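(* Let $I \subset \{1,\dots,r\}$ with $\#I = 2$ and let $T = D_I$ or $T = D_{I,\mathbb{R}}$. Let $g \in G$ and suppose that $T\pi(g)$ is a locally divergent orbit such that $\overline{T\pi(g)}$ is not an orbit of a torus. Then the orbit $T\pi(g)$ is a proper open subset of $\overline{T\pi(g)}$. In particular, $\overline{T\pi(g)}$ is not homogeneous.
   Context: $K$ is a number field, $\mathcal{O}$ its ring of integers, $K_1,\dots,K_r$ all its archimedean completions (each is $\mathbb{R}$ or $\mathbb{C}$); throughout $r \geq 2$. $G = \prod_{i=1}^r G_i$ with $G_i = \mathrm{SL}(2,K_i)$, and $\Gamma = \mathrm{SL}(2,\mathcal{O})$ is identified with its image in $G$ under the diagonal embedding. $\pi: G \to G/\Gamma$ is the natural projection. $D_i$ is the connected component of the identity of the diagonal subgroup of $G_i$, and $D_{i,\mathbb{R}}$ is the connected component of the identity of the subgroup of real matrices in $D_i$ (so $D_{i,\mathbb{R}} = D_i$ if $K_i = \mathbb{R}$). For non-empty $I \subset \{1,\dots,r\}$, $D_I = \prod_{i\in I} D_i$ and $D_{I,\mathbb{R}} = \prod_{i\in I} D_{i,\mathbb{R}}$, viewed as subgroups of $G$ (trivial in the coordinates outside $I$); $D = D_{\{1,\dots,r\}}$. A torus in $G$ is a subgroup conjugate to a closed connected subgroup of $D$. A subset of $G/\Gamma$ is an orbit of a torus if it equals $Sx$ for some torus $S$ and some $x \in G/\Gamma$. For a closed non-compact subgroup $H$ of $G$, the orbit $Hx$ is divergent if the orbit map $h \mapsto hx$ from $H$ to $G/\Gamma$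 is proper. The orbit $D_I\pi(g)$ is locally divergent if $D_i\pi(g)$ is divergent for every $i \in I$; the orbit $D_{I,\mathbb{R}}\pi(g)$ is locally divergent if and only if $D_I\pi(g)$ is. The closure $\overline{Tx}$ is homogeneous if $\overline{Tx} = Fx$ for some closed subgroup $F$ of $G$ containing $T$. *)

theory Defs
  imports "HOL-Analysis.Analysis" "HOL-Algebra.Coset"
begin

section \<open>Number fields and their archimedean completions\<close>

text \<open>A number field is a type \<open>'k\<close> of class \<open>field_char_0\<close> that is finite-dimensional over
  the rationals.\<close>

definition number_field :: "'k::field_char_0 itself \<Rightarrow> bool" where
  "number_field TYPE('k) \<longleftrightarrow>
     (\<exists>B. finite_dimensional_vector_space (\<lambda>(q::rat) (x::'k). of_rat q * x) B)"

definition absolute_value :: "('k::field \<Rightarrow> real) \<Rightarrow> bool" where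
  "absolute_value v \<longleftrightarrow>
     (\<forall>x. 0 \<le> v x) \<and> (\<forall>x. v x = 0 \<longleftrightarrow> x = 0) \<and>
     (\<forall>x y. v (x * y) = v x * v y) \<and> (\<forall>x y. v (x + y) \<le> v x + v y)"

definition archimedean_absolute_value :: "('k::field \<Rightarrow> real) \<Rightarrow> bool" where
  "archimedean_absolute_value v \<longleftrightarrow>
     absolute_value v \<and> \<not> (\<forall>x y. v (x + y) \<le> max (v x) (v y))"

definition equivalent_absolute_values :: "('k::field \<Rightarrow> real) \<Rightarrow> ('k \<Rightarrow> real) \<Rightarrow> bool" where
  "equivalent_absolute_values v w \<longleftrightarrow> (\<exists>s>0. \<forall>x. w x = v x powr s)"

definition field_embedding :: "('k::field \<Rightarrow> complex) \<Rightarrow> bool" where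
  "field_embedding \<tau> \<longleftrightarrow>
     \<tau> 0 = 0 \<and> \<tau> 1 = 1 \<and> (\<forall>x y. \<tau> (x + y) = \<tau> x + \<tau> y) \<and> (\<forall>x y. \<tau> (x * y) = \<tau> x * \<tau> y)"

text \<open>The completion of the field for the absolute value \<open>\<lambda>x. cmod (\<tau> x)\<close>, realised as the
  closure of the image in the complete field of complex numbers; see \<open>arch_completion_eq\<close>.\<close>

definition arch_completion :: "('k::field \<Rightarrow> complex) \<Rightarrow> complex set" where
  "arch_completion \<tau> = closure (range \<tau>)"

text \<open>The type \<open>'r\<close> plays the role of the index set \<open>{1,\<dots>,r}\<close>: every archimedean absolute value
  is equivalent to \<open>\<lambda>x. cmod (\<sigma> i x)\<close> for exactly one \<open>i\<close>.  Applied to \<open>\<lambda>x. cmod (\<sigma> j x)\<close>, the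
  uniqueness says that distinct indices give distinct places.\<close>

definition archimedean_places :: "('r \<Rightarrow> 'k::field \<Rightarrow> complex) \<Rightarrow> bool" where
  "archimedean_places \<sigma> \<longleftrightarrow>
     (\<forall>i. field_embedding (\<sigma> i)) \<and>
     (\<forall>v. archimedean_absolute_value v \<longrightarrow>
        (\<exists>!i. equivalent_absolute_values v (\<lambda>x. cmod (\<sigma> i x))))"

section \<open>The groups \<open>G\<close> and \<open>\<Gamma>\<close>\<close>

definition SL2 :: "'a::comm_ring_1 set \<Rightarrow> ('a^2^2) set" where
  "SL2 R = {A. (\<forall>a b. A $ a $ b \<in> R) \<and> det A = 1}"

definition G :: "('r::finite \<Rightarrow> 'k::field \<Rightarrow> complex) \<Rightarrow> (complex^2^2^'r) monoid" where
  "G \<sigma> = \<lparr>carrier = {g. \<forall>i. g $ i \<in> SL2 (arch_completion (\<sigma> i))},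
          mult = (\<lambda>g h. \<chi> i. g $ i ** h $ i), one = (\<chi> i. mat 1)\<rparr>"

definition \<Gamma> :: "('r::finite \<Rightarrow> 'k::field \<Rightarrow> complex) \<Rightarrow> (complex^2^2^'r) set" where
  "\<Gamma> \<sigma> = (\<lambda>A. \<chi> i a b. \<sigma> i (A $ a $ b)) ` SL2 {x. algebraic_int x}"

section \<open>The quotient \<open>G/\<Gamma>\<close>\<close>

definition \<pi> :: "('r::finite \<Rightarrow> 'k::field \<Rightarrow> complex) \<Rightarrow> complex^2^2^'r \<Rightarrow> (complex^2^2^'r) set" where
  "\<pi> \<sigma> g = g <#\<^bsub>G \<sigma>\<^esub> \<Gamma> \<sigma>"

abbreviation top_G :: "('r::finite \<Rightarrow> 'k::field \<Rightarrow> complex) \<Rightarrow> (complex^2^2^'r) topology" where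
  "top_G \<sigma> \<equiv> top_of_set (carrier (G \<sigma>))"

text \<open>The quotient topology; see \<open>quotient_map_\<pi>\<close>.\<close>

definition quot_top :: "('r::finite \<Rightarrow> 'k::field \<Rightarrow> complex) \<Rightarrow> (complex^2^2^'r) set topology" where
  "quot_top \<sigma> = topology (\<lambda>U. U \<subseteq> \<pi> \<sigma> ` carrier (G \<sigma>) \<and>
                          openin (top_G \<sigma>) {g \<in> carrier (G \<sigma>). \<pi> \<sigma> g \<in> U})"

text \<open>Points of \<open>G/\<Gamma>\<close> are left cosets, on which \<open>h\<close> acts by \<open>x \<mapsto> hx\<close>.\<close>

definition coset_orbit :: "('r::finite \<Rightarrow> 'k::field \<Rightarrow> complex) \<Rightarrow> (complex^2^2^'r) set \<Rightarrow>
    (complex^2^2^'r) set \<Rightarrow> (complex^2^2^'r) set set" where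
  "coset_orbit \<sigma> H x = (\<lambda>h. h <#\<^bsub>G \<sigma>\<^esub> x) ` H"

section \<open>Tori\<close>

definition diag_SL2 :: "complex set \<Rightarrow> (complex^2^2) set" where
  "diag_SL2 R = {A \<in> SL2 R. \<forall>a b. a \<noteq> b \<longrightarrow> A $ a $ b = 0}"

definition D_factor :: "('k::field \<Rightarrow> complex) \<Rightarrow> (complex^2^2) set" where
  "D_factor \<tau> = connected_component_set (diag_SL2 (arch_completion \<tau>)) (mat 1)"

definition DR_factor :: "('k::field \<Rightarrow> complex) \<Rightarrow> (complex^2^2) set" where
  "DR_factor \<tau> = connected_component_set {A \<in> D_factor \<tau>. \<forall>a b. A $ a $ b \<in> \<real>} (mat 1)"

definition D :: "('r::finite \<Rightarrow> 'k::field \<Rightarrow> complex) \<Rightarrow> 'r set \<Rightarrow> (complex^2^2^'r) set" where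
  "D \<sigma> I = {g. \<forall>i. g $ i \<in> (if i \<in> I then D_factor (\<sigma> i) else {mat 1})}"

definition DR :: "('r::finite \<Rightarrow> 'k::field \<Rightarrow> complex) \<Rightarrow> 'r set \<Rightarrow> (complex^2^2^'r) set" where
  "DR \<sigma> I = {g. \<forall>i. g $ i \<in> (if i \<in> I then DR_factor (\<sigma> i) else {mat 1})}"

definition torus :: "('r::finite \<Rightarrow> 'k::field \<Rightarrow> complex) \<Rightarrow> (complex^2^2^'r) set \<Rightarrow> bool" where
  "torus \<sigma> S \<longleftrightarrow>
     (\<exists>H g. subgroup H (G \<sigma>) \<and> H \<subseteq> D \<sigma> UNIV \<and> closedin (top_G \<sigma>) H \<and> connected H \<and>
        g \<in> carrier (G \<sigma>) \<and>
        S = (\<lambda>h. g \<otimes>\<^bsub>G \<sigma>\<^esub> h \<otimes>\<^bsub>G \<sigma>\<^esub> inv\<^bsub>G \<sigma>\<^esub> g) ` H)"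

definition torus_orbit ::
    "('r::finite \<Rightarrow> 'k::field \<Rightarrow> complex) \<Rightarrow> (complex^2^2^'r) set set \<Rightarrow> bool" where
  "torus_orbit \<sigma> X \<longleftrightarrow> (\<exists>S x. torus \<sigma> S \<and> x \<in> topspace (quot_top \<sigma>) \<and> X = coset_orbit \<sigma> S x)"

section \<open>Divergent orbits and homogeneous closures\<close>

definition divergent :: "('r::finite \<Rightarrow> 'k::field \<Rightarrow> complex) \<Rightarrow> (complex^2^2^'r) set \<Rightarrow>
    (complex^2^2^'r) set \<Rightarrow> bool" where
  "divergent \<sigma> H x \<longleftrightarrow>
     subgroup H (G \<sigma>) \<and> closedin (top_G \<sigma>) H \<and> \<not> compact H \<and>
     proper_map (top_of_set H) (quot_top \<sigma>) (\<lambda>h. h <#\<^bsub>G \<sigma>\<^esub> x)"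

text \<open>Local divergence is the same condition for the orbits of \<open>D \<sigma> I\<close> and of \<open>DR \<sigma> I\<close>.\<close>

definition locally_divergent :: "('r::finite \<Rightarrow> 'k::field \<Rightarrow> complex) \<Rightarrow> 'r set \<Rightarrow>
    (complex^2^2^'r) set \<Rightarrow> bool" where
  "locally_divergent \<sigma> I x \<longleftrightarrow> (\<forall>i\<in>I. divergent \<sigma> (D \<sigma> {i}) x)"

definition orbit_closure :: "('r::finite \<Rightarrow> 'k::field \<Rightarrow> complex) \<Rightarrow> (complex^2^2^'r) set \<Rightarrow>
    (complex^2^2^'r) set \<Rightarrow> (complex^2^2^'r) set set" where
  "orbit_closure \<sigma> T x = quot_top \<sigma> closure_of coset_orbit \<sigma> T x"

definition homogeneous_closure :: "('r::finite \<Rightarrow> 'k::field \<Rightarrow> complex) \<Rightarrow> (complex^2^2^'r) set \<Rightarrow>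
    (complex^2^2^'r) set \<Rightarrow> bool" where
  "homogeneous_closure \<sigma> T x \<longleftrightarrow>
     (\<exists>F. subgroup F (G \<sigma>) \<and> closedin (top_G \<sigma>) F \<and> T \<subseteq> F \<and> orbit_closure \<sigma> T x = coset_orbit \<sigma> F x)"

section \<open>The definitions behave as intended\<close>

lemma openin_quot_top:
  "openin (quot_top \<sigma>) U \<longleftrightarrow>
     U \<subseteq> \<pi> \<sigma> ` carrier (G \<sigma>) \<and> openin (top_G \<sigma>) {g \<in> carrier (G \<sigma>). \<pi> \<sigma> g \<in> U}"
proof -
  let ?L = "\<lambda>U. U \<subseteq> \<pi> \<sigma> ` carrier (G \<sigma>) \<and> openin (top_G \<sigma>) {g \<in> carrier (G \<sigma>). \<pi> \<sigma> g \<in> U}"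
  have "istopology ?L"
    unfolding istopology_def
  proof (intro conjI allI impI)
    fix S T assume "?L S" "?L T"
    moreover have "{g \<in> carrier (G \<sigma>). \<pi> \<sigma> g \<in> S \<inter> T} =
        {g \<in> carrier (G \<sigma>). \<pi> \<sigma> g \<in> S} \<inter> {g \<in> carrier (G \<sigma>). \<pi> \<sigma> g \<in> T}"
      by auto
    ultimately show "S \<inter> T \<subseteq> \<pi> \<sigma> ` carrier (G \<sigma>)"
        "openin (top_G \<sigma>) {g \<in> carrier (G \<sigma>). \<pi> \<sigma> g \<in> S \<inter> T}"
      by (auto intro: openin_Int simp del: openin_subtopology)
  next
    fix \<K> assume *: "\<forall>K\<in>\<K>. ?L K"
    then show "\<Union>\<K> \<subseteq> \<pi> \<sigma> ` carrier (G \<sigma>)"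
      by blast
    have "{g \<in> carrier (G \<sigma>). \<pi> \<sigma> g \<in> \<Union>\<K>} = (\<Union>K\<in>\<K>. {g \<in> carrier (G \<sigma>). \<pi> \<sigma> g \<in> K})"
      by auto
    then show "openin (top_G \<sigma>) {g \<in> carrier (G \<sigma>). \<pi> \<sigma> g \<in> \<Union>\<K>}"
      using * by (metis (no_types, lifting) imageE openin_Union)
  qed
  then show ?thesis
    unfolding quot_top_def by simp
qed

lemma topspace_quot_top: "topspace (quot_top \<sigma>) = \<pi> \<sigma> ` carrier (G \<sigma>)"
proof
  show "topspace (quot_top \<sigma>) \<subseteq> \<pi> \<sigma> ` carrier (G \<sigma>)"
    by (meson openin_quot_top openin_topspace)
  have "{g \<in> carrier (G \<sigma>). \<pi> \<sigma> g \<in> \<pi> \<sigma> ` carrier (G \<sigma>)} = carrier (G \<sigma>)"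
    by auto
  then have "openin (quot_top \<sigma>) (\<pi> \<sigma> ` carrier (G \<sigma>))"
    unfolding openin_quot_top by (metis openin_subtopology_self subset_refl)
  then show "\<pi> \<sigma> ` carrier (G \<sigma>) \<subseteq> topspace (quot_top \<sigma>)"
    by (rule openin_subset)
qed

lemma quotient_map_\<pi>: "quotient_map (top_G \<sigma>) (quot_top \<sigma>) (\<pi> \<sigma>)"
  unfolding quotient_map_def topspace_quot_top
  by (auto simp: openin_quot_top simp del: openin_subtopology)

lemma embedding_of_rat:
  fixes \<tau> :: "'k::field_char_0 \<Rightarrow> complex"
  assumes "field_embedding \<tau>"
  shows "\<tau> (of_rat q) = of_rat q"
proof -
  have add: "\<tau> (x + y) = \<tau> x + \<tau> y" and mult: "\<tau> (x * y) = \<tau> x * \<tau> y" for x y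
    using assms by (auto simp: field_embedding_def)
  have "\<tau> 0 = 0" and "\<tau> 1 = 1"
    using assms by (auto simp: field_embedding_def)
  have minus: "\<tau> (- x) = - \<tau> x" for x
    using add[of x "- x"] \<open>\<tau> 0 = 0\<close> by (simp add: eq_neg_iff_add_eq_0 add.commute)
  have nat: "\<tau> (of_nat n) = of_nat n" for n
    by (induction n) (simp_all add: \<open>\<tau> 0 = 0\<close> \<open>\<tau> 1 = 1\<close> add)
  have int: "\<tau> (of_int z) = of_int z" for z
    by (cases z rule: int_cases2) (simp_all add: nat minus)
  obtain a b where q: "q = Fract a b" "b > 0"
    by (cases q) auto
  have "\<tau> (of_rat q) * of_int b = \<tau> (of_rat q * of_int b)"
    by (simp add: mult int)
  also have "of_rat q * of_int b = (of_int a :: 'k)"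
    using q by (simp add: of_rat_rat)
  finally show ?thesis
    using q by (simp add: int of_rat_rat field_simps)
qed

lemma arch_completion_closed:
  assumes "field_embedding \<tau>" "x \<in> arch_completion \<tau>" "y \<in> arch_completion \<tau>"
  shows "x + y \<in> arch_completion \<tau>" "x * y \<in> arch_completion \<tau>"
proof -
  obtain f g where f: "\<And>n. f n \<in> range \<tau>" "f \<longlonglongrightarrow> x" and g: "\<And>n. g n \<in> range \<tau>" "g \<longlonglongrightarrow> y"
    using assms(2,3) unfolding arch_completion_def closure_sequential by metis
  have "f n + g n \<in> range \<tau>" "f n * g n \<in> range \<tau>" for n
  proof -
    obtain a b where "f n = \<tau> a" "g n = \<tau> b"
      using f(1)[of n] g(1)[of n] by blast
    then have "f n + g n = \<tau> (a + b)" "f n * g n = \<tau> (a * b)"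
      using assms(1) by (simp_all add: field_embedding_def)
    then show "f n + g n \<in> range \<tau>" "f n * g n \<in> range \<tau>"
      by simp_all
  qed
  then show "x + y \<in> arch_completion \<tau>" "x * y \<in> arch_completion \<tau>"
    unfolding arch_completion_def closure_sequential
    using tendsto_add[OF f(2) g(2)] tendsto_mult[OF f(2) g(2)] by fast+
qed

lemma Reals_subset_arch_completion:
  fixes \<tau> :: "'k::field_char_0 \<Rightarrow> complex"
  assumes "field_embedding \<tau>"
  shows "\<real> \<subseteq> arch_completion \<tau>"
proof
  fix z :: complex assume "z \<in> \<real>"
  then obtain t where t: "z = of_real t"
    by (auto elim: Reals_cases)
  show "z \<in> arch_completion \<tau>"
    unfolding arch_completion_def closure_approachable
  proof (intro allI impI)
    fix e :: real assume "0 < e"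
    then obtain q where q: "t < of_rat q" "of_rat q < t + e"
      using of_rat_dense[of t "t + e"] by auto
    have "\<tau> (of_rat q) = of_real (of_rat q)"
      unfolding embedding_of_rat[OF assms] by (cases q) (simp add: of_rat_rat)
    moreover have "dist (complex_of_real (of_rat q)) z < e"
      using q by (simp add: t dist_norm flip: of_real_diff)
    ultimately show "\<exists>y\<in>range \<tau>. dist y z < e"
      by (metis rangeI)
  qed
qed

lemma arch_completion_eq:
  fixes \<tau> :: "'k::field_char_0 \<Rightarrow> complex"
  assumes "field_embedding \<tau>"
  shows "arch_completion \<tau> = (if range \<tau> \<subseteq> \<real> then \<real> else UNIV)"
proof (cases "range \<tau> \<subseteq> \<real>")
  case True
  then have "arch_completion \<tau> \<subseteq> \<real>"
    unfolding arch_completion_def by (simp add: closure_minimal closed_complex_Reals)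
  with True show ?thesis
    using Reals_subset_arch_completion[OF assms] by auto
next
  case False
  then obtain x where x: "Im (\<tau> x) \<noteq> 0"
    unfolding image_subset_iff complex_is_Real_iff by blast
  have "z \<in> arch_completion \<tau>" for z
  proof -
    define b where "b = Im z / Im (\<tau> x)"
    define a where "a = Re z - b * Re (\<tau> x)"
    have "z = of_real a + of_real b * \<tau> x"
      using x by (simp add: complex_eq_iff a_def b_def)
    moreover have "of_real a \<in> arch_completion \<tau>" "of_real b \<in> arch_completion \<tau>"
      using Reals_subset_arch_completion[OF assms] by auto
    moreover have "\<tau> x \<in> arch_completion \<tau>"
      unfolding arch_completion_def using closure_subset[of "range \<tau>"] by blast
    ultimately show ?thesis
      using arch_completion_closed[OF assms] by metis
  qed
  with False show ?thesis
    by auto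
qed

lemma group_G:
  fixes \<sigma> :: "'r::finite \<Rightarrow> 'k::field_char_0 \<Rightarrow> complex"
  assumes \<sigma>: "\<And>i. field_embedding (\<sigma> i)"
  shows "group (G \<sigma>)"
proof -
  have real: "z \<in> arch_completion (\<sigma> i)" if "z \<in> \<real>" for z i
    using Reals_subset_arch_completion[OF \<sigma>[of i]] that by blast
  have neg: "- z \<in> arch_completion (\<sigma> i)" if "z \<in> arch_completion (\<sigma> i)" for z i
    using arch_completion_closed(2)[OF \<sigma> real[of "-1"] that] by simp
  have one: "mat 1 \<in> SL2 (arch_completion (\<sigma> i))" for i
    using real by (simp add: SL2_def) (simp add: mat_def)
  have mult: "A ** B \<in> SL2 (arch_completion (\<sigma> i))"
    if "A \<in> SL2 (arch_completion (\<sigma> i))" "B \<in> SL2 (arch_completion (\<sigma> i))" for A B i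
    using that arch_completion_closed[OF \<sigma>[of i]]
    by (simp add: SL2_def det_mul) (simp add: matrix_matrix_mult_def sum_2)
  have inv: "\<exists>B\<in>SL2 (arch_completion (\<sigma> i)). B ** A = mat 1" if A: "A \<in> SL2 (arch_completion (\<sigma> i))" for A i
  proof
    let ?B = "vector [vector [A $ 2 $ 2, - A $ 1 $ 2], vector [- A $ 2 $ 1, A $ 1 $ 1]] :: complex^2^2"
    show "?B \<in> SL2 (arch_completion (\<sigma> i))"
      using A neg by (auto simp: SL2_def det_2 forall_2 algebra_simps)
    show "?B ** A = mat 1"
      using A by (auto simp: SL2_def det_2 matrix_matrix_mult_def mat_def vec_eq_iff forall_2 sum_2
          algebra_simps)
  qed
  show ?thesis
  proof (rule groupI)
    fix g assume g: "g \<in> carrier (G \<sigma>)"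
    then have "\<forall>i. \<exists>B\<in>SL2 (arch_completion (\<sigma> i)). B ** g $ i = mat 1"
      using inv by (auto simp: G_def)
    then obtain h where "\<And>i. h i \<in> SL2 (arch_completion (\<sigma> i)) \<and> h i ** g $ i = mat 1"
      by metis
    then show "\<exists>h\<in>carrier (G \<sigma>). h \<otimes>\<^bsub>G \<sigma>\<^esub> g = \<one>\<^bsub>G \<sigma>\<^esub>"
      by (intro bexI[of _ "\<chi> i. h i"]) (auto simp: G_def vec_eq_iff)
  qed (auto simp: G_def one mult matrix_mul_assoc vec_eq_iff)
qed

end

theory Submission
  imports Defs "HOL-Computational_Algebra.Fundamental_Theorem_Algebra"
begin

text \<open>Let \<open>O\<close> be the ring of integers of the field and \<open>T\<close> the given torus, with active
  places \<open>i\<close> and \<open>i'\<close>.  The theorem is about the question whether the orbit of \<open>T\<close> through \<open>\<pi> \<sigma> g\<close> comes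
  back to its starting point: \<open>g\<close> is called recurrent if \<open>t\<^sub>k g \<gamma>\<^sub>k \<rightarrow> g\<close> for some unbounded sequence
  \<open>t\<^sub>k\<close> in \<open>T\<close> and some \<open>\<gamma>\<^sub>k\<close> in \<open>\<Gamma> \<sigma>\<close>.

  Suppose that \<open>g\<close> is not recurrent.  A limit of points of \<open>T g (\<Gamma> \<sigma>)\<close> either comes from a bounded part
  of \<open>T\<close>, and then lies on the orbit, or from an unbounded sequence.  Limits of the second kind cannot
  accumulate at the orbit, since a translate of such a sequence would return to \<open>g\<close>.  So the orbit is open in
  its closure (\<open>closed_boundary\<close>).  If the closure were \<open>F \<pi>(g)\<close> for a closed subgroup \<open>F\<close> containing
  \<open>T\<close>, then \<open>T\<close> would be open in \<open>F\<close>; as \<open>T\<close> is connected, \<open>F\<close> would normalise it, all orbits of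
  \<open>T\<close> in \<open>F \<pi>(g)\<close> would be open, and the orbit would be closed (\<open>open_orbit_not_homogeneous\<close>).  But a
  closed orbit of \<open>T\<close> is a torus orbit.

  It remains to see that the closure is a torus orbit when \<open>g\<close> is recurrent.  Local divergence enters through
  rational lines: if the orbit of the one-place torus \<open>D \<sigma> {j}\<close> diverges, then each row of the matrix
  \<open>g $ j\<close> annihilates a non-zero vector of \<open>O\<^sup>2\<close> (\<open>divergent_imp_rational_zero\<close>).  For recurrent \<open>g\<close>
  both components of \<open>t\<^sub>k\<close> must go to infinity, and one picks \<open>v\<close> and \<open>v'\<close> in \<open>O\<^sup>2\<close> that are contracted by
  \<open>t\<^sub>k g\<close> at \<open>i\<close> and at \<open>i'\<close>.  The vectors \<open>inverse \<gamma>\<^sub>k v\<close> are integral, and the inequality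
  \<open>\<Prod>\<^sub>j |\<alpha>|\<^sub>j \<ge> 1\<close> for the normalised absolute values of a non-zero \<open>\<alpha> \<in> O\<close> forces them to stay on the line of \<open>v\<close>; the same holds for \<open>v'\<close>.
  Comparing the rows in \<open>t\<^sub>k g \<gamma>\<^sub>k \<rightarrow> g\<close> one finds that the two rational lines at \<open>i\<close> are the two rational lines at
  \<open>i'\<close>, so that both \<open>g $ i\<close> and \<open>g $ i'\<close> are monomial matrices times one common matrix of \<open>SL\<^sub>2\<close> over
  the number field (\<open>expanding_both_imp_monomial\<close>).  Monomial matrices normalise \<open>T\<close>, which reduces the
  closure to that of the orbit of a rational point.  There it is the orbit of the closure of \<open>T \<Delta>\<close>, with \<open>\<Delta>\<close> the
  stabiliser in the full diagonal group, and because the identity component of a closed subgroup of a diagonal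
  group is open, one may replace this closure by a connected closed subgroup
  (\<open>rational_torus_orbit_closure\<close>).

  The arithmetic input is kept elementary.  An algebraic integer whose conjugates are all smaller than 1 vanishes
  (\<open>small_algebraic_int_eq_0\<close>), and the pigeonhole principle turns this into the product inequality
  (\<open>algebraic_int_norm_ge_1\<close>), into the finiteness of bounded sets of integers and of residue rings, and into
  short lattice vectors in very unbalanced boxes.\<close>

section \<open>Sums and products of algebraic integers\<close>

interpretation int_module: module "\<lambda>(n::int) (x::'a::field_char_0). of_int n * x"
  by unfold_locales (auto simp: algebra_simps)

text \<open>Induction on the generators: the coefficients of the new generator \<open>b\<close> that occur in \<open>N\<close> form an ideal of the
  integers, and a generator of this ideal contributes one new generator of \<open>N\<close>.\<close>

lemma int_submodule_finitely_generated:
  fixes B :: "'a::field_char_0 set"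
  assumes "finite B" "int_module.subspace N" "N \<subseteq> int_module.span B"
  shows "\<exists>C. finite C \<and> N = int_module.span C"
  using assms
proof (induction B arbitrary: N rule: finite_induct)
  case empty
  then have "N = int_module.span {}"
    using int_module.subspace_0 by fastforce
  then show ?case by blast
next
  case (insert b B)
  let ?N = "N \<inter> int_module.span B"
  have "int_module.subspace ?N"
    using insert.prems by (simp add: int_module.subspace_inter)
  then obtain C where C: "finite C" "?N = int_module.span C"
    using insert.IH[of ?N] by blast
  define P where "P k \<longleftrightarrow> (\<exists>x\<in>N. x - of_int k * b \<in> int_module.span B)" for k :: int
  have coef: "\<exists>k. x - of_int k * b \<in> int_module.span B" if "x \<in> N" for x
    using insert.prems(2) that int_module.span_breakdown_eq by blast
  have neg: "P (- k)" if Pk: "P k" for k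
  proof -
    obtain x where "x \<in> N" "x - of_int k * b \<in> int_module.span B"
      using Pk unfolding P_def by blast
    then have "- x \<in> N" "- x - of_int (- k) * b \<in> int_module.span B"
      using insert.prems(1) int_module.subspace_neg[of N x]
        int_module.span_neg[of "x - of_int k * b" B] by (simp_all add: algebra_simps)
    then show ?thesis
      unfolding P_def by blast
  qed
  show ?case
  \<comment> \<open>The coefficients of \<open>b\<close> in \<open>N\<close> are the \<open>k\<close> with \<open>P k\<close>; the least positive one generates the rest.\<close>
  proof (cases "\<exists>k>0. P k")
    case False
    have "x \<in> int_module.span B" if x: "x \<in> N" for x
    proof -
      obtain k where k: "x - of_int k * b \<in> int_module.span B"
        using coef x by blast
      then have "P k" using x P_def by blast
      then have "k = 0" using False neg[of k] by (metis linorder_neqE neg_0_less_iff_less)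
      with k show ?thesis by simp
    qed
    then have "?N = N" by blast
    then show ?thesis using C by auto
  next
    case True
    define d where "d = (LEAST n::nat. n > 0 \<and> P (int n))"
    have ex: "\<exists>n::nat. n > 0 \<and> P (int n)"
      using True by (metis zero_less_imp_eq_int of_nat_0_less_iff)
    then have d: "d > 0" "P (int d)"
      unfolding d_def by (metis (mono_tags, lifting) LeastI_ex)+
    have least: "\<not> P k" if "0 < k" "k < int d" for k
      using that not_less_Least[of "nat k" "\<lambda>n. n > 0 \<and> P (int n)"] unfolding d_def by auto
    obtain x0 where x0: "x0 \<in> N" "x0 - of_int (int d) * b \<in> int_module.span B"
      using d(2) P_def by auto
    have "N = int_module.span (insert x0 C)"
    proof
      have "C \<subseteq> N" using C(2) int_module.span_superset by blast
      then show "int_module.span (insert x0 C) \<subseteq> N"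
        using insert.prems(1) x0(1) by (simp add: int_module.span_minimal)
    next
      show "N \<subseteq> int_module.span (insert x0 C)"
      proof
        fix x assume x: "x \<in> N"
        obtain k where k: "x - of_int k * b \<in> int_module.span B"
          using coef x by blast
        define q where "q = k div int d"
        define y where "y = x - of_int q * x0"
        have kq: "k = q * int d + k mod int d"
          unfolding q_def by simp
        have yN: "y \<in> N"
          unfolding y_def
          using insert.prems(1) x x0(1)
          by (intro int_module.subspace_diff int_module.subspace_scale)
        have "y - of_int (k mod int d) * b =
            (x - of_int k * b) - of_int q * (x0 - of_int (int d) * b)"
          unfolding y_def by (subst (2) kq) (simp add: algebra_simps)
        also have "\<dots> \<in> int_module.span B"
          by (intro int_module.span_diff int_module.span_scale k x0)
        finally have y: "y - of_int (k mod int d) * b \<in> int_module.span B" .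
        then have "P (k mod int d)" unfolding P_def using yN by blast
        then have "k mod int d = 0"
          using least[of "k mod int d"] d(1) by (smt (verit) of_nat_0_less_iff pos_mod_bound pos_mod_sign)
        then have "y \<in> int_module.span C" using y yN C(2) by auto
        then show "x \<in> int_module.span (insert x0 C)"
          unfolding y_def int_module.span_breakdown_eq by blast
      qed
    qed
    then show ?thesis using C(1) by blast
  qed
qed

lemma int_span_family:
  fixes f :: "'i \<Rightarrow> 'a::field_char_0"
  assumes "finite A" "x \<in> int_module.span (f ` A)"
  shows "\<exists>c. x = (\<Sum>k\<in>A. of_int (c k) * f k)"
proof -
  let ?S = "{\<Sum>k\<in>A. of_int (c k) * f k | c. True}"
  have "int_module.subspace ?S"
    unfolding int_module.subspace_def
  proof (intro conjI ballI allI)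
    show "0 \<in> ?S" by (auto intro!: exI[of _ "\<lambda>_. 0"])
    show "x + y \<in> ?S" if xy: "x \<in> ?S" "y \<in> ?S" for x y
    proof -
      obtain c where "x = (\<Sum>k\<in>A. of_int (c k) * f k)"
        using xy(1) by blast
      moreover obtain c' where "y = (\<Sum>k\<in>A. of_int (c' k) * f k)"
        using xy(2) by blast
      ultimately have "x + y = (\<Sum>k\<in>A. of_int (c k + c' k) * f k)"
        by (simp add: algebra_simps sum.distrib)
      then show ?thesis by (intro CollectI exI[of _ "\<lambda>k. c k + c' k"]) simp
    qed
    show "of_int n * x \<in> ?S" if x: "x \<in> ?S" for n x
    proof -
      obtain c where "x = (\<Sum>k\<in>A. of_int (c k) * f k)"
        using x by blast
      then have "of_int n * x = (\<Sum>k\<in>A. of_int (n * c k) * f k)"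
        by (simp add: algebra_simps sum_distrib_left)
      then show ?thesis by (intro CollectI exI[of _ "\<lambda>k. n * c k"]) simp
    qed
  qed
  moreover have "f ` A \<subseteq> ?S"
  proof
    fix x assume "x \<in> f ` A"
    then obtain a where a: "a \<in> A" "x = f a" by blast
    then have "x = (\<Sum>k\<in>A. of_int (if k = a then 1 else 0) * f k)"
      using assms(1) by (subst sum.remove[of A a]) (auto intro!: sum.neutral)
    then show "x \<in> ?S" by (intro CollectI exI[of _ "\<lambda>k. if k = a then 1 else 0"]) simp
  qed
  ultimately show ?thesis
    using int_module.span_minimal[of "f ` A" ?S] assms(2) by blast
qed

lemma algebraic_int_iff_power_combination:
  "algebraic_int (z::'a::field_char_0) \<longleftrightarrow>
     (\<exists>m (c::nat \<Rightarrow> int). z ^ m = (\<Sum>k<m. of_int (c k) * z ^ k))"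
proof
  assume "algebraic_int z"
  then obtain p :: "int poly" where p: "poly (map_poly of_int p) z = 0" "lead_coeff p = 1"
    unfolding algebraic_int_altdef_ipoly by blast
  have "poly (map_poly of_int p) z = (\<Sum>k\<le>degree p. of_int (coeff p k) * z ^ k)"
    by (simp add: poly_altdef coeff_map_poly degree_map_poly)
  also have "\<dots> = (\<Sum>k<degree p. of_int (coeff p k) * z ^ k) + z ^ degree p"
    using p(2) by (simp add: lessThan_Suc_atMost[symmetric])
  finally have "z ^ degree p = (\<Sum>k<degree p. of_int (- coeff p k) * z ^ k)"
    using p(1) by (simp add: sum_negf eq_neg_iff_add_eq_0 add.commute)
  then show "\<exists>m (c::nat \<Rightarrow> int). z ^ m = (\<Sum>k<m. of_int (c k) * z ^ k)"
    by (intro exI[of _ "degree p"] exI[of _ "\<lambda>k. - coeff p k"])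
next
  assume "\<exists>m (c::nat \<Rightarrow> int). z ^ m = (\<Sum>k<m. of_int (c k) * z ^ k)"
  then obtain m and c :: "nat \<Rightarrow> int" where mc: "z ^ m = (\<Sum>k<m. of_int (c k) * z ^ k)"
    by blast
  define q where "q = (\<Sum>k<m. monom (c k) k)"
  have cq: "coeff q k = (if k < m then c k else 0)" for k
    unfolding q_def by (simp add: coeff_sum)
  have cp: "coeff (monom 1 m - q) k = (if k < m then - c k else if k = m then 1 else 0)" for k
    using cq by auto
  have "degree (monom 1 m - q) = m"
  proof (rule antisym)
    show "degree (monom 1 m - q) \<le> m"
      by (rule degree_le) (simp add: cp del: coeff_diff)
    show "m \<le> degree (monom 1 m - q)"
      by (rule le_degree) (simp add: cp del: coeff_diff)
  qed
  moreover have "poly (map_poly of_int (monom 1 m - q)) z = 0"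
  proof -
    have "poly (map_poly of_int (monom 1 m - q)) z = (\<Sum>k\<le>m. of_int (coeff (monom 1 m - q) k) * z ^ k)"
      using calculation by (simp add: poly_altdef coeff_map_poly degree_map_poly del: coeff_diff)
    also have "\<dots> = z ^ m - (\<Sum>k<m. of_int (c k) * z ^ k)"
      unfolding cp by (simp add: lessThan_Suc_atMost[symmetric] sum_negf)
    finally show ?thesis using mc by simp
  qed
  ultimately show "algebraic_int z"
    unfolding algebraic_int_altdef_ipoly
    by (intro exI[of _ "monom 1 m - q"]) (auto simp: cp simp del: coeff_diff)
qed

text \<open>All products \<open>z ^ k * s\<close> lie in one finitely generated module, so the module that they span is finitely generated as
  well; hence some power is an integer combination of smaller ones.\<close>

lemma algebraic_int_if_stable_module:
  fixes z :: "'a::field_char_0"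
  assumes "finite B" "\<And>b. b \<in> B \<Longrightarrow> z * b \<in> int_module.span B"
    and s: "s \<in> int_module.span B" "s \<noteq> 0"
  shows "algebraic_int z"
proof -
  define f where "f k = z ^ k * s" for k
  have "int_module.subspace {x. z * x \<in> int_module.span B}"
    unfolding int_module.subspace_def
    by (auto simp: distrib_left int_module.span_zero int_module.span_add
        mult.left_commute[of z "of_int _"] intro: int_module.span_scale)
  then have "int_module.span B \<subseteq> {x. z * x \<in> int_module.span B}"
    using assms(2) by (intro int_module.span_minimal) auto
  then have stable: "z * x \<in> int_module.span B" if "x \<in> int_module.span B" for x
    using that by blast
  have "f k \<in> int_module.span B" for k
    by (induction k) (use s stable in \<open>auto simp: f_def mult.assoc\<close>)
  then have "int_module.span (range f) \<subseteq> int_module.span B"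
    by (intro int_module.span_minimal) auto
  then obtain C where C: "finite C" "int_module.span (range f) = int_module.span C"
    using int_submodule_finitely_generated[OF assms(1), of "int_module.span (range f)"]
    by auto
  let ?M = "\<lambda>m. int_module.span (f ` {..<m})"
  have mono: "?M m \<subseteq> ?M m'" if "m \<le> m'" for m m'
    using that by (intro int_module.span_mono image_mono) auto
  have "int_module.subspace (\<Union>m. ?M m)"
    unfolding int_module.subspace_def
  proof (intro conjI ballI allI)
    show "0 \<in> (\<Union>m. ?M m)" using int_module.span_zero by blast
    show "x + y \<in> (\<Union>m. ?M m)" if xy: "x \<in> (\<Union>m. ?M m)" "y \<in> (\<Union>m. ?M m)" for x y
    proof -
      obtain a b where "x \<in> ?M a" "y \<in> ?M b" using xy by blast
      then have "x \<in> ?M (max a b)" "y \<in> ?M (max a b)"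
        using mono[of a "max a b"] mono[of b "max a b"] by auto
      then show ?thesis using int_module.span_add by blast
    qed
    show "of_int c * x \<in> (\<Union>m. ?M m)" if x: "x \<in> (\<Union>m. ?M m)" for c x
    proof -
      obtain a where "x \<in> ?M a" using x by blast
      then have "of_int c * x \<in> ?M a" by (rule int_module.span_scale)
      then show ?thesis by blast
    qed
  qed
  moreover have "f k \<in> (\<Union>m. ?M m)" for k
    by (intro UN_I[of "Suc k"] int_module.span_base) auto
  ultimately have "int_module.span (range f) \<subseteq> (\<Union>m. ?M m)"
    by (intro int_module.span_minimal) auto
  then have "\<forall>c\<in>C. \<exists>m. c \<in> ?M m"
    using C(2) int_module.span_superset by blast
  then obtain mm where mm: "\<And>c. c \<in> C \<Longrightarrow> c \<in> ?M (mm c)"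
    by metis
  obtain m where m: "\<And>c. c \<in> C \<Longrightarrow> mm c \<le> m"
    using C(1) by (meson finite_nat_set_iff_bounded_le finite_imageI imageI)
  have "C \<subseteq> ?M m" using mm m mono by blast
  then have "int_module.span C \<subseteq> ?M m"
    by (intro int_module.span_minimal) auto
  then have "f m \<in> ?M m"
    using C(2) int_module.span_base[of "f m" "range f"] by auto
  then obtain c where "f m = (\<Sum>k<m. of_int (c k) * f k)"
    using int_span_family[of "{..<m}" "f m" f] by auto
  then have "z ^ m * s = (\<Sum>k<m. of_int (c k) * z ^ k) * s"
    unfolding f_def by (simp add: sum_distrib_right mult.assoc)
  then have "z ^ m = (\<Sum>k<m. of_int (c k) * z ^ k)"
    using s(2) by simp
  then show ?thesis
    unfolding algebraic_int_iff_power_combination by blast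
qed

text \<open>Both claims hold because multiplication by \<open>x\<close> and by \<open>y\<close> preserves the module spanned by the
  monomials \<open>x ^ i * y ^ j\<close> with bounded exponents.\<close>

lemma
  fixes x y :: "'a::field_char_0"
  assumes "algebraic_int x" "algebraic_int y"
  shows algebraic_int_add: "algebraic_int (x + y)"
    and algebraic_int_mult: "algebraic_int (x * y)"
proof -
  obtain m c where x: "x ^ m = (\<Sum>k<m. of_int (c k) * x ^ k)"
    using assms(1) unfolding algebraic_int_iff_power_combination by blast
  obtain n d where y: "y ^ n = (\<Sum>k<n. of_int (d k) * y ^ k)"
    using assms(2) unfolding algebraic_int_iff_power_combination by blast
  define B where "B = (\<lambda>(i, j). x ^ i * y ^ j) ` ({..<m} \<times> {..<n})"
  have fin: "finite B" unfolding B_def by simp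
  have inB: "x ^ i * y ^ j \<in> int_module.span B" if "i < m" "j < n" for i j
    unfolding B_def by (rule int_module.span_base) (use that in force)
  have xm: "x ^ m * y ^ j \<in> int_module.span B" if "j < n" for j
    unfolding x sum_distrib_right mult.assoc
    by (intro int_module.span_sum int_module.span_scale inB) (use that in auto)
  have yn: "x ^ i * y ^ n \<in> int_module.span B" if "i < m" for i
    unfolding y sum_distrib_left mult.left_commute[of "x ^ i"]
    by (intro int_module.span_sum int_module.span_scale inB) (use that in auto)
  have xB: "x * b \<in> int_module.span B" and yB: "y * b \<in> int_module.span B" if b: "b \<in> B" for b
  proof -
    obtain i j where ij: "i < m" "j < n" "b = x ^ i * y ^ j"
      using b unfolding B_def by (elim imageE) auto
    have "x ^ Suc i * y ^ j \<in> int_module.span B"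
      using inB[of "Suc i" j] xm[of j] ij by (cases "Suc i = m") auto
    then show "x * b \<in> int_module.span B" using ij by (simp add: mult.assoc)
    have "x ^ i * y ^ Suc j \<in> int_module.span B"
      using inB[of i "Suc j"] yn[of i] ij by (cases "Suc j = n") auto
    then show "y * b \<in> int_module.span B" using ij by (simp add: mult.left_commute)
  qed
  have mn: "m > 0" "n > 0"
    using x y by (auto intro!: Nat.gr0I)
  have one: "1 \<in> int_module.span B" using inB[of 0 0] mn by simp
  have "int_module.subspace {w. x * w \<in> int_module.span B}"
    unfolding int_module.subspace_def
    by (auto simp: distrib_left int_module.span_zero int_module.span_add
        mult.left_commute[of x "of_int _"] intro: int_module.span_scale)
  then have "int_module.span B \<subseteq> {w. x * w \<in> int_module.span B}"
    using xB by (intro int_module.span_minimal) auto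
  then have "x * y * b \<in> int_module.span B" if "b \<in> B" for b
    using yB[OF that] by (auto simp: mult.assoc)
  then show "algebraic_int (x * y)"
    by (rule algebraic_int_if_stable_module[OF fin _ one]) auto
  have "(x + y) * b \<in> int_module.span B" if "b \<in> B" for b
    using xB[OF that] yB[OF that] by (auto simp: distrib_right int_module.span_add)
  then show "algebraic_int (x + y)"
    by (rule algebraic_int_if_stable_module[OF fin _ one]) auto
qed

section \<open>Algebraic integers with small conjugates\<close>

interpretation rat_space: vector_space "\<lambda>(q::rat) (x::'a::field_char_0). of_rat q * x"
  by unfold_locales (auto simp: algebra_simps of_rat_add of_rat_mult)

lemma common_denominator:
  fixes r :: "'i \<Rightarrow> rat"
  assumes "finite A"
  shows "\<exists>N::int. N > 0 \<and> (\<forall>i\<in>A. of_int N * r i \<in> \<int>)"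
  using assms
proof (induction A rule: finite_induct)
  case empty
  then show ?case by (intro exI[of _ 1]) auto
next
  case (insert a A)
  then obtain N :: int where N: "N > 0" "\<forall>i\<in>A. of_int N * r i \<in> \<int>" by blast
  obtain p q where pq: "quotient_of (r a) = (p, q)" by force
  then have q: "q > 0" "r a = of_int p / of_int q"
    using quotient_of_denom_pos quotient_of_div by blast+
  have "of_int (q * N) * r i \<in> \<int>" if "i \<in> insert a A" for i
  proof (cases "i = a")
    case True
    then have "of_int (q * N) * r i = of_int (N * p)" using q by simp
    then show ?thesis by (metis Ints_of_int)
  next
    case False
    then have "of_int N * r i \<in> \<int>" using N that by blast
    then have "of_int q * (of_int N * r i) \<in> \<int>" by (rule Ints_mult[OF Ints_of_int])
    then show ?thesis unfolding of_int_mult mult.assoc .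
  qed
  then show ?case using N(1) q(1) by (intro exI[of _ "q * N"]) auto
qed

lemma number_field_finite_spanning:
  assumes "number_field TYPE('k::field_char_0)"
  shows "\<exists>B::'k set. finite B \<and> rat_space.span B = UNIV"
proof -
  obtain B :: "'k set" where "finite_dimensional_vector_space (\<lambda>(q::rat) (x::'k). of_rat q * x) B"
    using assms unfolding number_field_def by blast
  then interpret finite_dimensional_vector_space "\<lambda>(q::rat) (x::'k). of_rat q * x" B .
  show ?thesis using finite_Basis span_Basis by blast
qed

lemma rat_span_family:
  assumes "finite B" "rat_space.span B = (UNIV :: 'k::field_char_0 set)"
  shows "\<exists>q::'k \<Rightarrow> rat. x = (\<Sum>b\<in>B. of_rat (q b) * b)"
  using assms rat_space.span_finite[OF assms(1)] by auto

text \<open>After clearing denominators, multiplication by \<open>x\<close> preserves the module spanned by a rational basis.\<close>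

lemma int_multiple_algebraic_int:
  assumes "number_field TYPE('k::field_char_0)"
  shows "\<exists>N>0. algebraic_int (of_int N * (x::'k))"
proof -
  obtain B :: "'k set" where B: "finite B" "rat_space.span B = UNIV"
    using number_field_finite_spanning[OF assms] by blast
  have "\<forall>b. \<exists>q::'k \<Rightarrow> rat. x * b = (\<Sum>b'\<in>B. of_rat (q b') * b')"
    using rat_span_family[OF B] by blast
  then obtain q :: "'k \<Rightarrow> 'k \<Rightarrow> rat" where q: "\<And>b. x * b = (\<Sum>b'\<in>B. of_rat (q b b') * b')"
    by metis
  obtain N :: int where N: "N > 0" "\<forall>i\<in>B \<times> B. of_int N * (\<lambda>(b, b'). q b b') i \<in> \<int>"
    using common_denominator[of "B \<times> B"] B(1) by blast
  have stable: "of_int N * x * b \<in> int_module.span B" if b: "b \<in> B" for b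
  proof -
    have "\<exists>c::int. of_int N * q b b' = of_int c" if "b' \<in> B" for b'
      using N(2) b that by (auto elim!: Ints_cases)
    then obtain c where c: "\<And>b'. b' \<in> B \<Longrightarrow> of_int N * q b b' = of_int (c b')"
      by metis
    have "of_int N * x * b = (\<Sum>b'\<in>B. of_rat (of_int N * q b b') * b')"
      by (simp add: mult.assoc q sum_distrib_left of_rat_mult)
    also have "\<dots> = (\<Sum>b'\<in>B. of_int (c b') * b')"
      by (intro sum.cong) (simp_all add: c)
    also have "\<dots> \<in> int_module.span B"
      by (intro int_module.span_sum int_module.span_scale int_module.span_base)
    finally show ?thesis .
  qed
  have "\<exists>s\<in>B. s \<noteq> 0"
  proof (rule ccontr)
    assume "\<not> (\<exists>s\<in>B. s \<noteq> 0)"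
    then have "(1::'k) = 0"
      using rat_span_family[OF B, of 1] by (auto simp: sum.neutral)
    then show False by simp
  qed
  then obtain s where "s \<in> B" "s \<noteq> 0" by blast
  then have "algebraic_int (of_int N * x)"
    using algebraic_int_if_stable_module[OF B(1) stable, of s] int_module.span_base by blast
  then show ?thesis using N(1) by (intro exI[of _ N]) simp
qed

lemma number_field_integral_basis:
  assumes "number_field TYPE('k::field_char_0)"
  shows "\<exists>B::'k set. finite B \<and> rat_space.independent B \<and> rat_space.span B = UNIV \<and>
           (\<forall>b\<in>B. algebraic_int b)"
proof -
  obtain B0 :: "'k set" where B0: "finite B0" "rat_space.span B0 = UNIV"
    using number_field_finite_spanning[OF assms] by blast
  obtain N :: "'k \<Rightarrow> int" where N: "\<And>x. N x > 0" "\<And>x. algebraic_int (of_int (N x) * x)"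
    using int_multiple_algebraic_int[OF assms] by metis
  let ?B1 = "(\<lambda>x. of_int (N x) * x) ` B0"
  obtain B where B: "B \<subseteq> ?B1" "rat_space.independent B" "?B1 \<subseteq> rat_space.span B"
    using rat_space.maximal_independent_subset[of ?B1] by blast
  have "b \<in> rat_space.span B" if "b \<in> B0" for b
  proof -
    have "of_rat (inverse (of_int (N b))) * (of_int (N b) * b) \<in> rat_space.span B"
      using B(3) that by (intro rat_space.span_scale) auto
    also have "of_rat (inverse (of_int (N b))) * (of_int (N b) * b) = b"
      using N(1)[of b] by (simp add: of_rat_inverse)
    finally show ?thesis .
  qed
  then have "rat_space.span B0 \<subseteq> rat_space.span B"
    by (intro rat_space.span_minimal) auto
  then show ?thesis
    using B B0 N(2) by (intro exI[of _ B]) (auto intro: finite_subset)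
qed

lemma additive_of_int:
  fixes f :: "'a::ring_1 \<Rightarrow> 'b::ring_1"
  assumes "Modules.additive f"
  shows "f (of_int n * y) = of_int n * f y"
proof -
  have nat: "f (of_nat m * y) = of_nat m * f y" for m
    by (induction m) (simp_all add: additive.zero[OF assms] additive.add[OF assms] distrib_right)
  show ?thesis
    by (cases n rule: int_cases2) (simp_all add: nat additive.minus[OF assms])
qed

lemma additive_of_rat:
  fixes f :: "'a::field_char_0 \<Rightarrow> 'b::field_char_0"
  assumes "Modules.additive f"
  shows "f (of_rat q * y) = of_rat q * f y"
proof -
  obtain a b where q: "q = Fract a b" "b > 0" by (cases q) auto
  have "of_int b * f (of_rat q * y) = f (of_int b * (of_rat q * y))"
    by (simp add: additive_of_int[OF assms])
  also have "of_int b * (of_rat q * y) = of_int a * y"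
    using q by (simp add: of_rat_rat)
  finally have "of_int b * f (of_rat q * y) = of_int a * f y"
    by (simp add: additive_of_int[OF assms])
  then show ?thesis using q by (simp add: of_rat_rat field_simps)
qed

text \<open>The operator \<open>\<Prod>\<^sub>c (S - c)\<close> with \<open>S f y = f (x * y)\<close>.  Functions on which such operators act replace the
  tensor product of the number field with the complex numbers: an additive function that is an eigenfunction of all shifts is
  a multiple of an embedding.\<close>

fun shift_ops :: "'a::comm_ring_1 \<Rightarrow> complex list \<Rightarrow> ('a \<Rightarrow> complex) \<Rightarrow> 'a \<Rightarrow> complex" where
  "shift_ops x [] f = f"
| "shift_ops x (c # cs) f = shift_ops x cs (\<lambda>y. f (x * y) - c * f y)"

lemma shift_ops_commute:
  "shift_ops x cs (\<lambda>y. f (x * y) - c * f y) = (\<lambda>y. shift_ops x cs f (x * y) - c * shift_ops x cs f y)"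
proof (induction cs arbitrary: f)
  case (Cons d cs)
  have "(\<lambda>y. (f (x * (x * y)) - c * f (x * y)) - d * (f (x * y) - c * f y)) =
      (\<lambda>y. (f (x * (x * y)) - d * f (x * y)) - c * (f (x * y) - d * f y))"
    by (simp add: algebra_simps)
  then show ?case
    using Cons.IH[of "\<lambda>y. f (x * y) - d * f y"] by simp
qed simp

lemma shift_ops_additive:
  assumes "Modules.additive f"
  shows "Modules.additive (shift_ops x cs f)"
  using assms
proof (induction cs arbitrary: f)
  case (Cons c cs)
  interpret Modules.additive f by (rule Cons.prems)
  have "Modules.additive (\<lambda>y. f (x * y) - c * f y)"
    by unfold_locales (simp add: distrib_left add algebra_simps)
  then show ?case using Cons.IH by simp
qed simp

lemma shift_ops_eq_sum:
  "shift_ops x cs f y =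
     (\<Sum>i\<le>length cs. coeff (\<Prod>c\<leftarrow>cs. [:- c, 1:]) i * f (x ^ i * y))"
proof (induction cs arbitrary: f y)
  case Nil
  show ?case by simp
next
  case (Cons c cs)
  let ?q = "\<Prod>c\<leftarrow>cs. [:- c, 1:]" and ?n = "length cs"
  have "degree ?q \<le> ?n"
  proof (induction cs)
    case (Cons a cs)
    then show ?case
      using degree_mult_le[of "[:- a, 1:]" "\<Prod>c\<leftarrow>cs. [:- c, 1:]"]
      by (simp del: mult_pCons_left)
  qed simp
  then have top: "coeff ?q (Suc ?n) = 0"
    by (intro coeff_eq_0) simp
  have "(\<Sum>i\<le>Suc ?n. coeff ([:- c, 1:] * ?q) i * f (x ^ i * y)) =
      (\<Sum>i\<le>Suc ?n. coeff (pCons 0 ?q) i * f (x ^ i * y)) - c * (\<Sum>i\<le>Suc ?n. coeff ?q i * f (x ^ i * y))"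
    by (simp add: algebra_simps sum.distrib sum_subtractf sum_distrib_left del: sum.atMost_Suc)
  also have "(\<Sum>i\<le>Suc ?n. coeff (pCons 0 ?q) i * f (x ^ i * y)) =
      (\<Sum>i\<le>?n. coeff ?q i * f (x * (x ^ i * y)))"
    by (simp add: sum.atMost_Suc_shift mult.assoc del: sum.atMost_Suc)
  also have "(\<Sum>i\<le>Suc ?n. coeff ?q i * f (x ^ i * y)) = (\<Sum>i\<le>?n. coeff ?q i * f (x ^ i * y))"
    using top by simp
  finally have expand: "(\<Sum>i\<le>Suc ?n. coeff ([:- c, 1:] * ?q) i * f (x ^ i * y)) =
      (\<Sum>i\<le>?n. coeff ?q i * f (x * (x ^ i * y))) - c * (\<Sum>i\<le>?n. coeff ?q i * f (x ^ i * y))" .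
  have "shift_ops x (c # cs) f y =
      (\<Sum>i\<le>?n. coeff ?q i * (f (x * (x ^ i * y)) - c * f (x ^ i * y)))"
    using Cons.IH[of "\<lambda>y. f (x * y) - c * f y" y] by simp
  also have "\<dots> = (\<Sum>i\<le>?n. coeff ?q i * f (x * (x ^ i * y))) - c * (\<Sum>i\<le>?n. coeff ?q i * f (x ^ i * y))"
    unfolding sum_distrib_left sum_subtractf[symmetric] by (intro sum.cong) (auto simp: algebra_simps)
  finally show ?case
    unfolding expand[symmetric] by (simp only: list.map prod_list.Cons length_Cons)
qed

text \<open>The list consists of the complex roots of a monic integral equation of \<open>x\<close>, evaluated at the shift by \<open>x\<close>.\<close>

lemma algebraic_int_shift_ops_annihilate:
  assumes "algebraic_int (x::'k::field_char_0)"
  shows "\<exists>cs. \<forall>f. Modules.additive f \<longrightarrow> shift_ops x cs f = (\<lambda>y. 0)"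
proof -
  obtain p :: "int poly" where p: "poly (map_poly of_int p) x = 0" "lead_coeff p = 1"
    using assms unfolding algebraic_int_altdef_ipoly by blast
  let ?P = "map_poly of_int p :: complex poly"
  have deg: "degree ?P = degree p" and lead: "lead_coeff ?P = 1"
    using p(2) by (simp_all add: degree_map_poly coeff_map_poly)
  have "?P \<noteq> 0" using lead by auto
  then obtain A where A: "size A = degree ?P" "?P = (\<Prod>c\<in>#A. [:- c, 1:])"
    using alg_closed_imp_factorization[of ?P] lead by auto
  obtain cs where cs: "mset cs = A" by (metis ex_mset)
  have P: "?P = (\<Prod>c\<leftarrow>cs. [:- c, 1:])"
    using A(2) cs by (metis prod_mset_prod_list mset_map)
  have len: "length cs = degree p" using A(1) cs deg by auto
  have "shift_ops x cs f y = 0" if f: "Modules.additive f" for f y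
  proof -
    have "shift_ops x cs f y = (\<Sum>i\<le>degree p. f (of_int (coeff p i) * (x ^ i * y)))"
      unfolding shift_ops_eq_sum P[symmetric] len
      by (simp add: coeff_map_poly additive_of_int[OF f])
    also have "\<dots> = f (\<Sum>i\<le>degree p. of_int (coeff p i) * (x ^ i * y))"
      by (simp add: additive.sum[OF f])
    also have "(\<Sum>i\<le>degree p. of_int (coeff p i) * (x ^ i * y)) = poly (map_poly of_int p) x * y"
      by (simp add: poly_altdef degree_map_poly coeff_map_poly sum_distrib_right mult.assoc)
    finally show ?thesis using p(1) additive.zero[OF f] by simp
  qed
  then show ?thesis by blast
qed

text \<open>If a product of operators kills \<open>f\<close>, then the last intermediate result that is not zero is an eigenfunction.  The predicate
  \<open>P\<close> carries along the eigenvalue equations for other elements, which commute with the shifts.\<close>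

lemma shift_ops_eigenfunction:
  assumes "shift_ops x cs f = (\<lambda>y. 0)" "P f" "f \<noteq> (\<lambda>y. 0)"
    and step: "\<And>g c. P g \<Longrightarrow> P (\<lambda>y. g (x * y) - c * g y)"
  shows "\<exists>g c. P g \<and> g \<noteq> (\<lambda>y. 0) \<and> (\<forall>y. g (x * y) = c * g y)"
  using assms(1-3)
proof (induction cs arbitrary: f)
  case (Cons c cs)
  show ?case
  proof (cases "(\<lambda>y. f (x * y) - c * f y) = (\<lambda>y. 0)")
    case True
    then show ?thesis using Cons.prems by (metis eq_iff_diff_eq_0)
  next
    case False
    then show ?thesis using Cons.IH[of "\<lambda>y. f (x * y) - c * f y"] Cons.prems step by auto
  qed
qed simp

lemma joint_eigenfunction:
  fixes S :: "'k::field_char_0 set" and f :: "'k \<Rightarrow> complex"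
  assumes "finite S" "\<forall>x\<in>S. algebraic_int x"
    and "Modules.additive f" "f \<noteq> (\<lambda>y. 0)" "\<And>y. f (\<alpha> * y) = c * f y"
  shows "\<exists>h. Modules.additive h \<and> h \<noteq> (\<lambda>y. 0) \<and> (\<forall>y. h (\<alpha> * y) = c * h y) \<and>
           (\<forall>x\<in>S. \<exists>m. \<forall>y. h (x * y) = m * h y)"
  using assms(1,2)
proof (induction S rule: finite_induct)
  case empty
  then show ?case using assms(3-5) by auto
next
  case (insert x S)
  then obtain h where h: "Modules.additive h" "h \<noteq> (\<lambda>y. 0)" "\<forall>y. h (\<alpha> * y) = c * h y"
    "\<forall>x\<in>S. \<exists>m. \<forall>y. h (x * y) = m * h y"
    by auto
  define P where "P g \<longleftrightarrow> Modules.additive g \<and> (\<forall>y. g (\<alpha> * y) = c * g y) \<and>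
    (\<forall>x\<in>S. \<exists>m. \<forall>y. g (x * y) = m * g y)" for g
  obtain cs where "shift_ops x cs h = (\<lambda>y. 0)"
    using algebraic_int_shift_ops_annihilate[of x] insert.prems h(1) by blast
  moreover have "P h" using h P_def by blast
  moreover have "P (\<lambda>y. g (x * y) - d * g y)" if g: "P g" for g d
    unfolding P_def
  proof (intro conjI ballI allI)
    interpret Modules.additive g using g P_def by blast
    show "Modules.additive (\<lambda>y. g (x * y) - d * g y)"
      by unfold_locales (simp add: distrib_left add algebra_simps)
    show "g (x * (\<alpha> * y)) - d * g (\<alpha> * y) = c * (g (x * y) - d * g y)" for y
      using g unfolding P_def by (simp add: mult.left_commute[of x] right_diff_distrib)
    fix z assume "z \<in> S"
    then obtain m where "\<And>y. g (z * y) = m * g y" using g P_def by blast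
    then have "\<forall>y. g (x * (z * y)) - d * g (z * y) = m * (g (x * y) - d * g y)"
      by (simp add: mult.left_commute[of x] right_diff_distrib)
    then show "\<exists>m. \<forall>y. g (x * (z * y)) - d * g (z * y) = m * (g (x * y) - d * g y)" by blast
  qed
  ultimately obtain g m where "P g" "g \<noteq> (\<lambda>y. 0)" "\<forall>y. g (x * y) = m * g y"
    using shift_ops_eigenfunction[of x cs h P] h(2) by blast
  then show ?case unfolding P_def by (intro exI[of _ g]) auto
qed

text \<open>Passing to a joint eigenfunction \<open>h\<close> for a basis, every \<open>x\<close> acts on \<open>h\<close> by a scalar, and the scalar depends
  multiplicatively and additively on \<open>x\<close>.  This is the existence of an embedding with prescribed conjugate of \<open>\<alpha>\<close>.\<close>

lemma eigenvalue_of_embedding: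
  assumes "number_field TYPE('k::field_char_0)"
    and f: "Modules.additive (f :: 'k \<Rightarrow> complex)" "f \<noteq> (\<lambda>y. 0)" "\<And>y. f (\<alpha> * y) = c * f y"
  shows "\<exists>\<tau>. field_embedding \<tau> \<and> \<tau> \<alpha> = c"
proof -
  obtain B :: "'k set" where B: "finite B" "rat_space.span B = UNIV" "\<forall>b\<in>B. algebraic_int b"
    using number_field_integral_basis[OF assms(1)] by (elim exE conjE) (rule that)
  obtain h where h: "Modules.additive h" "h \<noteq> (\<lambda>y. 0)" "\<forall>y. h (\<alpha> * y) = c * h y"
    "\<forall>x\<in>B. \<exists>m. \<forall>y. h (x * y) = m * h y"
    using joint_eigenfunction[OF B(1) B(3) f] by (elim exE conjE) (rule that)
  interpret Modules.additive h by (rule h(1))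
  have "rat_space.subspace {x. \<exists>m. \<forall>y. h (x * y) = m * h y}"
    unfolding rat_space.subspace_def
  proof (intro conjI ballI allI)
    show "0 \<in> {x. \<exists>m. \<forall>y. h (x * y) = m * h y}"
      by (auto simp: zero intro!: exI[of _ 0])
    fix x assume "x \<in> {x. \<exists>m. \<forall>y. h (x * y) = m * h y}"
    then obtain m where m: "\<forall>y. h (x * y) = m * h y" by blast
    show "of_rat q * x \<in> {x. \<exists>m. \<forall>y. h (x * y) = m * h y}" for q
      using m by (auto simp: mult.assoc additive_of_rat[OF h(1)] intro!: exI[of _ "of_rat q * m"])
    fix z assume "z \<in> {x. \<exists>m. \<forall>y. h (x * y) = m * h y}"
    then obtain n where "\<forall>y. h (z * y) = n * h y" by blast
    then show "x + z \<in> {x. \<exists>m. \<forall>y. h (x * y) = m * h y}"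
      using m by (auto simp: distrib_right add intro!: exI[of _ "m + n"])
  qed
  then have "rat_space.span B \<subseteq> {x. \<exists>m. \<forall>y. h (x * y) = m * h y}"
    using h(4) by (intro rat_space.span_minimal) auto
  then have "\<forall>x. \<exists>m. \<forall>y. h (x * y) = m * h y" using B(2) by blast
  then obtain m where m: "\<And>x y. h (x * y) = m x * h y" by metis
  have h1: "h 1 \<noteq> 0"
  proof
    assume "h 1 = 0"
    then have "h y = 0" for y using m[of y 1] by simp
    then show False using h(2) by auto
  qed
  have hm: "h x = m x * h 1" for x using m[of x 1] by simp
  have "field_embedding m"
    unfolding field_embedding_def
  proof (intro conjI allI)
    show "m 0 = 0" using hm[of 0] h1 zero by simp
    show "m 1 = 1" using hm[of 1] h1 by simp
    show "m (x + y) = m x + m y" for x y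
      using hm[of "x + y"] hm[of x] hm[of y] h1 add[of x y]
      by (metis distrib_right mult_right_cancel)
    show "m (x * y) = m x * m y" for x y
      using hm[of "x * y"] m[of x y] hm[of y] h1 by (simp add: mult.assoc[symmetric])
  qed
  moreover have "m \<alpha> = c"
    using hm[of \<alpha>] h(3) h1 by (metis mult.right_neutral mult_right_cancel)
  ultimately show ?thesis by blast
qed

lemma geometric_recurrence_tendsto_0:
  fixes a e :: "nat \<Rightarrow> complex"
  assumes "cmod c < 1" "e \<longlonglongrightarrow> 0" "\<And>k. a (Suc k) = c * a k + e k"
  shows "a \<longlonglongrightarrow> 0"
proof (rule LIMSEQ_I)
  fix r :: real assume r: "r > 0"
  define \<delta> where "\<delta> = (1 - cmod c) * (r / 2)"
  have "\<delta> > 0" using assms(1) r by (simp add: \<delta>_def)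
  then obtain K where K: "\<And>k. k \<ge> K \<Longrightarrow> cmod (e k) < \<delta>"
    using LIMSEQ_D[OF assms(2)] by (metis diff_zero)
  have bound: "cmod (a (K + n)) \<le> cmod c ^ n * cmod (a K) + r / 2" for n
  proof (induction n)
    case (Suc n)
    have "cmod (a (K + Suc n)) \<le> cmod c * cmod (a (K + n)) + \<delta>"
      using norm_triangle_ineq[of "c * a (K + n)" "e (K + n)"] K[of "K + n"] assms(3)[of "K + n"]
      by (simp add: norm_mult)
    also have "\<dots> \<le> cmod c * (cmod c ^ n * cmod (a K) + r / 2) + \<delta>"
      using Suc by (intro add_right_mono mult_left_mono) auto
    also have "\<dots> = cmod c ^ Suc n * cmod (a K) + r / 2"
      by (simp add: \<delta>_def field_simps)
    finally show ?case .
  qed (use r in simp)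
  have "(\<lambda>n. cmod c ^ n * cmod (a K)) \<longlonglongrightarrow> 0"
    using assms(1) by (intro tendsto_mult_left_zero LIMSEQ_power_zero) simp
  then obtain M where M: "\<And>n. n \<ge> M \<Longrightarrow> cmod c ^ n * cmod (a K) < r / 2"
    using order_tendstoD(2)[of _ 0 sequentially "r / 2"] r
    unfolding eventually_sequentially by (metis half_gt_zero)
  have "cmod (a n) < r" if n: "n \<ge> K + M" for n
  proof -
    have "K + (n - K) = n" "M \<le> n - K" using n by auto
    then show ?thesis using bound[of "n - K"] M[of "n - K"] by simp
  qed
  then show "\<exists>no. \<forall>n\<ge>no. cmod (a n - 0) < r" by auto
qed

locale arch_number_field =
  fixes \<sigma> :: "'r::finite \<Rightarrow> 'k::field_char_0 \<Rightarrow> complex"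
  assumes number_field: "number_field TYPE('k)" and places: "archimedean_places \<sigma>"
begin

text \<open>Every embedding defines an archimedean absolute value, which is a power of one of the given ones.\<close>

lemma embedding_lt_1:
  assumes "field_embedding \<tau>" "\<And>j. cmod (\<sigma> j \<alpha>) < 1"
  shows "cmod (\<tau> \<alpha>) < 1"
proof (rule ccontr)
  assume big: "\<not> cmod (\<tau> \<alpha>) < 1"
  have \<tau>: "\<tau> 0 = 0" "\<tau> 1 = 1" "\<tau> (x + y) = \<tau> x + \<tau> y" "\<tau> (x * y) = \<tau> x * \<tau> y" for x y
    using assms(1) by (auto simp: field_embedding_def)
  have inj: "\<tau> x = 0 \<longleftrightarrow> x = 0" for x
    using \<tau>(4)[of x "inverse x"] \<tau>(1,2) by (cases "x = 0") auto
  have "cmod (\<tau> (1 + 1)) > max (cmod (\<tau> 1)) (cmod (\<tau> 1))"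
    unfolding \<tau> by simp
  then have "archimedean_absolute_value (\<lambda>x. cmod (\<tau> x))"
    unfolding archimedean_absolute_value_def absolute_value_def
    by (metis \<tau>(3,4) inj norm_ge_zero norm_eq_zero norm_mult norm_triangle_ineq not_le)
  then obtain i s where s: "s > 0" "\<And>x. cmod (\<sigma> i x) = cmod (\<tau> x) powr s"
    using places unfolding archimedean_places_def equivalent_absolute_values_def by meson
  have "cmod (\<sigma> i \<alpha>) \<ge> 1"
    unfolding s(2) using big s(1) by (intro ge_one_powr_ge_zero) auto
  then show False using assms(2)[of i] by simp
qed

text \<open>For an additive \<open>f\<close> the numbers \<open>f (\<alpha> ^ k * y)\<close> satisfy a linear recurrence whose characteristic roots may be taken to be
  conjugates of \<open>\<alpha>\<close>, so they tend to 0.  For a coordinate function with respect to a rational basis they also have bounded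
  denominators.  So all coordinates of \<open>\<alpha> ^ k\<close> vanish for large \<open>k\<close>.\<close>

lemma small_algebraic_int_eq_0:
  assumes \<alpha>: "algebraic_int \<alpha>" and small: "\<And>j. cmod (\<sigma> j \<alpha>) < 1"
  shows "\<alpha> = 0"
proof -
  have lim: "(\<lambda>k. f (\<alpha> ^ k * y)) \<longlonglongrightarrow> 0" if "shift_ops \<alpha> cs f = (\<lambda>y. 0)" "Modules.additive f" for f cs y
    using that
  proof (induction cs arbitrary: f)
    case (Cons c cs)
    show ?case
    proof (cases "cmod c < 1")
      case True
      interpret Modules.additive f by (rule Cons.prems)
      let ?g = "\<lambda>y. f (\<alpha> * y) - c * f y"
      have "Modules.additive ?g"
        by unfold_locales (simp add: distrib_left add algebra_simps)
      then have "(\<lambda>k. ?g (\<alpha> ^ k * y)) \<longlonglongrightarrow> 0"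
        using Cons.IH[of ?g] Cons.prems by simp
      then show ?thesis
        by (rule geometric_recurrence_tendsto_0[OF True]) (simp add: mult.assoc)
    next
      case False
      \<comment> \<open>A root \<open>c\<close> with \<open>cmod c \<ge> 1\<close> is no conjugate of \<open>\<alpha>\<close>, so the factor for \<open>c\<close> can be cancelled.\<close>
      let ?h = "shift_ops \<alpha> cs f"
      have "?h (\<alpha> * y) = c * ?h y" for y
        using Cons.prems(1) fun_cong[OF shift_ops_commute[of \<alpha> cs f c], of y] by simp
      then have "?h = (\<lambda>y. 0)"
        using eigenvalue_of_embedding[OF number_field shift_ops_additive[OF Cons.prems(2)], of \<alpha> cs \<alpha> c]
          embedding_lt_1[OF _ small] False by blast
      then show ?thesis using Cons.IH Cons.prems(2) by blast
    qed
  qed simp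
  obtain B :: "'k set" where B: "finite B" "rat_space.independent B" "rat_space.span B = UNIV"
    using number_field_integral_basis[OF number_field] by (elim exE conjE) (rule that)
  define r where "r b x = rat_space.representation B x b" for b x
  have ev0: "\<forall>\<^sub>F k in sequentially. r b (\<alpha> ^ k) = 0" for b
  proof -
    define f :: "'k \<Rightarrow> complex" where "f x = of_rat (r b x)" for x
    have f: "Modules.additive f"
      by unfold_locales (simp add: f_def r_def rat_space.representation_add[OF B(2)] B(3) of_rat_add)
    obtain cs where "shift_ops \<alpha> cs f = (\<lambda>y. 0)"
      using algebraic_int_shift_ops_annihilate[OF \<alpha>] f by blast
    from lim[OF this f, of 1] have to0: "(\<lambda>k. f (\<alpha> ^ k)) \<longlonglongrightarrow> 0" by simp
    obtain m c where mc: "\<alpha> ^ m = (\<Sum>k<m. of_int (c k) * \<alpha> ^ k)"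
      using \<alpha> unfolding algebraic_int_iff_power_combination by blast
    obtain N :: int where N: "N > 0" "\<forall>i\<in>{..<m}. of_int N * r b (\<alpha> ^ i) \<in> \<int>"
      using common_denominator[of "{..<m}" "\<lambda>i. r b (\<alpha> ^ i)"] by blast
    have int: "of_int N * f (\<alpha> ^ k) \<in> \<int>" for k
    proof (induction k rule: less_induct)
      case (less k)
      show ?case
      proof (cases "k < m")
        case True
        then obtain z where "of_int N * r b (\<alpha> ^ k) = of_int z"
          using N(2) by (auto elim: Ints_cases)
        then have "of_int N * f (\<alpha> ^ k) = of_int z"
          unfolding f_def by (metis of_rat_mult of_rat_of_int_eq)
        then show ?thesis by simp
      next
        case False
        then have "\<alpha> ^ k = \<alpha> ^ (k - m) * \<alpha> ^ m" by (simp flip: power_add)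
        also have "\<dots> = \<alpha> ^ (k - m) * (\<Sum>i<m. of_int (c i) * \<alpha> ^ i)"
          by (subst mc) (rule refl)
        also have "\<dots> = (\<Sum>i<m. of_int (c i) * \<alpha> ^ (k - m + i))"
          unfolding sum_distrib_left
          by (intro sum.cong) (simp_all add: power_add mult.left_commute[of "\<alpha> ^ (k - m)"])
        finally have "f (\<alpha> ^ k) = (\<Sum>i<m. of_int (c i) * f (\<alpha> ^ (k - m + i)))"
          by (simp only: additive.sum[OF f] additive_of_int[OF f])
        then have "of_int N * f (\<alpha> ^ k) = (\<Sum>i<m. of_int (c i) * (of_int N * f (\<alpha> ^ (k - m + i))))"
          unfolding sum_distrib_left
          by (simp add: sum_distrib_left mult.left_commute)
        also have "\<dots> \<in> \<int>"
          by (intro Ints_sum Ints_mult[OF Ints_of_int] less) (use False in auto)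
        finally show ?thesis .
      qed
    qed
    have "(\<lambda>k. of_int N * f (\<alpha> ^ k)) \<longlonglongrightarrow> 0"
      using tendsto_mult_right_zero[OF to0, of "of_int N"] by simp
    from tendstoD[OF this, of 1]
    have "\<forall>\<^sub>F k in sequentially. cmod (of_int N * f (\<alpha> ^ k)) < 1"
      by (simp add: dist_norm)
    then show ?thesis
    proof (rule eventually_mono)
      fix k assume k: "cmod (of_int N * f (\<alpha> ^ k)) < 1"
      obtain z where z: "of_int N * f (\<alpha> ^ k) = of_int z"
        using int Ints_cases by blast
      then have "z = 0" using k by (simp add: norm_of_int)
      then show "r b (\<alpha> ^ k) = 0" using z N(1) f_def by simp
    qed
  qed
  have "\<forall>\<^sub>F k in sequentially. \<forall>b\<in>B. r b (\<alpha> ^ k) = 0"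
    using ev0 B(1) by (simp add: eventually_ball_finite)
  then obtain k where k: "\<forall>b\<in>B. r b (\<alpha> ^ k) = 0"
    unfolding eventually_sequentially by blast
  have "\<alpha> ^ k = (\<Sum>b\<in>B. of_rat (rat_space.representation B (\<alpha> ^ k) b) * b)"
    using rat_space.sum_representation_eq[OF B(2) _ B(1) order_refl, of "\<alpha> ^ k"] B(3) by simp
  also have "\<dots> = 0" using k unfolding r_def by (intro sum.neutral) auto
  finally show ?thesis by simp
qed

end

section \<open>The pigeonhole principle and the product formula\<close>

lemma homogeneous_system_nontrivial_solution:
  fixes a :: "'b \<Rightarrow> 'e \<Rightarrow> 'f::field"
  assumes "finite B" "finite E" "card B < card E"
  shows "\<exists>c. (\<exists>e\<in>E. c e \<noteq> 0) \<and> (\<forall>b\<in>B. (\<Sum>e\<in>E. c e * a b e) = 0)"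
  using assms
proof (induction B arbitrary: E a rule: finite_induct)
  case empty
  then have "E \<noteq> {}" by auto
  then show ?case by (intro exI[of _ "\<lambda>_. 1"]) auto
next
  case (insert b B)
  show ?case
  proof (cases "\<forall>e\<in>E. a b e = 0")
    case True
    have "card B < card E" using insert by simp
    from insert.IH[OF insert.prems(1) this, of a]
    obtain c where "\<exists>e\<in>E. c e \<noteq> 0" "\<forall>b\<in>B. (\<Sum>e\<in>E. c e * a b e) = 0"
      by (elim exE conjE) (rule that)
    then show ?thesis using True by (intro exI[of _ c]) simp
  next
    case False
    then obtain e0 where e0: "e0 \<in> E" "a b e0 \<noteq> 0" by blast
    let ?E = "E - {e0}"
    have "finite ?E" "card B < card ?E"
      using insert e0 by auto
    from insert.IH[OF this, of "\<lambda>b' e. a b' e - a b' e0 * a b e / a b e0"]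
    obtain c where c: "\<exists>e\<in>?E. c e \<noteq> 0"
      "\<forall>b'\<in>B. (\<Sum>e\<in>?E. c e * (a b' e - a b' e0 * a b e / a b e0)) = 0"
      by (elim exE conjE) (rule that)
    define s where "s = (\<Sum>e\<in>?E. c e * a b e) / a b e0"
    define c' where "c' e = (if e = e0 then - s else c e)" for e
    have split: "(\<Sum>e\<in>E. c' e * a b' e) = - s * a b' e0 + (\<Sum>e\<in>?E. c e * a b' e)" for b'
    proof -
      have "(\<Sum>e\<in>E. c' e * a b' e) = c' e0 * a b' e0 + (\<Sum>e\<in>?E. c' e * a b' e)"
        using insert.prems(1) e0(1) by (rule sum.remove)
      also have "(\<Sum>e\<in>?E. c' e * a b' e) = (\<Sum>e\<in>?E. c e * a b' e)"
        by (intro sum.cong) (auto simp: c'_def)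
      finally show ?thesis by (simp add: c'_def)
    qed
    have "(\<Sum>e\<in>E. c' e * a b' e) = 0" if b': "b' \<in> insert b B" for b'
    proof (cases "b' = b")
      case True
      then show ?thesis unfolding split using e0(2) by (simp add: s_def)
    next
      case False
      then have "0 = (\<Sum>e\<in>?E. c e * (a b' e - a b' e0 * a b e / a b e0))"
        using c(2) b' by simp
      also have "\<dots> = (\<Sum>e\<in>?E. c e * a b' e) - (\<Sum>e\<in>?E. (c e * a b e) * (a b' e0 / a b e0))"
        by (subst sum_subtractf[symmetric], intro sum.cong) (auto simp: field_simps)
      also have "(\<Sum>e\<in>?E. (c e * a b e) * (a b' e0 / a b e0)) = s * a b' e0"
        unfolding sum_distrib_right[symmetric] s_def by simp
      finally show ?thesis unfolding split by simp
    qed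
    moreover have "\<exists>e\<in>E. c' e \<noteq> 0" using c(1) by (auto simp: c'_def)
    ultimately show ?thesis by (intro exI[of _ c']) blast
  qed
qed

lemma field_embedding_additive: "field_embedding \<tau> \<Longrightarrow> Modules.additive \<tau>"
  by unfold_locales (simp add: field_embedding_def)

text \<open>Dedekind's argument: multiplying the relation by \<open>t e0 y\<close> and comparing it with the relation at \<open>y * x\<close> removes the
  term of \<open>e0\<close>.\<close>

lemma embeddings_linearly_independent:
  assumes "finite E" "\<And>e. e \<in> E \<Longrightarrow> field_embedding (t e)" "inj_on t E"
    and "\<And>x. (\<Sum>e\<in>E. c e * t e x) = 0" "e \<in> E"
  shows "c e = 0"
  using assms
proof (induction E arbitrary: c e rule: finite_induct)
  case (insert e0 E)
  have mult: "t e (x * y) = t e x * t e y" if "e \<in> insert e0 E" for e x y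
    using insert.prems(1)[OF that] by (simp add: field_embedding_def)
  have rel: "c e0 * t e0 x = - (\<Sum>e\<in>E. c e * t e x)" for x
    using insert.prems(3)[of x] insert.hyps by (simp add: eq_neg_iff_add_eq_0)
  have zero: "c e = 0" if e: "e \<in> E" for e
  proof -
    have "t e \<noteq> t e0"
      using insert.prems(2) insert.hyps e by (auto simp: inj_on_def)
    then obtain y where y: "t e y \<noteq> t e0 y" by blast
    have "(\<Sum>e\<in>E. c e * (t e y - t e0 y) * t e x) = 0" for x
    proof -
      have "(\<Sum>e\<in>E. c e * (t e y - t e0 y) * t e x) =
          (\<Sum>e\<in>E. c e * t e (y * x)) - t e0 y * (\<Sum>e\<in>E. c e * t e x)"
        unfolding sum_distrib_left sum_subtractf[symmetric]
        by (intro sum.cong) (auto simp: mult left_diff_distrib right_diff_distrib)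
      also have "(\<Sum>e\<in>E. c e * t e (y * x)) = - (c e0 * t e0 (y * x))"
        unfolding rel by simp
      also have "(\<Sum>e\<in>E. c e * t e x) = - (c e0 * t e0 x)"
        unfolding rel by simp
      finally show ?thesis by (simp add: mult)
    qed
    then have "c e * (t e y - t e0 y) = 0"
      using insert.IH[of "\<lambda>e. c e * (t e y - t e0 y)" e] insert.prems(1,2) e by simp
    then show ?thesis using y by simp
  qed
  have "t e0 1 = 1" using insert.prems(1)[of e0] by (simp add: field_embedding_def)
  then have "c e0 = 0" using rel[of 1] zero by simp
  then show ?case using zero insert.prems(4) by auto
qed simp

text \<open>A form of the theorem of Minkowski on linear forms.  The \<open>(M + 1) ^ card B\<close> vectors with entries between 0 and \<open>M\<close> are
  sorted into \<open>\<Prod> k c\<close> boxes according to the values of the forms; two of them share a box.\<close>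

lemma integer_pigeonhole:
  fixes L :: "'c \<Rightarrow> 'b \<Rightarrow> real" and k :: "'c \<Rightarrow> nat" and C :: real
  assumes fin: "finite B" "finite J" and C: "\<And>c b. c \<in> J \<Longrightarrow> b \<in> B \<Longrightarrow> \<bar>L c b\<bar> \<le> C" "C \<ge> 0"
    and k: "\<And>c. c \<in> J \<Longrightarrow> k c \<ge> 1" and less: "(\<Prod>c\<in>J. k c) < (M + 1) ^ card B"
  shows "\<exists>z::'b \<Rightarrow> int. (\<exists>b\<in>B. z b \<noteq> 0) \<and>
    (\<forall>c\<in>J. \<bar>\<Sum>b\<in>B. of_int (z b) * L c b\<bar> \<le> 2 * (card B * C * M + 1) / k c)"
proof -
  \<comment> \<open>All values lie strictly inside \<open>{- W..W}\<close>, which is cut into \<open>k c\<close> intervals of length \<open>2 * W / k c\<close>.\<close>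
  define W where "W = card B * C * M + 1"
  have W: "W \<ge> 1" using C(2) by (simp add: W_def)
  define X where "X = (B \<rightarrow>\<^sub>E {..M})"
  define S where "S c x = (\<Sum>b\<in>B. real (x b) * L c b)" for c and x :: "'b \<Rightarrow> nat"
  define idx where "idx c x = nat \<lfloor>(S c x + W) * (k c / (2 * W))\<rfloor>" for c x
  have S: "\<bar>S c x\<bar> \<le> W - 1" if x: "x \<in> X" and c: "c \<in> J" for x c
  proof -
    have "\<bar>S c x\<bar> \<le> (\<Sum>b\<in>B. \<bar>real (x b) * L c b\<bar>)" unfolding S_def by (rule sum_abs)
    also have "\<dots> \<le> (\<Sum>b\<in>B. M * C)"
    proof (rule sum_mono)
      fix b assume b: "b \<in> B"
      then have "x b \<le> M" using x unfolding X_def by auto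
      then show "\<bar>real (x b) * L c b\<bar> \<le> M * C"
        unfolding abs_mult using C(1)[OF c b] by (intro mult_mono) auto
    qed
    finally show ?thesis by (simp add: W_def mult_ac)
  qed
  have pos: "(S c x + W) * (k c / (2 * W)) \<ge> 0" "(S c x + W) * (k c / (2 * W)) < k c"
    if x: "x \<in> X" and c: "c \<in> J" for x c
  proof -
    have "0 \<le> S c x + W" "S c x + W < 2 * W" using S[OF x c] W by auto
    moreover have "k c / (2 * W) > 0" using k[OF c] W by simp
    ultimately show "(S c x + W) * (k c / (2 * W)) \<ge> 0" by simp
    have "(S c x + W) * (k c / (2 * W)) < 2 * W * (k c / (2 * W))"
      using \<open>S c x + W < 2 * W\<close> \<open>k c / (2 * W) > 0\<close> by (rule mult_strict_right_mono)
    then show "(S c x + W) * (k c / (2 * W)) < k c" using W by simp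
  qed
  have "(\<lambda>x. \<lambda>c\<in>J. idx c x) ` X \<subseteq> (\<Pi>\<^sub>E c\<in>J. {..<k c})"
  proof (intro image_subsetI PiE_I)
    fix x c assume x: "x \<in> X" and c: "c \<in> J"
    have "idx c x < k c"
      unfolding idx_def using pos[OF x c] by (simp add: nat_less_iff floor_less_iff)
    then show "(\<lambda>c\<in>J. idx c x) c \<in> {..<k c}" using c by simp
  qed auto
  then have "card ((\<lambda>x. \<lambda>c\<in>J. idx c x) ` X) \<le> card (\<Pi>\<^sub>E c\<in>J. {..<k c})"
    using fin(2) by (intro card_mono finite_PiE) auto
  also have "\<dots> = (\<Prod>c\<in>J. k c)" using fin(2) by (simp add: card_PiE)
  also have "\<dots> < (M + 1) ^ card B" by (rule less)
  also have "\<dots> = card X" unfolding X_def using fin(1) by (simp add: card_PiE)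
  finally have "\<not> inj_on (\<lambda>x. \<lambda>c\<in>J. idx c x) X"
    using pigeonhole by blast
  then obtain x y where xy: "x \<in> X" "y \<in> X" "x \<noteq> y" "(\<lambda>c\<in>J. idx c x) = (\<lambda>c\<in>J. idx c y)"
    unfolding inj_on_def by blast
  define z where "z b = int (x b) - int (y b)" for b
  have "\<exists>b\<in>B. z b \<noteq> 0"
  proof (rule ccontr)
    assume "\<not> (\<exists>b\<in>B. z b \<noteq> 0)"
    then have "\<And>b. b \<in> B \<Longrightarrow> x b = y b" by (simp add: z_def)
    then have "x = y" using xy(1,2) unfolding X_def by (intro PiE_ext[of x B _ y]) auto
    then show False using xy(3) by simp
  qed
  moreover have "\<bar>\<Sum>b\<in>B. of_int (z b) * L c b\<bar> \<le> 2 * (card B * C * M + 1) / k c" if c: "c \<in> J" for c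
  proof -
    have "idx c x = idx c y" using fun_cong[OF xy(4), of c] c by simp
    then have "\<lfloor>(S c x + W) * (k c / (2 * W))\<rfloor> = \<lfloor>(S c y + W) * (k c / (2 * W))\<rfloor>"
      unfolding idx_def using pos(1)[OF xy(1) c] pos(1)[OF xy(2) c] by (simp add: nat_eq_iff)
    then have "\<bar>(S c x + W) * (k c / (2 * W)) - (S c y + W) * (k c / (2 * W))\<bar> < 1"
      by linarith
    moreover have "(S c x + W) * (k c / (2 * W)) - (S c y + W) * (k c / (2 * W)) =
        (S c x - S c y) * (k c / (2 * W))"
      by (simp only: left_diff_distrib distrib_right)
    ultimately have "\<bar>S c x - S c y\<bar> * (k c / (2 * W)) < 1"
      using W by (simp add: abs_mult)
    then have "\<bar>S c x - S c y\<bar> \<le> 2 * W / k c"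
      using W k[OF c] by (simp add: field_simps)
    moreover have "S c x - S c y = (\<Sum>b\<in>B. of_int (z b) * L c b)"
      unfolding S_def sum_subtractf[symmetric] by (intro sum.cong) (auto simp: z_def left_diff_distrib)
    ultimately show ?thesis unfolding W_def by simp
  qed
  ultimately show ?thesis by (intro exI[of _ z]) blast
qed

lemma algebraic_int_sum:
  fixes f :: "'i \<Rightarrow> 'a::field_char_0"
  shows "(\<And>i. i \<in> A \<Longrightarrow> algebraic_int (f i)) \<Longrightarrow> algebraic_int (\<Sum>i\<in>A. f i)"
  by (induction A rule: infinite_finite_induct) (auto intro: algebraic_int_add)

lemma algebraic_int_diff:
  "algebraic_int (x::'a::field_char_0) \<Longrightarrow> algebraic_int y \<Longrightarrow> algebraic_int (x - y)"
  using algebraic_int_add[of x "- y"] by auto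

lemma algebraic_int_power:
  "algebraic_int (x::'a::field_char_0) \<Longrightarrow> algebraic_int (x ^ n)"
  by (induction n) (auto intro: algebraic_int_mult)

context arch_number_field
begin

lemma embedding [simp]: "field_embedding (\<sigma> j)"
  using places by (simp add: archimedean_places_def)

lemma \<sigma>_simps [simp]:
  "\<sigma> j 0 = 0" "\<sigma> j 1 = 1" "\<sigma> j (x + y) = \<sigma> j x + \<sigma> j y" "\<sigma> j (x * y) = \<sigma> j x * \<sigma> j y"
  using embedding[of j] by (auto simp: field_embedding_def)

lemma \<sigma>_additive: "Modules.additive (\<sigma> j)"
  by (rule field_embedding_additive) simp

lemma \<sigma>_more [simp]:
  "\<sigma> j (- x) = - \<sigma> j x" "\<sigma> j (x - y) = \<sigma> j x - \<sigma> j y" "\<sigma> j (sum f A) = (\<Sum>a\<in>A. \<sigma> j (f a))"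
  "\<sigma> j (x ^ n) = \<sigma> j x ^ n" "\<sigma> j (of_int m) = of_int m" "\<sigma> j (of_rat q) = of_rat q"
proof -
  show "\<sigma> j (- x) = - \<sigma> j x" by (rule additive.minus[OF \<sigma>_additive])
  show "\<sigma> j (x - y) = \<sigma> j x - \<sigma> j y" by (rule additive.diff[OF \<sigma>_additive])
  show "\<sigma> j (sum f A) = (\<Sum>a\<in>A. \<sigma> j (f a))" by (rule additive.sum[OF \<sigma>_additive])
  show "\<sigma> j (x ^ n) = \<sigma> j x ^ n" by (induction n) auto
  show "\<sigma> j (of_int m) = of_int m" using additive_of_int[OF \<sigma>_additive[of j], of m 1] by simp
  show "\<sigma> j (of_rat q) = of_rat q" by (rule embedding_of_rat) simp
qed

lemma \<sigma>_eq_0_iff [simp]: "\<sigma> j x = 0 \<longleftrightarrow> x = 0"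
proof
  assume z: "\<sigma> j x = 0"
  show "x = 0"
  proof (rule ccontr)
    assume "x \<noteq> 0"
    then have "\<sigma> j x * \<sigma> j (inverse x) = 1" by (simp flip: \<sigma>_simps(4))
    then show False using z by simp
  qed
qed simp

text \<open>The dimension of the completion at \<open>j\<close> over the reals.\<close>

definition local_degree :: "'r \<Rightarrow> nat" where
  "local_degree j = (if range (\<sigma> j) \<subseteq> \<real> then 1 else 2)"

text \<open>The real coordinates of the product of all completions: the flag \<open>True\<close> stands for an imaginary part and is only admitted at
  complex places.\<close>

definition coords :: "('r \<times> bool) set" where
  "coords = {(j, p). p \<longrightarrow> \<not> range (\<sigma> j) \<subseteq> \<real>}"

definition part :: "bool \<Rightarrow> complex \<Rightarrow> real" where
  "part p z = (if p then Im z else Re z)"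

lemma finite_coords [simp]: "finite coords"
  by (rule finite)

lemma prod_coords: "(\<Prod>c\<in>coords. f (fst c)) = (\<Prod>j\<in>UNIV. f j ^ local_degree j)"
  for f :: "'r \<Rightarrow> 'x::comm_monoid_mult"
proof -
  have "coords = (SIGMA j:UNIV. {p. p \<longrightarrow> \<not> range (\<sigma> j) \<subseteq> \<real>})"
    unfolding coords_def by auto
  then have "(\<Prod>c\<in>coords. f (fst c)) = (\<Prod>j\<in>UNIV. \<Prod>p\<in>{p. p \<longrightarrow> \<not> range (\<sigma> j) \<subseteq> \<real>}. f j)"
    by (subst prod.Sigma) (simp_all add: split_def del: prod_constant)
  also have "\<dots> = (\<Prod>j\<in>UNIV. f j ^ local_degree j)"
  proof (intro prod.cong refl)
    fix j
    have "{p. p \<longrightarrow> \<not> range (\<sigma> j) \<subseteq> \<real>} = (if range (\<sigma> j) \<subseteq> \<real> then {False} else UNIV)"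
      by auto
    then show "(\<Prod>p\<in>{p. p \<longrightarrow> \<not> range (\<sigma> j) \<subseteq> \<real>}. f j) = f j ^ local_degree j"
      by (simp add: local_degree_def)
  qed
  finally show ?thesis .
qed

lemma norm_le_parts:
  assumes "\<And>p. (j, p) \<in> coords \<Longrightarrow> \<bar>part p z\<bar> \<le> e" "z \<in> arch_completion (\<sigma> j)"
  shows "cmod z \<le> 2 * e"
proof -
  have re: "\<bar>Re z\<bar> \<le> e" using assms(1)[of False] by (simp add: coords_def part_def)
  have "\<bar>Im z\<bar> \<le> e"
  proof (cases "range (\<sigma> j) \<subseteq> \<real>")
    case True
    then have "z \<in> \<real>" using assms(2) arch_completion_eq[OF embedding] by auto
    then show ?thesis using re by (simp add: complex_is_Real_iff)
  next
    case False
    then show ?thesis using assms(1)[of True] by (simp add: coords_def part_def)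
  qed
  then show ?thesis using re cmod_le[of z] by simp
qed

lemma \<sigma>_in_completion [simp]: "\<sigma> j x \<in> arch_completion (\<sigma> j)"
  unfolding arch_completion_def using closure_subset[of "range (\<sigma> j)"] by blast

lemma archimedean_\<sigma>: "archimedean_absolute_value (\<lambda>x. cmod (\<sigma> j x))"
proof -
  have "cmod (\<sigma> j (1 + 1)) > max (cmod (\<sigma> j 1)) (cmod (\<sigma> j 1))"
    unfolding \<sigma>_simps by simp
  then have "\<not> (\<forall>x y. cmod (\<sigma> j (x + y)) \<le> max (cmod (\<sigma> j x)) (cmod (\<sigma> j y)))"
    by (metis not_le)
  then show ?thesis
    unfolding archimedean_absolute_value_def absolute_value_def
    by (auto simp: norm_mult norm_triangle_ineq)
qed

lemma \<sigma>_norm_inj: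
  assumes "\<And>x. cmod (\<sigma> i x) = cmod (\<sigma> j x)"
  shows "i = j"
proof -
  have "equivalent_absolute_values (\<lambda>x. cmod (\<sigma> j x)) (\<lambda>x. cmod (\<sigma> j x))"
    unfolding equivalent_absolute_values_def by (intro exI[of _ 1]) auto
  moreover have "equivalent_absolute_values (\<lambda>x. cmod (\<sigma> j x)) (\<lambda>x. cmod (\<sigma> i x))"
    unfolding equivalent_absolute_values_def by (intro exI[of _ 1]) (auto simp: assms)
  moreover have "\<exists>!i. equivalent_absolute_values (\<lambda>x. cmod (\<sigma> j x)) (\<lambda>x. cmod (\<sigma> i x))"
    using places archimedean_\<sigma>[of j] unfolding archimedean_places_def by blast
  ultimately show ?thesis by auto
qed

text \<open>Besides the chosen embeddings this takes in their complex conjugates at the complex places.\<close>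

definition embedding_of :: "'r \<times> bool \<Rightarrow> 'k \<Rightarrow> complex" where
  "embedding_of c x = (if snd c then cnj (\<sigma> (fst c) x) else \<sigma> (fst c) x)"

lemma field_embedding_of: "field_embedding (embedding_of c)"
  unfolding field_embedding_def embedding_of_def by auto

lemma inj_embedding_of: "inj_on embedding_of coords"
proof (rule inj_onI)
  fix c d assume c: "c \<in> coords" and d: "d \<in> coords" and eq: "embedding_of c = embedding_of d"
  have norm: "cmod (embedding_of e x) = cmod (\<sigma> (fst e) x)" for e x
    by (simp add: embedding_of_def)
  have "fst c = fst d"
    by (rule \<sigma>_norm_inj) (metis norm eq)
  moreover have "snd c = snd d"
  proof (rule ccontr)
    assume ne: "snd c \<noteq> snd d"
    have "\<sigma> (fst c) x = cnj (\<sigma> (fst c) x)" for x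
      using fun_cong[OF eq, of x] ne \<open>fst c = fst d\<close> unfolding embedding_of_def
      by (cases "snd c") auto
    then have "range (\<sigma> (fst c)) \<subseteq> \<real>"
      using Reals_cnj_iff by (metis image_subsetI)
    then show False using c d ne \<open>fst c = fst d\<close> by (auto simp: coords_def)
  qed
  ultimately show "c = d" by (rule prod_eqI)
qed

text \<open>The embeddings indexed by \<open>coords\<close> are linearly independent, and a linear dependence can be tested on a basis.\<close>

lemma card_coords_le:
  assumes "finite B" "rat_space.span B = (UNIV :: 'k set)"
  shows "card coords \<le> card B"
proof (rule ccontr)
  assume "\<not> card coords \<le> card B"
  then have "card B < card coords" by simp
  from homogeneous_system_nontrivial_solution[OF assms(1) finite_coords this, of "\<lambda>b c. embedding_of c b"]
  obtain c where c: "\<exists>e\<in>coords. c e \<noteq> 0" "\<forall>b\<in>B. (\<Sum>e\<in>coords. c e * embedding_of e b) = 0"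
    by (elim exE conjE) (rule that)
  have "(\<Sum>e\<in>coords. c e * embedding_of e x) = 0" for x
  proof -
    obtain q where x: "x = (\<Sum>b\<in>B. of_rat (q b) * b)"
      using rat_span_family[OF assms] by blast
    have emb: "embedding_of e x = (\<Sum>b\<in>B. of_rat (q b) * embedding_of e b)" for e
      unfolding x additive.sum[OF field_embedding_additive[OF field_embedding_of]]
      by (simp only: additive_of_rat[OF field_embedding_additive[OF field_embedding_of]])
    have "(\<Sum>e\<in>coords. c e * embedding_of e x) =
        (\<Sum>e\<in>coords. \<Sum>b\<in>B. of_rat (q b) * (c e * embedding_of e b))"
      unfolding emb sum_distrib_left by (intro sum.cong refl) (rule mult.left_commute)
    also have "\<dots> = (\<Sum>b\<in>B. of_rat (q b) * (\<Sum>e\<in>coords. c e * embedding_of e b))"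
      unfolding sum_distrib_left by (rule sum.swap)
    finally show ?thesis using c(2) by simp
  qed
  then have "c e = 0" if "e \<in> coords" for e
    using embeddings_linearly_independent[OF finite_coords field_embedding_of inj_embedding_of _ that, of c]
    by blast
  then show False using c(1) by blast
qed

lemma int_combination_eq_0:
  assumes "finite B" "rat_space.independent (B :: 'k set)" "(\<Sum>b\<in>B. of_int (z b) * b) = 0" "b \<in> B"
  shows "z b = 0"
proof -
  have "(\<Sum>b\<in>B. of_rat (of_int (z b)) * b) = 0" using assms(3) by simp
  then have "(of_int (z b) :: rat) = 0"
    using rat_space.independentD[OF assms(2,1) order_refl _ assms(4), of "\<lambda>b. of_int (z b)"] by simp
  then show ?thesis by simp
qed

lemma basis_bound:
  assumes "finite (B :: 'k set)"
  shows "\<exists>C\<ge>1. \<forall>j. \<forall>b\<in>B. cmod (\<sigma> j b) \<le> C"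
proof -
  let ?C = "1 + (\<Sum>j\<in>UNIV. \<Sum>b\<in>B. cmod (\<sigma> j b))"
  have "cmod (\<sigma> j b) \<le> ?C" if b: "b \<in> B" for j b
  proof -
    have "cmod (\<sigma> j b) \<le> (\<Sum>b\<in>B. cmod (\<sigma> j b))"
      using b assms by (intro member_le_sum) auto
    also have "\<dots> \<le> (\<Sum>j\<in>UNIV. \<Sum>b\<in>B. cmod (\<sigma> j b))"
      by (rule member_le_sum) (auto intro: sum_nonneg)
    finally show ?thesis by simp
  qed
  moreover have "(\<Sum>j\<in>UNIV. \<Sum>b\<in>B. cmod (\<sigma> j b)) \<ge> 0"
    by (intro sum_nonneg norm_ge_zero)
  ultimately show ?thesis by (intro exI[of _ ?C]) auto
qed

lemma part_le_norm: "\<bar>part p z\<bar> \<le> cmod z"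
  by (simp add: part_def abs_Re_le_cmod abs_Im_le_cmod)

lemma part_sum_int: "part p (\<Sum>b\<in>B. of_int (z b) * f b) = (\<Sum>b\<in>B. of_int (z b) * part p (f b))"
  by (simp add: part_def)

text \<open>If the product were smaller than 1, a power \<open>\<alpha> ^ s\<close> would have such a small product that the pigeonhole principle gives a
  non-zero integer \<open>\<beta>\<close> with \<open>cmod (\<sigma> j \<beta>)\<close> below \<open>1 / cmod (\<sigma> j (\<alpha> ^ s))\<close> at all places.  Then \<open>\<beta> * \<alpha> ^ s\<close> has small
  conjugates, contradicting \<open>small_algebraic_int_eq_0\<close>.\<close>

lemma algebraic_int_norm_ge_1:
  assumes \<alpha>: "algebraic_int \<alpha>" "\<alpha> \<noteq> 0"
  shows "(\<Prod>j\<in>UNIV. cmod (\<sigma> j \<alpha>) ^ local_degree j) \<ge> 1"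
proof (rule ccontr)
  define q where "q = (\<Prod>j\<in>UNIV. cmod (\<sigma> j \<alpha>) ^ local_degree j)"
  assume "\<not> (\<Prod>j\<in>UNIV. cmod (\<sigma> j \<alpha>) ^ local_degree j) \<ge> 1"
  then have q1: "q < 1" by (simp add: q_def)
  have q0: "q \<ge> 0" unfolding q_def by (intro prod_nonneg) auto
  obtain B :: "'k set" where B: "finite B" "rat_space.independent B" "rat_space.span B = UNIV"
    "\<forall>b\<in>B. algebraic_int b"
    using number_field_integral_basis[OF number_field] by (elim exE conjE) (rule that)
  obtain C where C: "C \<ge> 1" "\<forall>j. \<forall>b\<in>B. cmod (\<sigma> j b) \<le> C"
    using basis_bound[OF B(1)] by (elim exE conjE) (rule that)
  define n where "n = card B"
  define N where "N = card coords"
  have Nn: "N \<le> n" unfolding N_def n_def by (rule card_coords_le[OF B(1,3)])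
  \<comment> \<open>The factor 8 turns the pigeonhole bound on real and imaginary parts into \<open>cmod (\<sigma> j (\<beta> * \<alpha> ^ s)) \<le> 1 / 2\<close>.\<close>
  define A where "A = 8 * (n * C + 1)"
  have A: "A \<ge> 4" using C(1) by (simp add: A_def)
  have "(\<lambda>s. (2 * A) ^ N * q ^ s) \<longlonglongrightarrow> 0"
    using q0 q1 by (intro tendsto_mult_right_zero LIMSEQ_power_zero) simp
  then have "\<forall>\<^sub>F s in sequentially. (2 * A) ^ N * q ^ s < 1"
    by (rule order_tendstoD) simp
  then obtain s where s: "(2 * A) ^ N * q ^ s < 1"
    unfolding eventually_sequentially by blast
  define a where "a j = cmod (\<sigma> j \<alpha>) ^ s" for j
  have a: "a j > 0" for j using \<alpha>(2) by (simp add: a_def)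
  obtain M :: nat where M: "\<And>j. 1 / (A * a j) \<le> M" "M \<ge> 1"
  proof -
    obtain M :: nat where M: "(\<Sum>j\<in>UNIV. 1 / (A * a j)) + 1 \<le> M"
      using real_arch_simple by blast
    have nonneg: "0 \<le> 1 / (A * a j)" for j using A a[of j] by simp
    have "1 / (A * a j) \<le> M" for j
      using member_le_sum[of j UNIV "\<lambda>j. 1 / (A * a j)"] nonneg M by simp
    moreover have "real M \<ge> 1"
      using M sum_nonneg[of UNIV "\<lambda>j. 1 / (A * a j)"] nonneg by simp
    ultimately show ?thesis using that[of M] by simp
  qed
  define k where "k c = nat \<lfloor>A * M * a (fst c)\<rfloor> + 1" for c :: "'r \<times> bool"
  have AMa: "A * M * a j \<ge> 1" for j
    using M(1)[of j] A a[of j] by (simp add: field_simps)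
  have k_gt: "A * M * a (fst c) < k c" for c
  proof -
    have "A * M * a (fst c) \<ge> 0" using AMa[of "fst c"] by simp
    then have "real (nat \<lfloor>A * M * a (fst c)\<rfloor>) = of_int \<lfloor>A * M * a (fst c)\<rfloor>" by simp
    then show ?thesis unfolding k_def by linarith
  qed
  have k_le: "k c \<le> 2 * A * M * a (fst c)" for c
  proof -
    have "real (nat \<lfloor>A * M * a (fst c)\<rfloor>) = of_int \<lfloor>A * M * a (fst c)\<rfloor>"
      using AMa[of "fst c"] by simp
    then have "k c \<le> A * M * a (fst c) + 1" unfolding k_def by linarith
    then show ?thesis using AMa[of "fst c"] by simp
  qed
  have "real (\<Prod>c\<in>coords. k c) \<le> (\<Prod>c\<in>coords. 2 * A * M * a (fst c))"
    unfolding of_nat_prod using k_le by (intro prod_mono) auto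
  also have "\<dots> = (2 * A * M) ^ N * (\<Prod>c\<in>coords. a (fst c))"
    by (simp add: prod.distrib N_def power_mult_distrib)
  also have "(\<Prod>c\<in>coords. a (fst c)) = q ^ s"
    unfolding prod_coords[of a] unfolding a_def q_def prod_power_distrib
    by (intro prod.cong refl) (simp add: mult.commute flip: power_mult)
  also have "(2 * A * M) ^ N * q ^ s = ((2 * A) ^ N * q ^ s) * M ^ N"
    by (simp add: power_mult_distrib)
  also have "\<dots> \<le> real M ^ N"
    using mult_right_mono[of "(2 * A) ^ N * q ^ s" 1 "real M ^ N"] s by simp
  also have "\<dots> \<le> real M ^ n" using M(2) Nn by (simp add: power_increasing)
  also have "\<dots> < real (M + 1) ^ n"
  proof (rule power_strict_mono)
    have "B \<noteq> {}"
    proof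
      assume "B = {}"
      then have "(1::'k) \<in> {0}" using B(3) by (metis UNIV_I rat_space.span_empty)
      then show False by simp
    qed
    then show "0 < n" using B(1) by (simp add: n_def card_gt_0_iff)
  qed auto
  finally have less: "(\<Prod>c\<in>coords. k c) < (M + 1) ^ card B"
    unfolding n_def by (metis of_nat_less_iff of_nat_power)
  have "\<exists>z::'k \<Rightarrow> int. (\<exists>b\<in>B. z b \<noteq> 0) \<and>
    (\<forall>c\<in>coords. \<bar>\<Sum>b\<in>B. of_int (z b) * part (snd c) (\<sigma> (fst c) b)\<bar> \<le> 2 * (card B * C * M + 1) / k c)"
  proof (rule integer_pigeonhole[OF B(1) finite_coords _ _ _ less])
    show "\<bar>part (snd c) (\<sigma> (fst c) b)\<bar> \<le> C" if "b \<in> B" for c b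
      using part_le_norm[of "snd c" "\<sigma> (fst c) b"] C(2) that by (meson order_trans)
    show "0 \<le> C" using C(1) by simp
    show "1 \<le> k c" for c by (simp add: k_def)
  qed
  then obtain z :: "'k \<Rightarrow> int" where z: "\<exists>b\<in>B. z b \<noteq> 0"
    "\<forall>c\<in>coords. \<bar>\<Sum>b\<in>B. of_int (z b) * part (snd c) (\<sigma> (fst c) b)\<bar> \<le> 2 * (card B * C * M + 1) / k c"
    by (elim exE conjE) (rule that)
  define \<beta> where "\<beta> = (\<Sum>b\<in>B. of_int (z b) * b)"
  have \<beta>0: "\<beta> \<noteq> 0" using int_combination_eq_0[OF B(1,2), of z] z(1) unfolding \<beta>_def by blast
  have \<beta>int: "algebraic_int \<beta>"
    unfolding \<beta>_def using B(4) by (intro algebraic_int_sum algebraic_int_mult) auto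
  have "cmod (\<sigma> j (\<beta> * \<alpha> ^ s)) < 1" for j
  proof -
    have "cmod (\<sigma> j \<beta>) \<le> 2 * (1 / (4 * a j))"
    proof (rule norm_le_parts[OF _ \<sigma>_in_completion])
      fix p assume p: "(j, p) \<in> coords"
      have "\<bar>part p (\<sigma> j \<beta>)\<bar> \<le> 2 * (n * C * M + 1) / k (j, p)"
        using z(2) p unfolding \<beta>_def n_def by (auto simp: part_sum_int)
      also have "\<dots> \<le> (A * M / 4) / k (j, p)"
      proof (rule divide_right_mono)
        have "1 \<le> real M" using M(2) by simp
        then show "2 * (n * C * M + 1) \<le> A * M / 4" unfolding A_def by (simp add: algebra_simps)
      qed simp
      also have "\<dots> \<le> (A * M / 4) / (A * M * a j)"
        using k_gt[of "(j, p)"] A AMa[of j] a[of j] M(2) by (intro divide_left_mono mult_pos_pos) auto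
      also have "\<dots> = 1 / (4 * a j)" using A M(2) by simp
      finally show "\<bar>part p (\<sigma> j \<beta>)\<bar> \<le> 1 / (4 * a j)" .
    qed
    then have "cmod (\<sigma> j \<beta>) * a j \<le> 2 * (1 / (4 * a j)) * a j"
      using a[of j] by (intro mult_right_mono) auto
    also have "\<dots> < 1" using a[of j] by simp
    finally show ?thesis by (simp add: norm_mult norm_power a_def)
  qed
  then have "\<beta> * \<alpha> ^ s = 0"
    using small_algebraic_int_eq_0 algebraic_int_mult[OF \<beta>int algebraic_int_power[OF \<alpha>(1)]] by blast
  then show False using \<beta>0 \<alpha>(2) by simp
qed

text \<open>Two such integers with the same coordinates up to 1/2 have a difference with small conjugates.\<close>

lemma finite_bounded_algebraic_ints:
  "finite {\<alpha>. algebraic_int \<alpha> \<and> (\<forall>j. cmod (\<sigma> j \<alpha>) \<le> R)}" (is "finite ?S")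
proof -
  define F where "F \<alpha> c = \<lfloor>2 * part (snd c) (\<sigma> (fst c) \<alpha>)\<rfloor>" for \<alpha> and c :: "'r \<times> bool"
  have "F ` ?S \<subseteq> (\<Pi>\<^sub>E c\<in>UNIV. {\<lfloor>- 2 * R\<rfloor>..\<lfloor>2 * R\<rfloor>})"
  proof (intro image_subsetI PiE_I)
    fix \<alpha> c assume "\<alpha> \<in> ?S"
    then have "\<bar>part (snd c) (\<sigma> (fst c) \<alpha>)\<bar> \<le> R"
      using part_le_norm[of "snd c" "\<sigma> (fst c) \<alpha>"] order_trans by blast
    then show "F \<alpha> c \<in> {\<lfloor>- 2 * R\<rfloor>..\<lfloor>2 * R\<rfloor>}"
      unfolding F_def atLeastAtMost_iff by (intro conjI floor_mono) auto
  qed auto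
  then have "finite (F ` ?S)"
    by (rule finite_subset) (auto intro: finite_PiE)
  moreover have "inj_on F ?S"
  proof (rule inj_onI)
    fix \<alpha> \<beta> assume \<alpha>: "\<alpha> \<in> ?S" and \<beta>: "\<beta> \<in> ?S" and eq: "F \<alpha> = F \<beta>"
    have part: "\<bar>part p (\<sigma> j \<alpha>) - part p (\<sigma> j \<beta>)\<bar> < 1 / 2" for p j
    proof -
      have "\<lfloor>2 * part p (\<sigma> j \<alpha>)\<rfloor> = \<lfloor>2 * part p (\<sigma> j \<beta>)\<rfloor>"
        using fun_cong[OF eq, of "(j, p)"] unfolding F_def by simp
      then have "\<bar>2 * part p (\<sigma> j \<alpha>) - 2 * part p (\<sigma> j \<beta>)\<bar> < 1" by linarith
      then show ?thesis by linarith
    qed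
    have "cmod (\<sigma> j (\<alpha> - \<beta>)) < 1" for j
      using part[of False j] part[of True j] cmod_le[of "\<sigma> j \<alpha> - \<sigma> j \<beta>"] by (simp add: part_def)
    then have "\<alpha> - \<beta> = 0"
      using small_algebraic_int_eq_0[OF algebraic_int_diff] \<alpha> \<beta> by blast
    then show "\<alpha> = \<beta>" by simp
  qed
  ultimately show ?thesis using finite_imageD by blast
qed

text \<open>Modulo \<open>\<delta>\<close>, the rational coordinates of \<open>\<alpha> / \<delta>\<close> can be reduced to their fractional parts, which leaves a bounded
  set of integers.\<close>

lemma finite_residues:
  assumes \<delta>: "algebraic_int (\<delta> :: 'k)" "\<delta> \<noteq> 0"
  shows "\<exists>F. finite F \<and> (\<forall>\<alpha>. algebraic_int \<alpha> \<longrightarrow>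
           (\<exists>\<rho>\<in>F. \<exists>\<kappa>. algebraic_int \<kappa> \<and> \<alpha> = \<rho> + \<kappa> * \<delta>))"
proof -
  obtain B :: "'k set" where B: "finite B" "rat_space.span B = UNIV" "\<forall>b\<in>B. algebraic_int b"
    using number_field_integral_basis[OF number_field] by (elim exE conjE) (rule that)
  obtain C where C: "C \<ge> 1" "\<forall>j. \<forall>b\<in>B. cmod (\<sigma> j b) \<le> C"
    using basis_bound[OF B(1)] by (elim exE conjE) (rule that)
  define R where "R = (\<Sum>j\<in>UNIV. cmod (\<sigma> j \<delta>)) * (card B * C)"
  have "\<exists>\<rho>\<in>{\<alpha>. algebraic_int \<alpha> \<and> (\<forall>j. cmod (\<sigma> j \<alpha>) \<le> R)}. \<exists>\<kappa>. algebraic_int \<kappa> \<and> \<alpha> = \<rho> + \<kappa> * \<delta>"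
    if \<alpha>: "algebraic_int \<alpha>" for \<alpha>
  proof -
    obtain q where q: "\<alpha> / \<delta> = (\<Sum>b\<in>B. of_rat (q b) * b)"
      using rat_span_family[OF B(1,2)] by blast
    define \<kappa> where "\<kappa> = (\<Sum>b\<in>B. of_int \<lfloor>q b\<rfloor> * b)"
    define \<rho> where "\<rho> = \<alpha> - \<kappa> * \<delta>"
    have \<kappa>: "algebraic_int \<kappa>"
      unfolding \<kappa>_def using B(3) by (intro algebraic_int_sum algebraic_int_mult) auto
    have "\<rho> / \<delta> = (\<Sum>b\<in>B. of_rat (q b) * b) - \<kappa>"
      using \<delta>(2) by (simp add: \<rho>_def diff_divide_distrib flip: q)
    also have "\<dots> = (\<Sum>b\<in>B. of_rat (frac (q b)) * b)"
      unfolding \<kappa>_def sum_subtractf[symmetric]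
      by (intro sum.cong refl) (simp add: frac_def of_rat_diff left_diff_distrib)
    finally have \<rho>: "\<rho> = \<delta> * (\<Sum>b\<in>B. of_rat (frac (q b)) * b)"
      using \<delta>(2) by (simp add: field_simps)
    have "cmod (\<sigma> j \<rho>) \<le> R" for j
    proof -
      have "cmod (\<Sum>b\<in>B. of_rat (frac (q b)) * \<sigma> j b) \<le> (\<Sum>b\<in>B. C)"
      proof (rule sum_norm_le)
        fix b assume b: "b \<in> B"
        have "(of_rat (frac (q b)) :: complex) = of_real (of_rat (frac (q b)))"
          by (cases "frac (q b)") (simp add: of_rat_rat)
        moreover have "\<bar>of_rat (frac (q b)) :: real\<bar> \<le> 1"
          using frac_ge_0[of "q b"] frac_lt_1[of "q b"] by (simp add: less_imp_le)
        ultimately have "cmod (of_rat (frac (q b))) \<le> 1" by (metis norm_of_real)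
        then have "cmod (of_rat (frac (q b))) * cmod (\<sigma> j b) \<le> 1 * C"
          using C b by (intro mult_mono) auto
        then show "cmod (of_rat (frac (q b)) * \<sigma> j b) \<le> C" by (simp add: norm_mult)
      qed
      then have "cmod (\<sigma> j \<delta>) * cmod (\<Sum>b\<in>B. of_rat (frac (q b)) * \<sigma> j b) \<le>
          (\<Sum>j\<in>UNIV. cmod (\<sigma> j \<delta>)) * (card B * C)"
        by (intro mult_mono member_le_sum) (auto intro: sum_nonneg)
      then show ?thesis unfolding R_def \<rho> by (simp add: norm_mult)
    qed
    moreover have "algebraic_int \<rho>"
      unfolding \<rho>_def by (intro algebraic_int_diff algebraic_int_mult \<alpha> \<kappa> \<delta>)
    ultimately show ?thesis using \<kappa> by (intro bexI[of _ \<rho>] exI[of _ \<kappa>]) (auto simp: \<rho>_def)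
  qed
  then show ?thesis
    using finite_bounded_algebraic_ints[of R] by (intro exI[of _ "{\<alpha>. algebraic_int \<alpha> \<and> (\<forall>j. cmod (\<sigma> j \<alpha>) \<le> R)}"]) blast
qed

end

section \<open>Diagonal one-parameter groups and the quotient\<close>

lemma entry_mult_2: "(A ** B) $ a $ b = A $ a $ 1 * B $ 1 $ b + A $ a $ 2 * B $ 2 $ b"
  for A B :: "'a::comm_ring_1^2^2"
  by (simp add: matrix_matrix_mult_def sum_2)

lemma matrix_2_eqI:
  "A $ 1 $ 1 = B $ 1 $ 1 \<Longrightarrow> A $ 1 $ 2 = B $ 1 $ 2 \<Longrightarrow> A $ 2 $ 1 = B $ 2 $ 1 \<Longrightarrow> A $ 2 $ 2 = B $ 2 $ 2 \<Longrightarrow> A = B"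
  for A B :: "'a^2^2"
  by (simp add: vec_eq_iff forall_2)

lemma mat_1_entries [simp]:
  "(mat 1 :: 'a::zero_neq_one^2^2) $ 1 $ 1 = 1" "(mat 1 :: 'a^2^2) $ 1 $ 2 = 0"
  "(mat 1 :: 'a^2^2) $ 2 $ 1 = 0" "(mat 1 :: 'a^2^2) $ 2 $ 2 = 1"
  by (auto simp: mat_def)

definition diag_exp :: "complex \<Rightarrow> complex^2^2" where
  "diag_exp z = (\<chi> a b. if a = b then (if a = 1 then exp z else exp (- z)) else 0)"

lemma diag_exp_entries [simp]:
  "diag_exp z $ 1 $ 1 = exp z" "diag_exp z $ 2 $ 2 = exp (- z)" "diag_exp z $ 1 $ 2 = 0" "diag_exp z $ 2 $ 1 = 0"
  by (auto simp: diag_exp_def)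

lemma diag_exp_0 [simp]: "diag_exp 0 = mat 1"
  by (rule matrix_2_eqI) auto

lemma diag_exp_add: "diag_exp (z + w) = diag_exp z ** diag_exp w"
  by (rule matrix_2_eqI) (auto simp: entry_mult_2 exp_add exp_diff exp_minus field_simps)

lemma continuous_on_diag_exp [continuous_intros]:
  assumes "continuous_on S f"
  shows "continuous_on S (\<lambda>x. diag_exp (f x))"
  unfolding diag_exp_def
proof (intro continuous_on_vec_lambda)
  fix a b :: 2
  show "continuous_on S (\<lambda>x. if a = b then if a = 1 then exp (f x) else exp (- f x) else 0)"
    by (cases "a = b"; cases "a = 1") (auto intro!: continuous_intros assms)
qed

lemma diag_SL2_iff:
  "A \<in> diag_SL2 R \<longleftrightarrow> (\<forall>a b. A $ a $ b \<in> R) \<and> A $ 1 $ 1 * A $ 2 $ 2 = 1 \<and> A $ 1 $ 2 = 0 \<and> A $ 2 $ 1 = 0"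
  by (auto simp: diag_SL2_def SL2_def det_2 forall_2)

text \<open>On real diagonal matrices of determinant 1 the first entry does not vanish, so its sign is constant on the component.\<close>

lemma connected_component_diag_real:
  assumes R: "\<real> \<subseteq> R" and S: "S = {A \<in> diag_SL2 R. \<forall>a b. A $ a $ b \<in> \<real>}"
  shows "connected_component_set S (mat 1) = diag_exp ` \<real>"
proof
  show "connected_component_set S (mat 1) \<subseteq> diag_exp ` \<real>"
  proof
    fix A assume A: "A \<in> connected_component_set S (mat 1)"
    define C where "C = connected_component_set S (mat 1)"
    have CS: "C \<subseteq> S" unfolding C_def by (rule connected_component_subset)
    have "connected C" unfolding C_def by simp
    then have conn: "connected ((\<lambda>A. Re (A $ 1 $ 1)) ` C)"
      by (intro connected_continuous_image continuous_intros)
    have mem1: "mat 1 \<in> C"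
      using A unfolding C_def by (metis connected_component_eq_empty connected_component_refl_eq empty_iff mem_Collect_eq)
    have AC: "A \<in> C" using A by (simp add: C_def)
    have pos: "Re (A $ 1 $ 1) > 0"
    proof (rule ccontr)
      assume "\<not> Re (A $ 1 $ 1) > 0"
      then have "0 \<in> (\<lambda>A. Re (A $ 1 $ 1)) ` C"
        using connectedD_interval[OF conn, of "Re (A $ 1 $ 1)" 1 0] AC mem1 by force
      then obtain A' where A': "A' \<in> C" "Re (A' $ 1 $ 1) = 0" by auto
      then have "A' \<in> S" using CS by blast
      then have "A' $ 1 $ 1 \<in> \<real>" "A' $ 1 $ 1 * A' $ 2 $ 2 = 1"
        unfolding S by (auto simp: diag_SL2_iff)
      then show False using A'(2) by (auto elim!: Reals_cases)
    qed
    have AS: "A \<in> S" using AC CS by blast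
    then obtain x where x: "A $ 1 $ 1 = of_real x" unfolding S by (auto elim!: Reals_cases)
    then have "x > 0" using pos by simp
    have "A = diag_exp (of_real (ln x))"
    proof (rule matrix_2_eqI)
      show "A $ 1 $ 1 = diag_exp (of_real (ln x)) $ 1 $ 1"
        using \<open>x > 0\<close> x by (simp add: exp_of_real)
      then have "A $ 2 $ 2 = inverse (exp (of_real (ln x)))"
        using AS unfolding S by (auto simp: diag_SL2_iff inverse_eq_divide field_simps)
      then show "A $ 2 $ 2 = diag_exp (of_real (ln x)) $ 2 $ 2" by (simp add: exp_minus)
    qed (use AS in \<open>auto simp: S diag_SL2_iff\<close>)
    then show "A \<in> diag_exp ` \<real>" by auto
  qed
  have "connected (diag_exp ` \<real>)"
    by (intro connected_continuous_image continuous_intros convex_connected) (simp add: convex_Reals)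
  moreover have "diag_exp ` \<real> \<subseteq> S"
  proof
    fix A assume "A \<in> diag_exp ` \<real>"
    then obtain t where "A = diag_exp (of_real t)" by (auto elim!: Reals_cases)
    moreover have "exp (complex_of_real t) \<in> \<real>" "exp (- complex_of_real t) \<in> \<real>"
      by (simp_all flip: exp_of_real of_real_minus)
    ultimately show "A \<in> S"
      using R unfolding S by (auto simp: diag_SL2_iff forall_2 exp_minus)
  qed
  moreover have "mat 1 \<in> diag_exp ` \<real>" by (metis Reals_0 diag_exp_0 imageI)
  ultimately show "diag_exp ` \<real> \<subseteq> connected_component_set S (mat 1)"
    by (intro connected_component_maximal) auto
qed

lemma convex_Reals_complex: "convex (\<real> :: complex set)"
  by (simp add: convex_def complex_is_Real_iff)

lemma diag_SL2_UNIV: "diag_SL2 UNIV = diag_exp ` UNIV"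
proof
  show "diag_SL2 UNIV \<subseteq> diag_exp ` UNIV"
  proof
    fix A :: "complex^2^2" assume A: "A \<in> diag_SL2 UNIV"
    then have nz: "A $ 1 $ 1 \<noteq> 0" by (auto simp: diag_SL2_iff)
    then have e: "exp (Ln (A $ 1 $ 1)) = A $ 1 $ 1" by simp
    have "A $ 2 $ 2 = inverse (A $ 1 $ 1)"
      using A nz by (auto simp: diag_SL2_iff intro: inverse_unique[symmetric])
    then have "A = diag_exp (Ln (A $ 1 $ 1))"
      using A by (intro matrix_2_eqI) (simp_all add: diag_SL2_iff e exp_minus)
    then show "A \<in> diag_exp ` UNIV" by blast
  qed
qed (auto simp: diag_SL2_iff exp_minus)

lemma D_factor_eq:
  fixes \<tau> :: "'k::field_char_0 \<Rightarrow> complex"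
  assumes "field_embedding \<tau>"
  shows "D_factor \<tau> = diag_exp ` arch_completion \<tau>"
proof (cases "range \<tau> \<subseteq> \<real>")
  case True
  then have R: "arch_completion \<tau> = \<real>" using arch_completion_eq[OF assms] by simp
  have "diag_SL2 \<real> = {A \<in> diag_SL2 \<real>. \<forall>a b. A $ a $ b \<in> \<real>}"
    by (auto simp: diag_SL2_def SL2_def)
  from connected_component_diag_real[OF order_refl this] show ?thesis
    unfolding D_factor_def R .
next
  case False
  then have U: "arch_completion \<tau> = UNIV" using arch_completion_eq[OF assms] by simp
  have "connected (diag_exp ` UNIV)"
    by (intro connected_continuous_image continuous_intros) auto
  moreover have "mat 1 \<in> diag_exp ` UNIV" by (metis diag_exp_0 rangeI)
  ultimately show ?thesis
    unfolding D_factor_def U diag_SL2_UNIV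
    by (metis connected_component_eq_self)
qed

lemma DR_factor_eq:
  fixes \<tau> :: "'k::field_char_0 \<Rightarrow> complex"
  assumes "field_embedding \<tau>"
  shows "DR_factor \<tau> = diag_exp ` \<real>"
proof (cases "range \<tau> \<subseteq> \<real>")
  case True
  then have D: "D_factor \<tau> = diag_exp ` \<real>" using D_factor_eq[OF assms] arch_completion_eq[OF assms] by simp
  have "{A \<in> D_factor \<tau>. \<forall>a b. A $ a $ b \<in> \<real>} = diag_exp ` \<real>"
  proof -
    have "diag_exp ` \<real> \<subseteq> {A \<in> diag_SL2 \<real>. \<forall>a b. A $ a $ b \<in> \<real>}"
      using connected_component_diag_real[of \<real>, OF _ refl] connected_component_subset by blast
    then show ?thesis using D by auto
  qed
  moreover have "connected (diag_exp ` \<real>)"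
    by (intro connected_continuous_image continuous_intros convex_connected convex_Reals_complex)
  moreover have "mat 1 \<in> diag_exp ` \<real>" by (metis Reals_0 diag_exp_0 imageI)
  ultimately show ?thesis
    unfolding DR_factor_def by (metis connected_component_eq_self)
next
  case False
  then have "D_factor \<tau> = diag_SL2 UNIV"
    using D_factor_eq[OF assms] arch_completion_eq[OF assms] diag_SL2_UNIV by simp
  then show ?thesis
    unfolding DR_factor_def using connected_component_diag_real[of UNIV, OF _ refl] by simp
qed

definition torus_exp :: "complex^'r \<Rightarrow> complex^2^2^'r" where
  "torus_exp z = (\<chi> i. diag_exp (z $ i))"

lemma torus_exp_nth [simp]: "torus_exp z $ i = diag_exp (z $ i)"
  by (simp add: torus_exp_def)

lemma continuous_on_torus_exp [continuous_intros]:
  assumes "continuous_on S f"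
  shows "continuous_on S (\<lambda>x. torus_exp (f x))"
  unfolding torus_exp_def
  by (intro continuous_on_vec_lambda continuous_intros assms)

text \<open>The group operations of \<open>G \<sigma>\<close>, written without reference to \<open>\<sigma>\<close>; they make sense and are continuous on all families of
  matrices.  The inverse is given by the adjugate matrices.\<close>

definition pmult :: "complex^2^2^'r \<Rightarrow> complex^2^2^'r \<Rightarrow> complex^2^2^'r" (infixl "\<odot>" 70) where
  "g \<odot> h = (\<chi> i. g $ i ** h $ i)"

definition pone :: "complex^2^2^'r" where
  "pone = (\<chi> i. mat 1)"

lemma pmult_nth [simp]: "(g \<odot> h) $ i = g $ i ** h $ i"
  by (simp add: pmult_def)

lemma pone_nth [simp]: "pone $ i = mat 1"
  by (simp add: pone_def)

lemma pmult_assoc: "g \<odot> h \<odot> k = g \<odot> (h \<odot> k)"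
  by (simp add: vec_eq_iff matrix_mul_assoc)

lemma pmult_pone [simp]: "pone \<odot> g = g" "g \<odot> pone = g"
  by (simp_all add: vec_eq_iff)

lemma torus_exp_0 [simp]: "torus_exp 0 = pone"
  by (simp add: vec_eq_iff)

lemma torus_exp_add: "torus_exp (z + w) = torus_exp z \<odot> torus_exp w"
  by (simp add: vec_eq_iff diag_exp_add)

lemma tendsto_pmult [tendsto_intros]:
  assumes "(f \<longlongrightarrow> a) F" "(h \<longlongrightarrow> b) F"
  shows "((\<lambda>x. f x \<odot> h x) \<longlongrightarrow> a \<odot> b) F"
  unfolding pmult_def matrix_matrix_mult_def
  by (intro vec_tendstoI) (auto intro!: tendsto_intros assms)

lemma continuous_on_pmult [continuous_intros]:
  assumes "continuous_on S f" "continuous_on S h"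
  shows "continuous_on S (\<lambda>x. f x \<odot> h x)"
  using assms unfolding continuous_on_def by (auto intro: tendsto_pmult)

lemma G_simps: "g \<otimes>\<^bsub>G \<sigma>\<^esub> h = g \<odot> h" "\<one>\<^bsub>G \<sigma>\<^esub> = pone"
  "g \<in> carrier (G \<sigma>) \<longleftrightarrow> (\<forall>i. g $ i \<in> SL2 (arch_completion (\<sigma> i)))"
  by (simp_all add: G_def pmult_def pone_def)

lemma SL2_iff: "A \<in> SL2 R \<longleftrightarrow> A $ 1 $ 1 \<in> R \<and> A $ 1 $ 2 \<in> R \<and> A $ 2 $ 1 \<in> R \<and> A $ 2 $ 2 \<in> R \<and>
    A $ 1 $ 1 * A $ 2 $ 2 - A $ 1 $ 2 * A $ 2 $ 1 = 1"
  by (auto simp: SL2_def det_2 forall_2)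

definition adj2 :: "'a::comm_ring_1^2^2 \<Rightarrow> 'a^2^2" where
  "adj2 A = (\<chi> a b. if a = b then (if a = 1 then A $ 2 $ 2 else A $ 1 $ 1) else - A $ a $ b)"

lemma adj2_entries [simp]:
  "adj2 A $ 1 $ 1 = A $ 2 $ 2" "adj2 A $ 2 $ 2 = A $ 1 $ 1"
  "adj2 A $ 1 $ 2 = - A $ 1 $ 2" "adj2 A $ 2 $ 1 = - A $ 2 $ 1"
  by (auto simp: adj2_def)

lemma adj2_mult:
  assumes "A $ 1 $ 1 * A $ 2 $ 2 - A $ 1 $ 2 * A $ 2 $ 1 = 1"
  shows "adj2 A ** A = mat 1" "A ** adj2 A = mat 1"
  using assms by (auto intro!: matrix_2_eqI simp: entry_mult_2 algebra_simps)

definition padj :: "complex^2^2^'r \<Rightarrow> complex^2^2^'r" where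
  "padj g = (\<chi> i. adj2 (g $ i))"

lemma padj_nth [simp]: "padj g $ i = adj2 (g $ i)"
  by (simp add: padj_def)

lemma tendsto_adj2:
  fixes f :: "'x \<Rightarrow> complex^2^2"
  assumes "(f \<longlongrightarrow> A) F"
  shows "((\<lambda>x. adj2 (f x)) \<longlongrightarrow> adj2 A) F"
proof (intro vec_tendstoI)
  fix a b
  have "((\<lambda>x. f x $ c $ d) \<longlongrightarrow> A $ c $ d) F" for c d
    by (intro tendsto_vec_nth assms)
  then show "((\<lambda>x. adj2 (f x) $ a $ b) \<longlongrightarrow> adj2 A $ a $ b) F"
    by (cases "a = b"; cases "a = 1") (auto intro: tendsto_minus simp: adj2_def)
qed

lemma tendsto_padj [tendsto_intros]:
  assumes "(f \<longlongrightarrow> a) F"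
  shows "((\<lambda>x. padj (f x)) \<longlongrightarrow> padj a) F"
proof (rule vec_tendstoI)
  fix i
  have "((\<lambda>x. f x $ i) \<longlongrightarrow> a $ i) F" by (intro tendsto_vec_nth assms)
  then show "((\<lambda>x. padj (f x) $ i) \<longlongrightarrow> padj a $ i) F" by (simp add: tendsto_adj2)
qed

lemma closed_arch_completion [simp]: "closed (arch_completion \<tau>)"
  by (simp add: arch_completion_def)

lemma closed_carrier_G:
  fixes \<sigma> :: "'r::finite \<Rightarrow> 'k::field \<Rightarrow> complex"
  shows "closed (carrier (G \<sigma>))"
proof -
  have "carrier (G \<sigma>) = (\<Inter>i. (\<Inter>a. \<Inter>b. {g. g $ i $ a $ b \<in> arch_completion (\<sigma> i)}) \<inter> {g. g $ i $ 1 $ 1 * g $ i $ 2 $ 2 - g $ i $ 1 $ 2 * g $ i $ 2 $ 1 = 1})"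
    by (auto simp: G_simps SL2_def det_2)
  moreover have "closed {g :: complex^2^2^'r. g $ i $ a $ b \<in> arch_completion \<tau>}" for i a b and \<tau> :: "'k \<Rightarrow> complex"
    using continuous_closed_vimage[of "arch_completion \<tau>" "\<lambda>g :: complex^2^2^'r. g $ i $ a $ b"]
    by (auto simp: vimage_def intro!: continuous_intros)
  moreover have "closed {g :: complex^2^2^'r. g $ i $ 1 $ 1 * g $ i $ 2 $ 2 - g $ i $ 1 $ 2 * g $ i $ 2 $ 1 = 1}" for i
    by (intro closed_Collect_eq continuous_intros)
  ultimately show ?thesis
    by (simp only:) (intro closed_INT ballI closed_Int; assumption)
qed

context arch_number_field
begin

lemma completion_closed:
  "x \<in> arch_completion (\<sigma> i) \<Longrightarrow> y \<in> arch_completion (\<sigma> i) \<Longrightarrow> x + y \<in> arch_completion (\<sigma> i)"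
  "x \<in> arch_completion (\<sigma> i) \<Longrightarrow> y \<in> arch_completion (\<sigma> i) \<Longrightarrow> x * y \<in> arch_completion (\<sigma> i)"
  "x \<in> arch_completion (\<sigma> i) \<Longrightarrow> - x \<in> arch_completion (\<sigma> i)"
  "x \<in> arch_completion (\<sigma> i) \<Longrightarrow> exp x \<in> arch_completion (\<sigma> i)"
  "of_real t \<in> arch_completion (\<sigma> i)"
  by (auto simp: arch_completion_eq[OF embedding] split: if_splits elim!: Reals_cases simp flip: exp_of_real)

lemma group_G_\<sigma>: "group (G \<sigma>)"
  by (rule group_G) simp

sublocale G: group "G \<sigma>"
  by (rule group_G_\<sigma>)

lemma carrier_det: "g \<in> carrier (G \<sigma>) \<Longrightarrow> g $ i $ 1 $ 1 * g $ i $ 2 $ 2 - g $ i $ 1 $ 2 * g $ i $ 2 $ 1 = 1"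
  by (simp add: G_simps SL2_iff)

lemma carrier_entry: "g \<in> carrier (G \<sigma>) \<Longrightarrow> g $ i $ a $ b \<in> arch_completion (\<sigma> i)"
  by (simp add: G_simps SL2_def)

lemma pmult_carrier [simp]:
  "g \<in> carrier (G \<sigma>) \<Longrightarrow> h \<in> carrier (G \<sigma>) \<Longrightarrow> g \<odot> h \<in> carrier (G \<sigma>)"
  using G.m_closed unfolding G_simps by (simp add: G_simps)

lemma pone_carrier [simp]: "pone \<in> carrier (G \<sigma>)"
  using G.one_closed by (simp add: G_simps(2))

lemma padj_carrier [simp]: "g \<in> carrier (G \<sigma>) \<Longrightarrow> padj g \<in> carrier (G \<sigma>)"
  unfolding G_simps padj_nth SL2_iff[of "adj2 _"] SL2_iff[of "g $ _"] adj2_entries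
  by (auto simp: completion_closed mult.commute)

lemma padj_mult [simp]:
  assumes "g \<in> carrier (G \<sigma>)"
  shows "padj g \<odot> g = pone" "g \<odot> padj g = pone"
  using carrier_det[OF assms] by (simp_all add: vec_eq_iff[of "_ \<odot> _"] adj2_mult)

lemma padj_mult_assoc [simp]:
  assumes "g \<in> carrier (G \<sigma>)"
  shows "padj g \<odot> (g \<odot> h) = h" "g \<odot> (padj g \<odot> h) = h"
  using padj_mult[OF assms] by (simp_all flip: pmult_assoc)

lemma inv_G: "g \<in> carrier (G \<sigma>) \<Longrightarrow> inv\<^bsub>G \<sigma>\<^esub> g = padj g"
  by (rule G.inv_equality) (simp_all add: G_simps(1,2))

lemma subgroup_G_iff:
  "subgroup H (G \<sigma>) \<longleftrightarrow> H \<subseteq> carrier (G \<sigma>) \<and> pone \<in> H \<and>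
     (\<forall>g\<in>H. \<forall>h\<in>H. g \<odot> h \<in> H) \<and> (\<forall>g\<in>H. padj g \<in> H)"
proof -
  have "H \<subseteq> carrier (G \<sigma>) \<Longrightarrow> (\<forall>g\<in>H. inv\<^bsub>G \<sigma>\<^esub> g \<in> H) \<longleftrightarrow> (\<forall>g\<in>H. padj g \<in> H)"
    by (metis inv_G subsetD)
  then show ?thesis unfolding subgroup_def G_simps(1,2) by blast
qed

text \<open>The diagonal embedding.\<close>

definition emb :: "'k^2^2 \<Rightarrow> complex^2^2^'r" where
  "emb A = (\<chi> i a b. \<sigma> i (A $ a $ b))"

lemma emb_nth [simp]: "emb A $ i $ a $ b = \<sigma> i (A $ a $ b)"
  by (simp add: emb_def)

lemma emb_mult: "emb (A ** B) = emb A \<odot> emb B"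
  by (simp add: vec_eq_iff[of "emb _"] vec_eq_iff[of "emb _ $ _"] vec_eq_iff[of "emb _ $ _ $ _"] entry_mult_2)

lemma emb_1 [simp]: "emb (mat 1) = pone"
  by (simp add: vec_eq_iff forall_2)

lemma emb_adj2: "emb (adj2 A) = padj (emb A)"
  by (simp add: vec_eq_iff forall_2)

lemma emb_carrier: "A \<in> SL2 UNIV \<Longrightarrow> emb A \<in> carrier (G \<sigma>)"
proof -
  assume "A \<in> SL2 UNIV"
  then have "\<sigma> i (A $ 1 $ 1 * A $ 2 $ 2 - A $ 1 $ 2 * A $ 2 $ 1) = \<sigma> i 1" for i
    by (simp only: SL2_iff)
  then show ?thesis by (simp add: G_simps SL2_iff)
qed

abbreviation SLO :: "('k^2^2) set" where "SLO \<equiv> SL2 {x. algebraic_int x}"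

lemma \<Gamma>_eq: "\<Gamma> \<sigma> = emb ` SLO"
  by (simp add: \<Gamma>_def emb_def)

lemma SLO_UNIV: "A \<in> SLO \<Longrightarrow> A \<in> SL2 UNIV"
  by (simp add: SL2_iff)

lemma SLO_mult: "A \<in> SLO \<Longrightarrow> B \<in> SLO \<Longrightarrow> A ** B \<in> SLO"
proof -
  assume A: "A \<in> SLO" and B: "B \<in> SLO"
  then have "det (A ** B) = 1" by (simp add: det_mul SL2_def)
  then show ?thesis
    using A B by (auto simp: SL2_def entry_mult_2 intro!: algebraic_int_add algebraic_int_mult)
qed

lemma SLO_adj2: "A \<in> SLO \<Longrightarrow> adj2 A \<in> SLO"
  by (auto simp: SL2_iff mult.commute)

lemma subgroup_\<Gamma>: "subgroup (\<Gamma> \<sigma>) (G \<sigma>)"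
  unfolding subgroup_G_iff \<Gamma>_eq
proof (intro conjI ballI)
  have "mat 1 \<in> SLO" by (simp add: SL2_iff)
  then show "pone \<in> emb ` SLO" by (metis emb_1 imageI)
  show "emb ` SLO \<subseteq> carrier (G \<sigma>)"
    by (intro image_subsetI emb_carrier SLO_UNIV)
  fix g assume "g \<in> emb ` SLO"
  then obtain A where A: "g = emb A" "A \<in> SLO" by blast
  then have "padj g = emb (adj2 A)" by (simp add: emb_adj2)
  then show "padj g \<in> emb ` SLO" using SLO_adj2[OF A(2)] by blast
  fix h assume "h \<in> emb ` SLO"
  then obtain B where B: "h = emb B" "B \<in> SLO" by blast
  then have "g \<odot> h = emb (A ** B)" using A by (simp add: emb_mult)
  then show "g \<odot> h \<in> emb ` SLO" using SLO_mult[OF A(2) B(2)] by blast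
qed

lemma \<Gamma>_carrier: "\<gamma> \<in> \<Gamma> \<sigma> \<Longrightarrow> \<gamma> \<in> carrier (G \<sigma>)"
  by (rule subgroup.mem_carrier[OF subgroup_\<Gamma>])

lemma \<Gamma>_closed:
  "\<gamma> \<in> \<Gamma> \<sigma> \<Longrightarrow> \<gamma>' \<in> \<Gamma> \<sigma> \<Longrightarrow> \<gamma> \<odot> \<gamma>' \<in> \<Gamma> \<sigma>" "\<gamma> \<in> \<Gamma> \<sigma> \<Longrightarrow> padj \<gamma> \<in> \<Gamma> \<sigma>" "pone \<in> \<Gamma> \<sigma>"
  using subgroup_\<Gamma>[unfolded subgroup_G_iff] by auto

lemma \<pi>_def': "\<pi> \<sigma> g = (\<lambda>\<gamma>. g \<odot> \<gamma>) ` \<Gamma> \<sigma>"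
  unfolding \<pi>_def l_coset_def G_simps by auto

lemma \<pi>_eq_iff:
  assumes "g \<in> carrier (G \<sigma>)" "h \<in> carrier (G \<sigma>)"
  shows "\<pi> \<sigma> g = \<pi> \<sigma> h \<longleftrightarrow> (\<exists>\<gamma>\<in>\<Gamma> \<sigma>. g = h \<odot> \<gamma>)"
proof
  assume "\<pi> \<sigma> g = \<pi> \<sigma> h"
  moreover have "g \<in> \<pi> \<sigma> g" unfolding \<pi>_def' using \<Gamma>_closed(3) by (force intro: image_eqI[of _ _ pone])
  ultimately show "\<exists>\<gamma>\<in>\<Gamma> \<sigma>. g = h \<odot> \<gamma>" unfolding \<pi>_def' by auto
next
  assume "\<exists>\<gamma>\<in>\<Gamma> \<sigma>. g = h \<odot> \<gamma>"
  then obtain \<gamma> where \<gamma>: "\<gamma> \<in> \<Gamma> \<sigma>" "g = h \<odot> \<gamma>" by blast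
  show "\<pi> \<sigma> g = \<pi> \<sigma> h"
  proof
    show "\<pi> \<sigma> g \<subseteq> \<pi> \<sigma> h"
      unfolding \<pi>_def' using \<gamma> \<Gamma>_closed(1) by (auto simp: pmult_assoc)
    show "\<pi> \<sigma> h \<subseteq> \<pi> \<sigma> g"
      unfolding \<pi>_def'
    proof (rule image_subsetI)
      fix \<gamma>' assume "\<gamma>' \<in> \<Gamma> \<sigma>"
      then have mem: "padj \<gamma> \<odot> \<gamma>' \<in> \<Gamma> \<sigma>"
        by (intro \<Gamma>_closed(1) \<Gamma>_closed(2)[OF \<gamma>(1)])
      have eq: "h \<odot> \<gamma>' = g \<odot> (padj \<gamma> \<odot> \<gamma>')"
        using \<gamma>(2) \<Gamma>_carrier[OF \<gamma>(1)] by (simp add: pmult_assoc)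
      show "h \<odot> \<gamma>' \<in> (\<odot>) g ` \<Gamma> \<sigma>"
        unfolding eq by (rule imageI[OF mem])
    qed
  qed
qed

lemma act_\<pi>: "h <#\<^bsub>G \<sigma>\<^esub> \<pi> \<sigma> g = \<pi> \<sigma> (h \<odot> g)"
  unfolding \<pi>_def' unfolding l_coset_def G_simps by (auto simp: pmult_assoc image_iff)

lemma coset_orbit_eq: "coset_orbit \<sigma> H (\<pi> \<sigma> g) = (\<lambda>h. \<pi> \<sigma> (h \<odot> g)) ` H"
  by (simp add: coset_orbit_def act_\<pi>)

end

section \<open>Divergent orbits and rational lines\<close>

lemma entry_le_norm: "cmod ((g :: complex^2^2^'r::finite) $ i $ a $ b) \<le> norm g"
proof -
  have "cmod (g $ i $ a $ b) \<le> norm (g $ i $ a)" by (rule Finite_Cartesian_Product.norm_nth_le)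
  also have "\<dots> \<le> norm (g $ i)" by (rule Finite_Cartesian_Product.norm_nth_le)
  also have "\<dots> \<le> norm g" by (rule Finite_Cartesian_Product.norm_nth_le)
  finally show ?thesis .
qed

lemma norm_le_sum_components: "norm (x :: 'a::real_normed_vector^'n::finite) \<le> (\<Sum>i\<in>UNIV. norm (x $ i))"
  unfolding norm_vec_def by (rule L2_set_le_sum) simp

lemma norm_le_entries:
  fixes g :: "complex^2^2^'r::finite" and R :: real
  assumes "\<And>i a b. cmod (g $ i $ a $ b) \<le> R"
  shows "norm g \<le> CARD('r) * (4 * R)"
proof -
  have row: "norm (g $ i $ a) \<le> 2 * R" for i a
    using norm_le_sum_components[of "g $ i $ a"] assms[of i a 1] assms[of i a 2] by (simp add: sum_2)
  have "norm (g $ i) \<le> 4 * R" for i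
    using norm_le_sum_components[of "g $ i"] row[of i 1] row[of i 2] by (simp add: sum_2)
  then have "(\<Sum>i\<in>UNIV. norm (g $ i)) \<le> (\<Sum>i\<in>(UNIV::'r set). 4 * R)"
    by (intro sum_mono)
  then show ?thesis using norm_le_sum_components[of g] by simp
qed

lemma proportional_vectors:
  fixes x y :: "'a::field"
  assumes "x * y' = x' * y" "x \<noteq> 0 \<or> y \<noteq> 0"
  shows "\<exists>m. x' = m * x \<and> y' = m * y"
proof (cases "x = 0")
  case True
  then have "x' = 0" using assms by simp
  then show ?thesis using True assms(2) by (intro exI[of _ "y' / y"]) simp
next
  case False
  then show ?thesis using assms(1) by (intro exI[of _ "x' / x"]) (simp add: field_simps)
qed

text \<open>The sizes of the box for \<open>unbalanced_lattice_vectors\<close>: at the place \<open>i\<close> the row \<open>a\<close> shrinks by \<open>t\<close> and the other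
  row grows by \<open>t\<close>, so the volume does not depend on \<open>t\<close>.\<close>

definition weight :: "'r \<Rightarrow> 2 \<Rightarrow> real \<Rightarrow> 'r \<Rightarrow> 2 \<Rightarrow> real" where
  "weight i a t j b = (if j \<noteq> i then 1 else if b = a then 1 / t else t)"

lemma weight_pos: "t > 0 \<Longrightarrow> weight i a t j b > 0"
  by (simp add: weight_def)

lemma weight_1_2: "t > 0 \<Longrightarrow> weight i a t j 1 * weight i a t j 2 = 1"
  using exhaust_2[of a] by (auto simp: weight_def)

context arch_number_field
begin

text \<open>The \<open>a\<close>-th coordinate of the vector \<open>g $ j\<close> applied to \<open>(x, y)\<close> at the place \<open>j\<close>.\<close>

definition row_form :: "complex^2^2^'r \<Rightarrow> 'r \<Rightarrow> 2 \<Rightarrow> 'k \<Rightarrow> 'k \<Rightarrow> complex" where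
  "row_form g j a x y = g $ j $ a $ 1 * \<sigma> j x + g $ j $ a $ 2 * \<sigma> j y"

lemma row_form_scale: "row_form g j a (c * x) (c * y) = \<sigma> j c * row_form g j a x y"
  by (simp add: row_form_def algebra_simps)

lemma pmult_emb_entry: "(g \<odot> emb A) $ j $ a $ b = row_form g j a (A $ 1 $ b) (A $ 2 $ b)"
  by (simp add: entry_mult_2 row_form_def)

lemma row_form_det:
  assumes "g \<in> carrier (G \<sigma>)"
  shows "row_form g j 1 x y * row_form g j 2 x' y' - row_form g j 1 x' y' * row_form g j 2 x y = \<sigma> j (x * y' - x' * y)"
proof -
  have "row_form g j 1 x y * row_form g j 2 x' y' - row_form g j 1 x' y' * row_form g j 2 x y =
      (g $ j $ 1 $ 1 * g $ j $ 2 $ 2 - g $ j $ 1 $ 2 * g $ j $ 2 $ 1) * (\<sigma> j x * \<sigma> j y' - \<sigma> j x' * \<sigma> j y)"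
    by (simp add: row_form_def algebra_simps)
  then show ?thesis unfolding carrier_det[OF assms] by simp
qed

lemma row_form_nonzero_row:
  assumes g: "g \<in> carrier (G \<sigma>)" and xy: "x \<noteq> 0 \<or> y \<noteq> 0"
  shows "\<exists>a. row_form g j a x y \<noteq> 0"
proof (rule ccontr)
  assume "\<not> (\<exists>a. row_form g j a x y \<noteq> 0)"
  then have z: "row_form g j a x y = 0" for a by simp
  have "x * y' - x' * y = 0" for x' y'
    using row_form_det[OF g, of j x y x' y'] z by (simp del: \<sigma>_more \<sigma>_simps)
  from this[of 1 0] this[of 0 1] show False using xy by simp
qed

lemma row_form_in_completion:
  assumes "g \<in> carrier (G \<sigma>)"
  shows "row_form g j a x y \<in> arch_completion (\<sigma> j)"
  unfolding row_form_def by (intro completion_closed carrier_entry assms \<sigma>_in_completion)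

text \<open>The pigeonhole principle with \<open>M\<close> intervals for every real coordinate at the places other than \<open>i\<close>, and with \<open>M\<^sup>2\<close> and 1
  intervals for the two rows at \<open>i\<close>.  Working with a fixed \<open>g\<close> keeps the constant \<open>K\<close> independent of \<open>M\<close>.\<close>

lemma unbalanced_lattice_vectors:
  assumes g: "g \<in> carrier (G \<sigma>)"
  shows "\<exists>K>0. \<forall>M::nat. M \<ge> 1 \<longrightarrow> (\<exists>x y. algebraic_int x \<and> algebraic_int y \<and> (x \<noteq> 0 \<or> y \<noteq> 0) \<and>
           (\<forall>j b. cmod (row_form g j b x y) \<le> K * weight i a M j b))"
proof -
  obtain B :: "'k set" where B: "finite B" "rat_space.independent B" "rat_space.span B = UNIV"
    "\<forall>b\<in>B. algebraic_int b"
    using number_field_integral_basis[OF number_field] by (elim exE conjE) (rule that)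
  obtain C where C: "C \<ge> 1" "\<forall>j. \<forall>b\<in>B. cmod (\<sigma> j b) \<le> C"
    using basis_bound[OF B(1)] by (elim exE conjE) (rule that)
  define BB where "BB = B \<times> (UNIV :: bool set)"
  define J where "J = coords \<times> (UNIV :: 2 set)"
  define C0 where "C0 = norm g * C"
  have C0: "C0 \<ge> 0" using C(1) by (simp add: C0_def)
  define K where "K = 4 * (card BB * C0 + 1)"
  have "K > 0" using C0 by (simp add: K_def add_nonneg_pos)
  define L where "L c b = part (snd (fst c))
    (g $ fst (fst c) $ snd c $ (if snd b then 2 else 1) * \<sigma> (fst (fst c)) (fst b))"
    for c :: "('r \<times> bool) \<times> 2" and b :: "'k \<times> bool"
  have fin: "finite BB" "finite J" using B(1) by (simp_all add: BB_def J_def)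
  have L: "\<bar>L c b\<bar> \<le> C0" if "b \<in> BB" for c b
  proof -
    have "\<bar>L c b\<bar> \<le> cmod (g $ fst (fst c) $ snd c $ (if snd b then 2 else 1)) * cmod (\<sigma> (fst (fst c)) (fst b))"
      unfolding L_def norm_mult[symmetric] by (rule part_le_norm)
    also have "\<dots> \<le> norm g * C"
      using C(2) that by (intro mult_mono entry_le_norm) (auto simp: BB_def)
    finally show ?thesis by (simp add: C0_def)
  qed
  have vectors: "\<exists>x y. algebraic_int x \<and> algebraic_int y \<and> (x \<noteq> 0 \<or> y \<noteq> 0) \<and>
           (\<forall>j b. cmod (row_form g j b x y) \<le> K * weight i a M j b)" if M: "M \<ge> 1" for M :: nat
  proof -
    define k where "k c = (if fst (fst c) \<noteq> i then M else if snd c = a then M ^ 2 else 1)"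
      for c :: "('r \<times> bool) \<times> 2"
    have "(\<Prod>c\<in>J. k c) = (\<Prod>c\<in>coords. \<Prod>b\<in>UNIV. k (c, b))"
      unfolding J_def by (subst prod.cartesian_product) simp
    also have "\<dots> = (\<Prod>c\<in>coords. M ^ 2)"
    proof (rule prod.cong[OF refl])
      fix c :: "'r \<times> bool"
      have "(\<Prod>b\<in>UNIV. k (c, b)) = k (c, 1) * k (c, 2)"
        unfolding UNIV_2 by simp
      also have "\<dots> = M ^ 2"
        using exhaust_2[of a] by (auto simp: k_def power2_eq_square)
      finally show "(\<Prod>b\<in>UNIV. k (c, b)) = M ^ 2" .
    qed
    also have "\<dots> = M ^ (2 * card coords)" by (simp add: power_mult)
    also have "\<dots> \<le> M ^ (2 * card B)"
      using M card_coords_le[OF B(1,3)] by (intro power_increasing) auto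
    also have "2 * card B = card BB" by (simp add: BB_def card_cartesian_product)
    also have "M ^ card BB < (M + 1) ^ card BB"
    proof (rule power_strict_mono)
      have "B \<noteq> {}"
      proof
        assume "B = {}"
        then have "(1::'k) \<in> {0}" using B(3) by (metis UNIV_I rat_space.span_empty)
        then show False by simp
      qed
      then show "0 < card BB" using fin by (simp add: BB_def card_gt_0_iff)
    qed auto
    finally have less: "(\<Prod>c\<in>J. k c) < (M + 1) ^ card BB" .
    have "\<exists>z::'k \<times> bool \<Rightarrow> int. (\<exists>b\<in>BB. z b \<noteq> 0) \<and>
      (\<forall>c\<in>J. \<bar>\<Sum>b\<in>BB. of_int (z b) * L c b\<bar> \<le> 2 * (card BB * C0 * M + 1) / k c)"
    proof (rule integer_pigeonhole[OF fin _ C0 _ less])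
      show "\<bar>L c b\<bar> \<le> C0" if "b \<in> BB" for c b by (rule L[OF that])
      show "1 \<le> k c" for c using M by (simp add: k_def)
    qed
    then obtain z :: "'k \<times> bool \<Rightarrow> int" where z: "\<exists>b\<in>BB. z b \<noteq> 0"
      "\<forall>c\<in>J. \<bar>\<Sum>b\<in>BB. of_int (z b) * L c b\<bar> \<le> 2 * (card BB * C0 * M + 1) / k c"
      by (elim exE conjE) (rule that)
    define x where "x = (\<Sum>b\<in>B. of_int (z (b, False)) * b)"
    define y where "y = (\<Sum>b\<in>B. of_int (z (b, True)) * b)"
    have int: "algebraic_int x" "algebraic_int y"
      unfolding x_def y_def using B(4) by (auto intro!: algebraic_int_sum algebraic_int_mult)
    have nz: "x \<noteq> 0 \<or> y \<noteq> 0"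
    proof (rule ccontr)
      assume "\<not> (x \<noteq> 0 \<or> y \<noteq> 0)"
      then have "z (b, t) = 0" if "b \<in> B" for b t
        using int_combination_eq_0[OF B(1,2), of "\<lambda>b. z (b, t)", OF _ that]
        by (cases t) (auto simp: x_def y_def)
      then show False using z(1) by (auto simp: BB_def)
    qed
    have sum_eq: "(\<Sum>b\<in>BB. of_int (z b) * L ((j, p), d) b) = part p (row_form g j d x y)" for j p d
    proof -
      have "(\<Sum>b\<in>BB. of_int (z b) * L ((j, p), d) b) =
          (\<Sum>b\<in>B. \<Sum>t\<in>UNIV. of_int (z (b, t)) * L ((j, p), d) (b, t))"
        unfolding BB_def by (subst sum.cartesian_product) (simp add: split_def)
      also have "\<dots> = (\<Sum>b\<in>B. of_int (z (b, False)) * part p (g $ j $ d $ 1 * \<sigma> j b)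
          + of_int (z (b, True)) * part p (g $ j $ d $ 2 * \<sigma> j b))"
        by (intro sum.cong refl) (simp add: UNIV_bool L_def)
      also have "\<dots> = part p (\<Sum>b\<in>B. of_int (z (b, False)) * (g $ j $ d $ 1 * \<sigma> j b))
          + part p (\<Sum>b\<in>B. of_int (z (b, True)) * (g $ j $ d $ 2 * \<sigma> j b))"
        unfolding sum.distrib part_sum_int ..
      also have "\<dots> = part p ((\<Sum>b\<in>B. of_int (z (b, False)) * (g $ j $ d $ 1 * \<sigma> j b))
          + (\<Sum>b\<in>B. of_int (z (b, True)) * (g $ j $ d $ 2 * \<sigma> j b)))"
        by (simp add: part_def)
      also have "(\<Sum>b\<in>B. of_int (z (b, False)) * (g $ j $ d $ 1 * \<sigma> j b)) = g $ j $ d $ 1 * \<sigma> j x"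
        unfolding x_def by (simp add: sum_distrib_left mult.left_commute)
      also have "(\<Sum>b\<in>B. of_int (z (b, True)) * (g $ j $ d $ 2 * \<sigma> j b)) = g $ j $ d $ 2 * \<sigma> j y"
        unfolding y_def by (simp add: sum_distrib_left mult.left_commute)
      finally show ?thesis by (simp add: row_form_def)
    qed
    have "cmod (row_form g j d x y) \<le> K * weight i a M j d" for j d
    proof -
      have "cmod (row_form g j d x y) \<le> 2 * (K / 2 * weight i a M j d)"
      proof (rule norm_le_parts[OF _ row_form_in_completion[OF g]])
        fix p assume "(j, p) \<in> coords"
        then have "((j, p), d) \<in> J" by (simp add: J_def)
        then have "\<bar>part p (row_form g j d x y)\<bar> \<le> 2 * (card BB * C0 * M + 1) / k ((j, p), d)"
          using z(2) unfolding sum_eq[symmetric] by blast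
        also have "\<dots> \<le> (K / 2 * M) / k ((j, p), d)"
        proof (rule divide_right_mono)
          have "1 \<le> real M" using M by simp
          then show "2 * (card BB * C0 * M + 1) \<le> K / 2 * M" unfolding K_def by (simp add: algebra_simps)
        qed simp
        also have "\<dots> = K / 2 * weight i a M j d"
          using M by (simp add: k_def weight_def power2_eq_square)
        finally show "\<bar>part p (row_form g j d x y)\<bar> \<le> K / 2 * weight i a M j d" .
      qed
      then show ?thesis by simp
    qed
    then show ?thesis using int nz by (intro exI[of _ x] exI[of _ y]) auto
  qed
  show ?thesis by (rule exI[of _ K], intro conjI allI impI \<open>K > 0\<close> vectors) simp
qed

text \<open>If the vectors of the boxes for all large \<open>M\<close> were multiples \<open>c * (x M0, y M0)\<close> of one vector, then, as row \<open>a\<close> does not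
  annihilate that vector, \<open>c\<close> would be of size \<open>1 / M\<close> at \<open>i\<close> and bounded elsewhere, against the product inequality for
  a non-zero coordinate of the integral vector.\<close>

lemma lattice_vectors_change_direction:
  assumes g: "g \<in> carrier (G \<sigma>)" and K: "K > 0"
    and none: "\<And>x y. algebraic_int x \<Longrightarrow> algebraic_int y \<Longrightarrow> row_form g i a x y = 0 \<Longrightarrow> x = 0 \<and> y = 0"
    and int: "\<And>M::nat. M \<ge> 1 \<Longrightarrow> algebraic_int (x M) \<and> algebraic_int (y M)"
    and nz: "\<And>M. M \<ge> 1 \<Longrightarrow> x M \<noteq> 0 \<or> y M \<noteq> 0"
    and bound: "\<And>M j b. M \<ge> 1 \<Longrightarrow> cmod (row_form g j b (x M) (y M)) \<le> K * weight i a M j b"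
    and M0: "M0 \<ge> 1"
  shows "\<exists>M\<ge>M0. x M * y (Suc M) \<noteq> x (Suc M) * y M"
proof (rule ccontr)
  assume "\<not> (\<exists>M\<ge>M0. x M * y (Suc M) \<noteq> x (Suc M) * y M)"
  then have det0: "\<And>M. M \<ge> M0 \<Longrightarrow> x M * y (Suc M) = x (Suc M) * y M" by blast
  have propor: "\<exists>c. x M = c * x M0 \<and> y M = c * y M0" if "M \<ge> M0" for M
    using that
  proof (induction M rule: dec_induct)
    case base
    show ?case by (intro exI[of _ 1]) simp
  next
    case (step M)
    then obtain c where c: "x M = c * x M0" "y M = c * y M0" by blast
    have "M \<ge> 1" using step(1) M0 by simp
    then obtain m where "x (Suc M) = m * x M" "y (Suc M) = m * y M"
      using proportional_vectors[OF det0[OF step(1)] nz] by blast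
    then show ?case using c by (intro exI[of _ "m * c"]) simp
  qed
  have nz0: "x M0 \<noteq> 0 \<or> y M0 \<noteq> 0" using nz M0 by blast
  then obtain u where u: "u = x M0 \<or> u = y M0" "u \<noteq> 0" by blast
  have "\<exists>b. row_form g j b (x M0) (y M0) \<noteq> 0 \<and> (j = i \<longrightarrow> b = a)" for j
    using row_form_nonzero_row[OF g nz0, of j] none[of "x M0" "y M0"] int[OF M0] nz0 by (cases "j = i") auto
  then obtain r where r: "\<And>j. row_form g j (r j) (x M0) (y M0) \<noteq> 0" "r i = a" by metis
  define Q where "Q j = K / cmod (row_form g j (r j) (x M0) (y M0)) * cmod (\<sigma> j u)" for j
  define P where "P = (\<Prod>j\<in>UNIV. Q j ^ local_degree j)"
  have Q: "Q j > 0" for j using K r(1)[of j] u(2) by (simp add: Q_def)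
  obtain M where M: "M \<ge> M0" "real M > P" "M \<ge> 1"
  proof -
    obtain n :: nat where "P < real n" using reals_Archimedean2 by blast
    then show ?thesis using that[of "max n M0"] M0 by auto
  qed
  obtain c where c: "x M = c * x M0" "y M = c * y M0" using propor[OF M(1)] by blast
  have "algebraic_int (c * u)" using u(1) int[OF M(3)] c by auto
  moreover have "c * u \<noteq> 0" using u nz[OF M(3)] c by auto
  ultimately have "1 \<le> (\<Prod>j\<in>UNIV. cmod (\<sigma> j (c * u)) ^ local_degree j)"
    by (rule algebraic_int_norm_ge_1)
  also have "\<dots> \<le> (\<Prod>j\<in>UNIV. (Q j * weight i a M j (r j)) ^ local_degree j)"
  proof (intro prod_mono conjI power_mono)
    fix j
    have "cmod (\<sigma> j c) * cmod (row_form g j (r j) (x M0) (y M0)) \<le> K * weight i a M j (r j)"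
      using bound[OF M(3), of j "r j"] unfolding c row_form_scale by (simp add: norm_mult)
    then have "cmod (\<sigma> j c) \<le> K * weight i a M j (r j) / cmod (row_form g j (r j) (x M0) (y M0))"
      using r(1)[of j] by (simp add: field_simps)
    then have "cmod (\<sigma> j c) * cmod (\<sigma> j u) \<le>
        K * weight i a M j (r j) / cmod (row_form g j (r j) (x M0) (y M0)) * cmod (\<sigma> j u)"
      by (rule mult_right_mono) simp
    then show "cmod (\<sigma> j (c * u)) \<le> Q j * weight i a M j (r j)"
      by (simp add: Q_def norm_mult mult_ac)
  qed auto
  also have "\<dots> = P * (\<Prod>j\<in>UNIV. weight i a M j (r j) ^ local_degree j)"
    unfolding P_def power_mult_distrib prod.distrib ..
  also have "(\<Prod>j\<in>UNIV. weight i a M j (r j) ^ local_degree j) = (1 / M) ^ local_degree i"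
  proof -
    have "(\<Prod>j\<in>UNIV. weight i a M j (r j) ^ local_degree j) =
        weight i a M i (r i) ^ local_degree i * (\<Prod>j\<in>UNIV - {i}. weight i a M j (r j) ^ local_degree j)"
      by (rule prod.remove) auto
    also have "(\<Prod>j\<in>UNIV - {i}. weight i a M j (r j) ^ local_degree j) = 1"
      by (intro prod.neutral) (auto simp: weight_def)
    finally show ?thesis using r(2) by (simp add: weight_def)
  qed
  also have "P * (1 / M) ^ local_degree i \<le> P * (1 / M)"
  proof (rule mult_left_mono)
    have "(1 / real M) ^ local_degree i \<le> (1 / real M) ^ 1"
      using M(3) by (intro power_decreasing) (auto simp: local_degree_def)
    then show "(1 / real M) ^ local_degree i \<le> 1 / real M" by simp
    show "0 \<le> P" unfolding P_def using Q by (intro prod_nonneg) (auto intro: less_imp_le)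
  qed
  also have "\<dots> < 1" using M(2,3) by simp
  finally show False by simp
qed

lemma compactin_\<pi>_bounded: "compactin (quot_top \<sigma>) (\<pi> \<sigma> ` {h \<in> carrier (G \<sigma>). norm h \<le> R})"
proof (rule image_compactin)
  have "{h \<in> carrier (G \<sigma>). norm h \<le> R} = cball 0 R \<inter> carrier (G \<sigma>)" by auto
  then have "compact {h \<in> carrier (G \<sigma>). norm h \<le> R}"
    using closed_carrier_G[of \<sigma>] by (simp add: compact_Int_closed)
  then show "compactin (top_G \<sigma>) {h \<in> carrier (G \<sigma>). norm h \<le> R}"
    by (auto simp: compactin_subtopology)
  show "continuous_map (top_G \<sigma>) (quot_top \<sigma>) (\<pi> \<sigma>)"
    by (rule quotient_imp_continuous_map[OF quotient_map_\<pi>])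
qed

text \<open>The element of \<open>D \<sigma> {i}\<close> that multiplies row \<open>a\<close> at \<open>i\<close> by \<open>t\<close>; it maps the box with the given weights to a box that
  does not depend on \<open>t\<close>.\<close>

definition ray :: "'r \<Rightarrow> 2 \<Rightarrow> real \<Rightarrow> complex^2^2^'r" where
  "ray i a t = torus_exp (\<chi> j. if j = i then of_real (if a = 1 then ln t else - ln t) else 0)"

lemma ray_mult_entry:
  assumes "t > 0"
  shows "(ray i a t \<odot> h) $ j $ b $ c = of_real (1 / weight i a t j b) * h $ j $ b $ c"
proof -
  have e: "exp (complex_of_real (ln t)) = of_real t" "exp (- complex_of_real (ln t)) = of_real (1 / t)"
    using assms by (simp_all add: exp_of_real exp_minus inverse_eq_divide)
  show ?thesis
    using exhaust_2[of a] exhaust_2[of b] by (auto simp: entry_mult_2 ray_def weight_def e)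
qed

lemma ray_in_D: "ray i a t \<in> D \<sigma> {i}"
  unfolding D_def ray_def by (auto simp: D_factor_eq completion_closed)

lemma norm_ray_ge: assumes "t > 0" shows "t \<le> norm (ray i a t)"
proof -
  have "cmod ((ray i a t \<odot> pone) $ i $ a $ a) = t"
    using assms exhaust_2[of a] unfolding ray_mult_entry[OF assms] by (auto simp: weight_def)
  then show ?thesis using entry_le_norm[of "ray i a t" i a a] by simp
qed

text \<open>Otherwise, for infinitely many \<open>M\<close>, the vectors for \<open>M\<close> and \<open>M + 1\<close> are linearly independent.  They form the columns of
  an integral matrix whose image under \<open>ray i a M\<close> times \<open>g\<close> is bounded and whose determinant \<open>\<delta> M\<close> therefore takes
  finitely many values.  Integral matrices with the same determinant \<open>\<rho>\<close> that are congruent modulo \<open>\<rho>\<close> differ by an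
  element \<open>\<gamma>\<close> of \<open>\<Gamma> \<sigma>\<close>.  So \<open>ray i a M\<close> times \<open>g \<gamma>\<close> is bounded for infinitely many \<open>M\<close>: the orbit returns to a compact set
  along an unbounded sequence.\<close>

lemma divergent_imp_rational_zero:
  assumes g: "g \<in> carrier (G \<sigma>)" and div: "divergent \<sigma> (D \<sigma> {i}) (\<pi> \<sigma> g)"
  shows "\<exists>x y. algebraic_int x \<and> algebraic_int y \<and> (x \<noteq> 0 \<or> y \<noteq> 0) \<and> row_form g i a x y = 0"
proof (rule ccontr)
  assume "\<not> ?thesis"
  then have none: "\<And>x y. algebraic_int x \<Longrightarrow> algebraic_int y \<Longrightarrow> row_form g i a x y = 0 \<Longrightarrow> x = 0 \<and> y = 0" by blast
  obtain K where K: "K > 0" and ex: "\<forall>M::nat. M \<ge> 1 \<longrightarrow> (\<exists>x y. algebraic_int x \<and> algebraic_int y \<and>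
      (x \<noteq> 0 \<or> y \<noteq> 0) \<and> (\<forall>j b. cmod (row_form g j b x y) \<le> K * weight i a M j b))"
    using unbalanced_lattice_vectors[OF g, of i a] by (elim exE conjE) (rule that)
  define good where "good M x y \<longleftrightarrow> algebraic_int x \<and> algebraic_int y \<and>
      (x \<noteq> 0 \<or> y \<noteq> 0) \<and> (\<forall>j b. cmod (row_form g j b x y) \<le> K * weight i a (real M) j b)" for M x y
  have "\<forall>M\<in>{1..}. \<exists>p. good M (fst p) (snd p)"
    using ex by (simp add: good_def)
  from bchoice[OF this] obtain p where p: "\<forall>M\<in>{1..}. good M (fst (p M)) (snd (p M))"
    by (elim exE) (rule that)
  define x y where "x M = fst (p M)" and "y M = snd (p M)" for M
  have xy: "algebraic_int (x M) \<and> algebraic_int (y M) \<and> (x M \<noteq> 0 \<or> y M \<noteq> 0) \<and>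
      (\<forall>j b. cmod (row_form g j b (x M) (y M)) \<le> K * weight i a (real M) j b)" if "M \<ge> 1" for M
    using p that by (simp add: good_def x_def y_def)
  have int: "algebraic_int (x M)" "algebraic_int (y M)" if "M \<ge> 1" for M using xy[OF that] by auto
  have bound: "cmod (row_form g j b (x M) (y M)) \<le> 2 * K * weight i a M j b"
    "cmod (row_form g j b (x (Suc M)) (y (Suc M))) \<le> 2 * K * weight i a M j b" if M: "M \<ge> 1" for M j b
  proof -
    have "weight i a M j b > 0" using M by (intro weight_pos) simp
    then have "K * weight i a M j b \<le> 2 * K * weight i a M j b" using K by simp
    moreover have "cmod (row_form g j b (x M) (y M)) \<le> K * weight i a M j b" using xy[OF M] by blast
    ultimately show "cmod (row_form g j b (x M) (y M)) \<le> 2 * K * weight i a M j b" by simp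
    have "weight i a (Suc M) j b \<le> 2 * weight i a M j b"
      using M by (auto simp: weight_def field_simps)
    then have "K * weight i a (Suc M) j b \<le> K * (2 * weight i a M j b)"
      using K by (intro mult_left_mono) auto
    moreover have "cmod (row_form g j b (x (Suc M)) (y (Suc M))) \<le> K * weight i a (Suc M) j b"
      using xy[of "Suc M"] by auto
    ultimately show "cmod (row_form g j b (x (Suc M)) (y (Suc M))) \<le> 2 * K * weight i a M j b" by simp
  qed
  define \<delta> where "\<delta> M = x M * y (Suc M) - x (Suc M) * y M" for M
  define S where "S = {M. M \<ge> 1 \<and> \<delta> M \<noteq> 0}"
  have "infinite S"
    unfolding infinite_nat_iff_unbounded_le
  proof
    fix m :: nat
    have "\<exists>M\<ge>max 1 m. x M * y (Suc M) \<noteq> x (Suc M) * y M"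
    proof (rule lattice_vectors_change_direction[OF g K none])
      show "algebraic_int (x M) \<and> algebraic_int (y M)" "x M \<noteq> 0 \<or> y M \<noteq> 0" if "1 \<le> M" for M
        using xy[OF that] by auto
      show "cmod (row_form g j b (x M) (y M)) \<le> K * weight i a M j b" if "1 \<le> M" for M j b
        using xy[OF that] by blast
    qed auto
    then show "\<exists>n\<ge>m. n \<in> S" by (auto simp: S_def \<delta>_def)
  qed
  define \<Delta> where "\<Delta> = {\<alpha>. algebraic_int \<alpha> \<and> (\<forall>j. cmod (\<sigma> j \<alpha>) \<le> 8 * K ^ 2)} - {0}"
  have \<delta>\<Delta>: "\<delta> M \<in> \<Delta>" if "M \<in> S" for M
  proof -
    have M: "M \<ge> 1" "\<delta> M \<noteq> 0" using that by (auto simp: S_def)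
    have "cmod (\<sigma> j (\<delta> M)) \<le> 8 * K ^ 2" for j
    proof -
      let ?w = "weight i a M j"
      have w: "?w 1 > 0" "?w 2 > 0" "?w 1 * ?w 2 = 1"
        using M(1) weight_pos[of "real M"] weight_1_2[of "real M"] by simp_all
      have prod: "cmod (u * v) \<le> 4 * K ^ 2" if "cmod u \<le> 2 * K * ?w 1" "cmod v \<le> 2 * K * ?w 2" for u v
      proof -
        have "cmod u * cmod v \<le> (2 * K * ?w 1) * (2 * K * ?w 2)"
          using that w K by (intro mult_mono) auto
        also have "\<dots> = 4 * K ^ 2 * (?w 1 * ?w 2)" by (simp add: power2_eq_square)
        finally show ?thesis using w(3) by (simp add: norm_mult)
      qed
      have "cmod (\<sigma> j (\<delta> M)) \<le> cmod (row_form g j 1 (x M) (y M) * row_form g j 2 (x (Suc M)) (y (Suc M))) +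
          cmod (row_form g j 1 (x (Suc M)) (y (Suc M)) * row_form g j 2 (x M) (y M))"
        unfolding \<delta>_def row_form_det[OF g, symmetric] by (rule norm_triangle_ineq4)
      also have "\<dots> \<le> 4 * K ^ 2 + 4 * K ^ 2"
        by (intro add_mono prod bound M)
      finally show ?thesis by simp
    qed
    moreover have "algebraic_int (\<delta> M)"
      unfolding \<delta>_def using int[OF M(1)] int[of "Suc M"] by (intro algebraic_int_diff algebraic_int_mult) auto
    ultimately show ?thesis using M(2) by (simp add: \<Delta>_def)
  qed
  have fin\<Delta>: "finite \<Delta>" unfolding \<Delta>_def using finite_bounded_algebraic_ints by blast
  define covers where "covers d F \<longleftrightarrow> finite F \<and> (\<forall>\<alpha>. algebraic_int \<alpha> \<longrightarrow>
      (\<exists>\<rho>\<in>F. \<exists>\<kappa>. algebraic_int \<kappa> \<and> \<alpha> = \<rho> + \<kappa> * d))" for d :: 'k and F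
  have "\<forall>d\<in>\<Delta>. \<exists>F. covers d F"
    using finite_residues by (simp add: \<Delta>_def covers_def)
  from bchoice[OF this] obtain F where F: "\<forall>d\<in>\<Delta>. covers d (F d)"
    by (elim exE) (rule that)
  define res where "res d \<alpha> = (SOME \<rho>. \<rho> \<in> F d \<and> (\<exists>\<kappa>. algebraic_int \<kappa> \<and> \<alpha> = \<rho> + \<kappa> * d))" for d \<alpha>
  have res: "res d \<alpha> \<in> F d \<and> (\<exists>\<kappa>. algebraic_int \<kappa> \<and> \<alpha> = res d \<alpha> + \<kappa> * d)"
    if "d \<in> \<Delta>" "algebraic_int \<alpha>" for d \<alpha>
  proof -
    have "covers d (F d)" using F that(1) by (rule bspec)
    then have "\<exists>\<rho>\<in>F d. \<exists>\<kappa>. algebraic_int \<kappa> \<and> \<alpha> = \<rho> + \<kappa> * d"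
      using that(2) unfolding covers_def by (elim conjE allE[of _ \<alpha>]) (erule mp)
    then have "\<exists>\<rho>. \<rho> \<in> F d \<and> (\<exists>\<kappa>. algebraic_int \<kappa> \<and> \<alpha> = \<rho> + \<kappa> * d)"
      unfolding Bex_def .
    then show ?thesis unfolding res_def by (rule someI_ex)
  qed
  define f where "f M = (\<delta> M, res (\<delta> M) (x M), res (\<delta> M) (x (Suc M)), res (\<delta> M) (y M), res (\<delta> M) (y (Suc M)))" for M
  have "f ` S \<subseteq> (SIGMA d:\<Delta>. F d \<times> F d \<times> F d \<times> F d)"
  proof (rule image_subsetI)
    fix M assume M: "M \<in> S"
    then have "M \<ge> 1" by (simp add: S_def)
    then show "f M \<in> (SIGMA d:\<Delta>. F d \<times> F d \<times> F d \<times> F d)"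
      unfolding f_def using res[OF \<delta>\<Delta>[OF M]] \<delta>\<Delta>[OF M] int[of M] int[of "Suc M"] by simp
  qed
  moreover have "finite (SIGMA d:\<Delta>. F d \<times> F d \<times> F d \<times> F d)"
    using fin\<Delta> F by (intro finite_SigmaI finite_cartesian_product) (auto simp: covers_def)
  ultimately have "finite (f ` S)" by (rule finite_subset)
  from pigeonhole_infinite[OF \<open>infinite S\<close> this]
  obtain N where N: "N \<in> S" "infinite {M \<in> S. f M = f N}" by blast
  define \<rho> where "\<rho> = \<delta> N"
  have \<rho>: "\<rho> \<in> \<Delta>" "\<rho> \<noteq> 0" using \<delta>\<Delta>[OF N(1)] by (auto simp: \<rho>_def \<Delta>_def)
  have N1: "N \<ge> 1" using N(1) by (simp add: S_def)
  let ?x = "x N" and ?x' = "x (Suc N)" and ?y = "y N" and ?y' = "y (Suc N)"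
  have intN: "algebraic_int ?x" "algebraic_int ?x'" "algebraic_int ?y" "algebraic_int ?y'"
    using int[OF N1] int[of "Suc N"] by auto
  define R where "R = (\<Sum>j\<in>UNIV. 2 * K * (cmod (\<sigma> j ?x) + cmod (\<sigma> j ?x') + cmod (\<sigma> j ?y) + cmod (\<sigma> j ?y')) / cmod (\<sigma> j \<rho>))"
  have key: "\<exists>\<gamma>\<in>\<Gamma> \<sigma>. norm (ray i a M \<odot> (g \<odot> \<gamma>)) \<le> CARD('r) * (4 * R)" if M: "M \<in> S" "f M = f N" for M
  proof -
    have M1: "M \<ge> 1" using M(1) by (simp add: S_def)
    have \<delta>M: "\<delta> M = \<rho>" using M(2) by (simp add: f_def \<rho>_def)
    have cong: "\<exists>\<kappa>. algebraic_int \<kappa> \<and> \<alpha> = \<beta> + \<kappa> * \<rho>"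
      if ab: "algebraic_int \<alpha>" "algebraic_int \<beta>" "res \<rho> \<alpha> = res \<rho> \<beta>" for \<alpha> \<beta>
    proof -
      obtain \<kappa>1 where k1: "algebraic_int \<kappa>1" "\<alpha> = res \<rho> \<alpha> + \<kappa>1 * \<rho>" using res[OF \<rho>(1) ab(1)] by blast
      obtain \<kappa>2 where k2: "algebraic_int \<kappa>2" "\<beta> = res \<rho> \<beta> + \<kappa>2 * \<rho>" using res[OF \<rho>(1) ab(2)] by blast
      have "\<alpha> - \<beta> = \<kappa>1 * \<rho> - \<kappa>2 * \<rho>"
        using k1(2) k2(2) ab(3) by (metis add_diff_cancel_left)
      then have "\<alpha> = \<beta> + (\<kappa>1 - \<kappa>2) * \<rho>"
        by (simp add: left_diff_distrib algebra_simps)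
      then show ?thesis using algebraic_int_diff[OF k1(1) k2(1)] by blast
    qed
    obtain k1 where k1: "algebraic_int k1" "x M = ?x + k1 * \<rho>"
      using cong[of "x M" ?x] M(2) int[OF M1] intN by (auto simp: f_def \<rho>_def)
    obtain k2 where k2: "algebraic_int k2" "x (Suc M) = ?x' + k2 * \<rho>"
      using cong[of "x (Suc M)" ?x'] M(2) int[of "Suc M"] intN by (auto simp: f_def \<rho>_def)
    obtain k3 where k3: "algebraic_int k3" "y M = ?y + k3 * \<rho>"
      using cong[of "y M" ?y] M(2) int[OF M1] intN by (auto simp: f_def \<rho>_def)
    obtain k4 where k4: "algebraic_int k4" "y (Suc M) = ?y' + k4 * \<rho>"
      using cong[of "y (Suc M)" ?y'] M(2) int[of "Suc M"] intN by (auto simp: f_def \<rho>_def)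
    have \<rho>N: "\<rho> = ?x * ?y' - ?x' * ?y" by (simp add: \<rho>_def \<delta>_def)
    \<comment> \<open>The entries of the quotient of the matrices for \<open>M\<close> and \<open>N\<close>, with the division by \<open>\<rho>\<close> carried out.\<close>
    define p q r s where "p = 1 + k1 * ?y' - k2 * ?y" and "q = k2 * ?x - k1 * ?x'"
      and "r = k3 * ?y' - k4 * ?y" and "s = 1 + k4 * ?x - k3 * ?x'"
    have p: "\<rho> * p = x M * ?y' - x (Suc M) * ?y"
      unfolding p_def k1(2) k2(2) by (simp add: algebra_simps \<rho>N)
    have q: "\<rho> * q = x (Suc M) * ?x - x M * ?x'"
      unfolding q_def k1(2) k2(2) by (simp add: algebra_simps)
    have r: "\<rho> * r = y M * ?y' - y (Suc M) * ?y"
      unfolding r_def k3(2) k4(2) by (simp add: algebra_simps)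
    have s: "\<rho> * s = y (Suc M) * ?x - y M * ?x'"
      unfolding s_def k3(2) k4(2) by (simp add: algebra_simps \<rho>N)
    have "(\<rho> * p) * (\<rho> * s) - (\<rho> * q) * (\<rho> * r) =
        (x M * y (Suc M) - x (Suc M) * y M) * (?x * ?y' - ?x' * ?y)"
      unfolding p q r s by (simp add: algebra_simps)
    also have "\<dots> = \<rho> * \<rho>" using \<delta>M \<rho>N by (simp add: \<delta>_def)
    finally have "(\<rho> * \<rho>) * (p * s - q * r) = (\<rho> * \<rho>) * 1" by (simp add: algebra_simps)
    then have det: "p * s - q * r = 1" using \<rho>(2) by simp
    define A :: "'k^2^2" where "A = (\<chi> a b. if a = 1 then (if b = 1 then p else q) else (if b = 1 then r else s))"
    have A: "A $ 1 $ 1 = p" "A $ 1 $ 2 = q" "A $ 2 $ 1 = r" "A $ 2 $ 2 = s" by (simp_all add: A_def)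
    have ints: "algebraic_int p" "algebraic_int q" "algebraic_int r" "algebraic_int s"
      unfolding p_def q_def r_def s_def
      using k1(1) k2(1) k3(1) k4(1) intN
      by (auto intro!: algebraic_int_add algebraic_int_diff algebraic_int_mult)
    have "A \<in> SLO" unfolding SL2_iff A using ints det by simp
    then have \<gamma>: "emb A \<in> \<Gamma> \<sigma>" by (simp add: \<Gamma>_eq)
    have entry: "cmod ((ray i a M \<odot> (g \<odot> emb A)) $ j $ b $ c) \<le> R" for j b c
    proof -
      let ?w = "weight i a M j b"
      have w: "?w > 0" using M1 by (intro weight_pos) simp
      have \<sigma>\<rho>: "\<sigma> j \<rho> \<noteq> 0" using \<rho>(2) by simp
      let ?l = "row_form g j b (x M) (y M)" and ?l' = "row_form g j b (x (Suc M)) (y (Suc M))"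
      have e1: "\<sigma> j \<rho> * row_form g j b p r = ?l * \<sigma> j ?y' - ?l' * \<sigma> j ?y"
        unfolding row_form_scale[symmetric] p r by (simp add: row_form_def algebra_simps)
      have e2: "\<sigma> j \<rho> * row_form g j b q s = ?l' * \<sigma> j ?x - ?l * \<sigma> j ?x'"
        unfolding row_form_scale[symmetric] q s by (simp add: row_form_def algebra_simps)
      let ?T = "2 * K * (cmod (\<sigma> j ?x) + cmod (\<sigma> j ?x') + cmod (\<sigma> j ?y) + cmod (\<sigma> j ?y'))"
      have b1: "cmod (u * e - v * f) \<le> ?w * (2 * K * (cmod e + cmod f))"
        if "cmod u \<le> 2 * K * ?w" "cmod v \<le> 2 * K * ?w" for u v e f
      proof -
        have "cmod (u * e - v * f) \<le> cmod u * cmod e + cmod v * cmod f"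
          using norm_triangle_ineq4[of "u * e" "v * f"] by (simp add: norm_mult)
        also have "\<dots> \<le> (2 * K * ?w) * cmod e + (2 * K * ?w) * cmod f"
          using that by (intro add_mono mult_right_mono) auto
        finally show ?thesis by (simp add: algebra_simps)
      qed
      have l: "cmod ?l \<le> 2 * K * ?w" "cmod ?l' \<le> 2 * K * ?w" using bound[OF M1] by auto
      have "cmod (\<sigma> j \<rho> * row_form g j b (A $ 1 $ c) (A $ 2 $ c)) \<le> ?w * ?T"
      proof (cases "c = 1")
        case True
        have "cmod (?l * \<sigma> j ?y' - ?l' * \<sigma> j ?y) \<le> ?w * (2 * K * (cmod (\<sigma> j ?y') + cmod (\<sigma> j ?y)))"
          by (rule b1[OF l])
        also have "\<dots> \<le> ?w * ?T" using w K by (intro mult_left_mono) auto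
        finally show ?thesis unfolding True A e1 .
      next
        case False
        then have c2: "c = 2" using exhaust_2[of c] by blast
        have "cmod (?l' * \<sigma> j ?x - ?l * \<sigma> j ?x') \<le> ?w * (2 * K * (cmod (\<sigma> j ?x) + cmod (\<sigma> j ?x')))"
          by (rule b1[OF l(2,1)])
        also have "\<dots> \<le> ?w * ?T" using w K by (intro mult_left_mono) auto
        finally show ?thesis unfolding c2 A e2 .
      qed
      then have "1 / ?w * cmod (row_form g j b (A $ 1 $ c) (A $ 2 $ c)) \<le> ?T / cmod (\<sigma> j \<rho>)"
        using w \<sigma>\<rho> by (simp add: norm_mult field_simps)
      moreover have "?T / cmod (\<sigma> j \<rho>) \<le> R"
        unfolding R_def using K by (intro member_le_sum[where f = "\<lambda>j. 2 * K * (cmod (\<sigma> j ?x) + cmod (\<sigma> j ?x') + cmod (\<sigma> j ?y) + cmod (\<sigma> j ?y')) / cmod (\<sigma> j \<rho>)"]) auto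
      moreover have "cmod ((ray i a M \<odot> (g \<odot> emb A)) $ j $ b $ c) = 1 / ?w * cmod (row_form g j b (A $ 1 $ c) (A $ 2 $ c))"
        using M1 w by (subst ray_mult_entry) (simp_all only: pmult_emb_entry norm_mult norm_of_real, simp_all)
      ultimately show ?thesis by linarith
    qed
    show ?thesis using \<gamma> norm_le_entries[OF entry] by blast
  qed
  define Kc where "Kc = \<pi> \<sigma> ` {h \<in> carrier (G \<sigma>). norm h \<le> CARD('r) * (4 * R)}"
  have proper: "proper_map (top_of_set (D \<sigma> {i})) (quot_top \<sigma>) (\<lambda>h. h <#\<^bsub>G \<sigma>\<^esub> \<pi> \<sigma> g)"
    and DG: "D \<sigma> {i} \<subseteq> carrier (G \<sigma>)"
    using div subgroup.subset unfolding divergent_def by blast+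
  have "compactin (quot_top \<sigma>) Kc" unfolding Kc_def by (rule compactin_\<pi>_bounded)
  then have "compactin (top_of_set (D \<sigma> {i})) {h \<in> topspace (top_of_set (D \<sigma> {i})). h <#\<^bsub>G \<sigma>\<^esub> \<pi> \<sigma> g \<in> Kc}"
    by (rule compactin_proper_map_preimage[OF proper])
  then have "compact {h \<in> D \<sigma> {i}. h <#\<^bsub>G \<sigma>\<^esub> \<pi> \<sigma> g \<in> Kc}"
    by (simp add: compactin_subtopology)
  from compact_imp_bounded[OF this]
  obtain b where b: "\<forall>h\<in>{h \<in> D \<sigma> {i}. h <#\<^bsub>G \<sigma>\<^esub> \<pi> \<sigma> g \<in> Kc}. norm h \<le> b"
    unfolding bounded_iff by (elim exE) (rule that)
  obtain n :: nat where n: "b < real n" using reals_Archimedean2 by blast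
  obtain M where M: "M \<in> S" "f M = f N" "M \<ge> n"
    using N(2) unfolding infinite_nat_iff_unbounded_le by auto
  have M1: "M \<ge> 1" using M(1) by (simp add: S_def)
  have rc: "ray i a M \<in> carrier (G \<sigma>)" using ray_in_D DG by blast
  obtain \<gamma> where \<gamma>: "\<gamma> \<in> \<Gamma> \<sigma>" "norm (ray i a M \<odot> (g \<odot> \<gamma>)) \<le> CARD('r) * (4 * R)"
    using key[OF M(1,2)] by blast
  have "ray i a M <#\<^bsub>G \<sigma>\<^esub> \<pi> \<sigma> g = \<pi> \<sigma> (ray i a M \<odot> (g \<odot> \<gamma>))"
  proof -
    have "\<pi> \<sigma> (ray i a M \<odot> (g \<odot> \<gamma>)) = \<pi> \<sigma> (ray i a M \<odot> g)"
      using \<gamma>(1) rc g \<Gamma>_carrier by (subst \<pi>_eq_iff) (auto simp: pmult_assoc)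
    then show ?thesis by (simp add: act_\<pi>)
  qed
  also have "\<dots> \<in> Kc"
    unfolding Kc_def using \<gamma> rc g \<Gamma>_carrier by (intro imageI) auto
  finally have "norm (ray i a M) \<le> b" using b ray_in_D by simp
  then have "real M \<le> b" using norm_ray_ge[of "real M" i a] M1 by simp
  then show False using n M(3) by linarith
qed

end

section \<open>Orbits that return to their starting point\<close>

lemma prod_split_two:
  fixes f :: "'r::finite \<Rightarrow> 'a::comm_monoid_mult"
  assumes "i \<noteq> i'"
  shows "(\<Prod>j\<in>UNIV. f j) = f i * f i' * (\<Prod>j\<in>UNIV - {i, i'}. f j)"
proof -
  have "(\<Prod>j\<in>UNIV. f j) = f i * (\<Prod>j\<in>UNIV - {i}. f j)" by (rule prod.remove) auto
  also have "(\<Prod>j\<in>UNIV - {i}. f j) = f i' * (\<Prod>j\<in>UNIV - {i} - {i'}. f j)"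
    using assms by (intro prod.remove) auto
  also have "UNIV - {i} - {i'} = UNIV - {i, i'}" by auto
  finally show ?thesis by (simp add: mult.assoc)
qed

definition row_scale :: "2 \<Rightarrow> complex \<Rightarrow> complex" where
  "row_scale b z = exp (if b = 1 then z else - z)"

lemma row_scale_nonzero [simp]: "row_scale b z \<noteq> 0"
  by (simp add: row_scale_def)

lemma row_scale_other: "a \<noteq> b \<Longrightarrow> row_scale b z = inverse (row_scale a z)"
  using exhaust_2[of a] exhaust_2[of b] by (auto simp: row_scale_def exp_minus)

lemma diag_exp_mult_entry: "(diag_exp z ** A) $ a $ b = row_scale a z * A $ a $ b" for A :: "complex^2^2"
  using exhaust_2[of a] by (auto simp: entry_mult_2 row_scale_def)

definition monomial2 :: "complex^2^2 \<Rightarrow> bool" where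
  "monomial2 A \<longleftrightarrow> (A $ 1 $ 2 = 0 \<and> A $ 2 $ 1 = 0) \<or> (A $ 1 $ 1 = 0 \<and> A $ 2 $ 2 = 0)"

text \<open>A sequence of diagonal elements along which the orbit of \<open>g\<close> returns to \<open>g\<close>.\<close>

locale recurrent_sequence = arch_number_field \<sigma>
  for \<sigma> :: "'r::finite \<Rightarrow> 'k::field_char_0 \<Rightarrow> complex" +
  fixes g :: "complex^2^2^'r" and z :: "nat \<Rightarrow> complex^'r" and \<gamma> :: "nat \<Rightarrow> 'k^2^2"
  assumes g: "g \<in> carrier (G \<sigma>)" and zc: "\<And>k. torus_exp (z k) \<in> carrier (G \<sigma>)"
    and \<gamma>: "\<And>k. \<gamma> k \<in> SL2 {x. algebraic_int x}"
    and lim: "(\<lambda>k. torus_exp (z k) \<odot> g \<odot> emb (\<gamma> k)) \<longlonglongrightarrow> g"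
begin

text \<open>This tends to the identity, and it measures by how much applying the inverse of \<open>\<gamma> k\<close> to a vector differs from
  applying the diagonal element \<open>torus_exp (z k)\<close> to its image under \<open>g\<close>; see \<open>row_form_u\<close>.\<close>

definition N :: "nat \<Rightarrow> complex^2^2^'r" where
  "N k = g \<odot> padj (torus_exp (z k) \<odot> g \<odot> emb (\<gamma> k))"

text \<open>The coordinates of the inverse of \<open>\<gamma> k\<close> applied to \<open>(x, y)\<close>.\<close>

definition ux :: "nat \<Rightarrow> 'k \<Rightarrow> 'k \<Rightarrow> 'k" where "ux k x y = \<gamma> k $ 2 $ 2 * x - \<gamma> k $ 1 $ 2 * y"
definition uy :: "nat \<Rightarrow> 'k \<Rightarrow> 'k \<Rightarrow> 'k" where "uy k x y = \<gamma> k $ 1 $ 1 * y - \<gamma> k $ 2 $ 1 * x"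

definition E :: "2 \<Rightarrow> nat \<Rightarrow> 'r \<Rightarrow> complex" where "E b k j = row_scale b (z k $ j)"

lemma N_tendsto: "(\<lambda>k. N k $ j $ a $ b) \<longlonglongrightarrow> mat 1 $ a $ b"
proof -
  have "(\<lambda>k. N k) \<longlonglongrightarrow> g \<odot> padj g"
    unfolding N_def by (intro tendsto_intros lim)
  then have "(\<lambda>k. N k $ j $ a $ b) \<longlonglongrightarrow> (g \<odot> padj g) $ j $ a $ b"
    by (intro tendsto_vec_nth)
  then show ?thesis unfolding padj_mult[OF g] by simp
qed

lemma emb_\<gamma>: "emb (\<gamma> k) \<in> carrier (G \<sigma>)"
  using emb_carrier SLO_UNIV \<gamma> by blast

lemma N_mult: "N k \<odot> (torus_exp (z k) \<odot> g) = g \<odot> emb (adj2 (\<gamma> k))"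
proof -
  let ?h = "torus_exp (z k) \<odot> g"
  have h: "?h \<in> carrier (G \<sigma>)" using zc g by simp
  have hg: "?h \<odot> emb (\<gamma> k) \<in> carrier (G \<sigma>)" using h emb_\<gamma> by simp
  have "?h = (?h \<odot> emb (\<gamma> k)) \<odot> padj (emb (\<gamma> k))"
    using padj_mult(2)[OF emb_\<gamma>] by (simp only: pmult_assoc pmult_pone)
  then have "N k \<odot> ?h = g \<odot> (padj (?h \<odot> emb (\<gamma> k)) \<odot> ((?h \<odot> emb (\<gamma> k)) \<odot> padj (emb (\<gamma> k))))"
    unfolding N_def by (metis pmult_assoc)
  also have "\<dots> = g \<odot> padj (emb (\<gamma> k))"
    unfolding padj_mult_assoc(1)[OF hg] ..
  finally show ?thesis by (simp add: emb_adj2)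
qed

lemma row_form_u:
  "row_form g j a (ux k x y) (uy k x y) = N k $ j $ a $ 1 * (E 1 k j * row_form g j 1 x y) + N k $ j $ a $ 2 * (E 2 k j * row_form g j 2 x y)"
proof -
  have "(N k \<odot> (torus_exp (z k) \<odot> g)) $ j $ a $ c = row_form g j a (adj2 (\<gamma> k) $ 1 $ c) (adj2 (\<gamma> k) $ 2 $ c)" for c
    unfolding N_mult by (rule pmult_emb_entry)
  then have c: "N k $ j $ a $ 1 * (E 1 k j * g $ j $ 1 $ c) + N k $ j $ a $ 2 * (E 2 k j * g $ j $ 2 $ c)
      = row_form g j a (adj2 (\<gamma> k) $ 1 $ c) (adj2 (\<gamma> k) $ 2 $ c)" for c
    by (simp only: pmult_nth torus_exp_nth entry_mult_2[of "N k $ j"] diag_exp_mult_entry E_def)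
  have "row_form g j a (ux k x y) (uy k x y) =
      row_form g j a (adj2 (\<gamma> k) $ 1 $ 1) (adj2 (\<gamma> k) $ 2 $ 1) * \<sigma> j x + row_form g j a (adj2 (\<gamma> k) $ 1 $ 2) (adj2 (\<gamma> k) $ 2 $ 2) * \<sigma> j y"
    by (simp add: row_form_def ux_def uy_def algebra_simps)
  then show ?thesis
    unfolding c[symmetric] by (simp add: row_form_def algebra_simps)
qed

lemma u_int:
  assumes "algebraic_int x" "algebraic_int y"
  shows "algebraic_int (ux k x y)" "algebraic_int (uy k x y)"
  using \<gamma>[of k] assms unfolding ux_def uy_def SL2_iff
  by (auto intro!: algebraic_int_diff algebraic_int_mult)

lemma u_nonzero:
  assumes "x \<noteq> 0 \<or> y \<noteq> 0"
  shows "ux k x y \<noteq> 0 \<or> uy k x y \<noteq> 0"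
proof (rule ccontr)
  assume "\<not> ?thesis"
  then have u: "ux k x y = 0" "uy k x y = 0" by auto
  have d: "\<gamma> k $ 1 $ 1 * \<gamma> k $ 2 $ 2 - \<gamma> k $ 1 $ 2 * \<gamma> k $ 2 $ 1 = 1"
    using \<gamma>[of k] by (simp add: SL2_iff)
  have "(\<gamma> k $ 1 $ 1 * \<gamma> k $ 2 $ 2 - \<gamma> k $ 1 $ 2 * \<gamma> k $ 2 $ 1) * x = \<gamma> k $ 1 $ 1 * ux k x y + \<gamma> k $ 1 $ 2 * uy k x y"
    "(\<gamma> k $ 1 $ 1 * \<gamma> k $ 2 $ 2 - \<gamma> k $ 1 $ 2 * \<gamma> k $ 2 $ 1) * y = \<gamma> k $ 2 $ 1 * ux k x y + \<gamma> k $ 2 $ 2 * uy k x y"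
    by (simp_all add: ux_def uy_def algebra_simps)
  then show False using assms u d by simp
qed

text \<open>The size at \<open>j\<close> of the image of \<open>(x, y)\<close> under \<open>g\<close> after it is stretched by \<open>torus_exp (z k)\<close>.\<close>

definition W :: "'k \<Rightarrow> 'k \<Rightarrow> nat \<Rightarrow> 'r \<Rightarrow> real" where
  "W x y k j = cmod (E 1 k j) * cmod (row_form g j 1 x y) + cmod (E 2 k j) * cmod (row_form g j 2 x y)"

lemma W_nonneg: "W x y k j \<ge> 0"
  by (simp add: W_def)

lemma N_bounded: "\<exists>C>0. \<forall>k j a b. cmod (N k $ j $ a $ b) \<le> C"
proof -
  have "(\<lambda>k. N k) \<longlonglongrightarrow> g \<odot> padj g"
    unfolding N_def by (intro tendsto_intros lim)
  then have "Bseq N" using convergent_imp_Bseq convergentI by blast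
  then obtain C where C: "C > 0" "\<And>k. norm (N k) \<le> C" by (rule BseqE) blast
  have "cmod (N k $ j $ a $ b) \<le> C" for k j a b
    using entry_le_norm[of "N k" j a b] C(2)[of k] by simp
  then show ?thesis using C(1) by blast
qed

lemma u_bound:
  "\<exists>C>0. \<forall>k j x y. cmod (\<sigma> j (ux k x y)) \<le> C * W x y k j \<and> cmod (\<sigma> j (uy k x y)) \<le> C * W x y k j"
proof -
  obtain C0 where C0: "C0 > 0" "\<forall>k j a b. cmod (N k $ j $ a $ b) \<le> C0"
    using N_bounded by (elim exE conjE) (rule that)
  have lfb: "cmod (row_form g j a (ux k x y) (uy k x y)) \<le> C0 * W x y k j" for j a k x y
  proof -
    have "cmod (row_form g j a (ux k x y) (uy k x y)) \<le>
       cmod (N k $ j $ a $ 1) * (cmod (E 1 k j) * cmod (row_form g j 1 x y)) + cmod (N k $ j $ a $ 2) * (cmod (E 2 k j) * cmod (row_form g j 2 x y))"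
      unfolding row_form_u by (rule order.trans[OF norm_triangle_ineq]) (simp add: norm_mult)
    also have "\<dots> \<le> C0 * (cmod (E 1 k j) * cmod (row_form g j 1 x y)) + C0 * (cmod (E 2 k j) * cmod (row_form g j 2 x y))"
      using C0(2) by (intro add_mono mult_right_mono) auto
    finally show ?thesis by (simp add: W_def distrib_left)
  qed
  define C where "C = 2 * (norm g + 1) * C0"
  have ng: "norm g + 1 > 0" by (simp add: add_nonneg_pos)
  have C: "C > 0" using C0(1) ng by (simp add: C_def)
  have comb: "cmod (e * u - f * v) \<le> C * w"
    if "cmod e \<le> norm g" "cmod f \<le> norm g" "cmod u \<le> C0 * w" "cmod v \<le> C0 * w" "w \<ge> 0" for e f u v w
  proof -
    have "cmod (e * u - f * v) \<le> cmod e * cmod u + cmod f * cmod v"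
      using norm_triangle_ineq4[of "e * u" "f * v"] by (simp add: norm_mult)
    also have "\<dots> \<le> (norm g + 1) * (C0 * w) + (norm g + 1) * (C0 * w)"
      using that ng by (intro add_mono mult_mono) auto
    also have "\<dots> = C * w" by (simp add: C_def)
    finally show ?thesis .
  qed
  have "cmod (\<sigma> j (ux k x y)) \<le> C * W x y k j \<and> cmod (\<sigma> j (uy k x y)) \<le> C * W x y k j" for k j x y
  proof -
    let ?d = "g $ j $ 1 $ 1 * g $ j $ 2 $ 2 - g $ j $ 1 $ 2 * g $ j $ 2 $ 1"
    have "?d * \<sigma> j (ux k x y) = g $ j $ 2 $ 2 * row_form g j 1 (ux k x y) (uy k x y) - g $ j $ 1 $ 2 * row_form g j 2 (ux k x y) (uy k x y)"
      "?d * \<sigma> j (uy k x y) = g $ j $ 1 $ 1 * row_form g j 2 (ux k x y) (uy k x y) - g $ j $ 2 $ 1 * row_form g j 1 (ux k x y) (uy k x y)"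
      unfolding row_form_def by (simp_all add: algebra_simps)
    then have "\<sigma> j (ux k x y) = g $ j $ 2 $ 2 * row_form g j 1 (ux k x y) (uy k x y) - g $ j $ 1 $ 2 * row_form g j 2 (ux k x y) (uy k x y)"
      "\<sigma> j (uy k x y) = g $ j $ 1 $ 1 * row_form g j 2 (ux k x y) (uy k x y) - g $ j $ 2 $ 1 * row_form g j 1 (ux k x y) (uy k x y)"
      unfolding carrier_det[OF g] by simp_all
    then show ?thesis by (simp only:) (intro conjI comb lfb entry_le_norm W_nonneg)
  qed
  then show ?thesis using C by blast
qed

text \<open>The product inequality for a non-zero coordinate of the integral vector \<open>(ux k x y, uy k x y)\<close>; away from \<open>i\<close> and
  \<open>i'\<close> nothing is stretched.\<close>

lemma W_product_bound:
  assumes i: "i \<noteq> i'" and supp: "\<forall>k j. j \<noteq> i \<longrightarrow> j \<noteq> i' \<longrightarrow> z k $ j = 0"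
    and v: "algebraic_int x" "algebraic_int y" "x \<noteq> 0 \<or> y \<noteq> 0"
  shows "\<exists>C>0. \<forall>k. 1 \<le> C * (W x y k i ^ local_degree i * W x y k i' ^ local_degree i')"
proof -
  obtain C where C: "C > 0" "\<forall>k j x y. cmod (\<sigma> j (ux k x y)) \<le> C * W x y k j \<and> cmod (\<sigma> j (uy k x y)) \<le> C * W x y k j"
    using u_bound by (elim exE conjE) (rule that)
  define w where "w j = cmod (row_form g j 1 x y) + cmod (row_form g j 2 x y)" for j
  have w: "W x y k j = w j" if "j \<noteq> i" "j \<noteq> i'" for k j
    using supp[rule_format, OF that] by (simp add: W_def w_def E_def row_scale_def)
  define P where "P = (\<Prod>j\<in>UNIV. C ^ local_degree j) * (\<Prod>j\<in>UNIV - {i, i'}. w j ^ local_degree j)"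
  have P: "P \<ge> 0" unfolding P_def using C(1) by (intro mult_nonneg_nonneg prod_nonneg) (auto simp: w_def)
  have "1 \<le> (P + 1) * (W x y k i ^ local_degree i * W x y k i' ^ local_degree i')" for k
  proof -
    obtain u where u: "u = ux k x y \<or> u = uy k x y" "u \<noteq> 0" using u_nonzero[OF v(3), of k] by blast
    have "algebraic_int u" using u(1) u_int[OF v(1,2)] by blast
    then have "1 \<le> (\<Prod>j\<in>UNIV. cmod (\<sigma> j u) ^ local_degree j)"
      using u(2) by (rule algebraic_int_norm_ge_1)
    also have "\<dots> \<le> (\<Prod>j\<in>UNIV. (C * W x y k j) ^ local_degree j)"
      using C(2) u(1) by (intro prod_mono conjI power_mono) auto
    also have "\<dots> = (\<Prod>j\<in>UNIV. C ^ local_degree j) * (\<Prod>j\<in>UNIV. W x y k j ^ local_degree j)"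
      by (simp add: power_mult_distrib prod.distrib)
    also have "(\<Prod>j\<in>UNIV. W x y k j ^ local_degree j) =
        W x y k i ^ local_degree i * W x y k i' ^ local_degree i' * (\<Prod>j\<in>UNIV - {i, i'}. W x y k j ^ local_degree j)"
      by (rule prod_split_two[OF i])
    also have "(\<Prod>j\<in>UNIV - {i, i'}. W x y k j ^ local_degree j) = (\<Prod>j\<in>UNIV - {i, i'}. w j ^ local_degree j)"
      by (intro prod.cong refl) (simp add: w)
    also have "(\<Prod>j\<in>UNIV. C ^ local_degree j) *
        (W x y k i ^ local_degree i * W x y k i' ^ local_degree i' * (\<Prod>j\<in>UNIV - {i, i'}. w j ^ local_degree j))
        = P * (W x y k i ^ local_degree i * W x y k i' ^ local_degree i')"
      by (simp add: P_def mult_ac)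
    also have "\<dots> \<le> (P + 1) * (W x y k i ^ local_degree i * W x y k i' ^ local_degree i')"
      using W_nonneg by (intro mult_right_mono mult_nonneg_nonneg zero_le_power) auto
    finally show ?thesis .
  qed
  then show ?thesis using P by (intro exI[of _ "P + 1"]) auto
qed

lemma W_row_zero:
  assumes "row_form g i a x y = 0" "b \<noteq> a"
  shows "W x y k i = cmod (row_form g i b x y) / cmod (E a k i)"
proof -
  have "cmod (E b k i) = 1 / cmod (E a k i)"
    using row_scale_other[of a b] assms(2) by (simp add: E_def norm_divide inverse_eq_divide)
  then show ?thesis
    using assms exhaust_2[of a] exhaust_2[of b] by (auto simp: W_def)
qed

lemma W_le:
  assumes "cmod (E a k i) \<ge> 1"
  shows "W x y k i \<le> (cmod (row_form g i 1 x y) + cmod (row_form g i 2 x y)) * cmod (E a k i)"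
proof -
  have "cmod (E b k i) \<le> cmod (E a k i)" for b
  proof (cases "b = a")
    case False
    then have "cmod (E b k i) = inverse (cmod (E a k i))"
      using row_scale_other[of a b] by (simp add: E_def norm_inverse)
    also have "\<dots> \<le> 1" using assms by (rule inverse_le_1_iff[THEN iffD2, OF disjI2])
    finally show ?thesis using assms by simp
  qed simp
  then have "cmod (E 1 k i) * cmod (row_form g i 1 x y) + cmod (E 2 k i) * cmod (row_form g i 2 x y)
      \<le> cmod (E a k i) * cmod (row_form g i 1 x y) + cmod (E a k i) * cmod (row_form g i 2 x y)"
    by (intro add_mono mult_right_mono) auto
  then show ?thesis by (simp add: W_def algebra_simps)
qed

text \<open>A vector that is contracted at \<open>i\<close> and stays bounded at all other places would violate the product inequality.\<close>

lemma contracted_vector_contradiction: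
  assumes i: "i \<noteq> i'" and supp: "\<forall>k j. j \<noteq> i \<longrightarrow> j \<noteq> i' \<longrightarrow> z k $ j = 0"
    and v: "algebraic_int x" "algebraic_int y" "x \<noteq> 0 \<or> y \<noteq> 0"
    and top: "filterlim (\<lambda>k. cmod (E a k i)) at_top sequentially" and zero: "row_form g i a x y = 0"
    and bound: "\<forall>\<^sub>F k in sequentially. W x y k i' \<le> R"
  shows False
proof -
  obtain C where C: "C > 0" "\<forall>k. 1 \<le> C * (W x y k i ^ local_degree i * W x y k i' ^ local_degree i')"
    using W_product_bound[OF i supp v] by (elim exE conjE) (rule that)
  obtain b where b: "b \<noteq> a" using that[of 1] that[of 2] by (cases "a = 1") auto
  have W0: "(\<lambda>k. W x y k i) \<longlonglongrightarrow> 0"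
    unfolding W_row_zero[OF zero b] by (rule tendsto_divide_0[OF tendsto_const filterlim_at_top_imp_at_infinity[OF top]])
  have "(\<lambda>k. C * (W x y k i ^ local_degree i * \<bar>R\<bar> ^ local_degree i')) \<longlonglongrightarrow> C * (0 ^ local_degree i * \<bar>R\<bar> ^ local_degree i')"
    by (intro tendsto_intros W0)
  moreover have "local_degree i \<noteq> 0" by (simp add: local_degree_def)
  ultimately have "(\<lambda>k. C * (W x y k i ^ local_degree i * \<bar>R\<bar> ^ local_degree i')) \<longlonglongrightarrow> 0"
    by (simp add: zero_power)
  then have "\<forall>\<^sub>F k in sequentially. C * (W x y k i ^ local_degree i * \<bar>R\<bar> ^ local_degree i') < 1"
    by (rule order_tendstoD) simp
  with bound have "\<forall>\<^sub>F k in sequentially. False"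
  proof eventually_elim
    case (elim k)
    have "W x y k i' ^ local_degree i' \<le> \<bar>R\<bar> ^ local_degree i'"
      using elim(1) W_nonneg[of x y k i'] by (intro power_mono) auto
    then have "C * (W x y k i ^ local_degree i * W x y k i' ^ local_degree i') \<le>
        C * (W x y k i ^ local_degree i * \<bar>R\<bar> ^ local_degree i')"
      using C(1) W_nonneg[of x y k i] by (intro mult_left_mono) auto
    moreover have "1 \<le> C * (W x y k i ^ local_degree i * W x y k i' ^ local_degree i')" using C(2) by blast
    ultimately show False using elim(2) by linarith
  qed
  then show False by simp
qed

lemma expansion_comparison:
  assumes i: "i \<noteq> i'" and supp: "\<forall>k j. j \<noteq> i \<longrightarrow> j \<noteq> i' \<longrightarrow> z k $ j = 0"
    and v: "algebraic_int x" "algebraic_int y" "x \<noteq> 0 \<or> y \<noteq> 0"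
    and zero: "row_form g i a x y = 0"
    and top': "filterlim (\<lambda>k. cmod (E a' k i')) at_top sequentially"
  shows "\<exists>C. \<forall>\<^sub>F k in sequentially. cmod (E a k i) ^ local_degree i \<le> C * cmod (E a' k i') ^ local_degree i'"
proof -
  obtain C where C: "C > 0" "\<forall>k. 1 \<le> C * (W x y k i ^ local_degree i * W x y k i' ^ local_degree i')"
    using W_product_bound[OF i supp v] by (elim exE conjE) (rule that)
  obtain b where b: "b \<noteq> a" using that[of 1] that[of 2] by (cases "a = 1") auto
  let ?l = "cmod (row_form g i b x y)" and ?m = "cmod (row_form g i' 1 x y) + cmod (row_form g i' 2 x y)"
  have "\<forall>\<^sub>F k in sequentially. cmod (E a' k i') \<ge> 1"
    using top' by (simp add: filterlim_at_top)
  then have "\<forall>\<^sub>F k in sequentially. cmod (E a k i) ^ local_degree i \<le>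
      C * ?l ^ local_degree i * ?m ^ local_degree i' * cmod (E a' k i') ^ local_degree i'"
  proof eventually_elim
    case (elim k)
    have pos: "cmod (E a k i) > 0" by (simp add: E_def)
    have "1 \<le> C * ((?l / cmod (E a k i)) ^ local_degree i * W x y k i' ^ local_degree i')"
      using C(2) unfolding W_row_zero[OF zero b] by blast
    also have "\<dots> \<le> C * ((?l / cmod (E a k i)) ^ local_degree i * (?m * cmod (E a' k i')) ^ local_degree i')"
      using C(1) W_nonneg W_le[OF elim] by (intro mult_left_mono power_mono) auto
    also have "\<dots> = C * ?l ^ local_degree i * ?m ^ local_degree i' * cmod (E a' k i') ^ local_degree i' / cmod (E a k i) ^ local_degree i"
      by (simp add: power_divide power_mult_distrib)
    finally show ?case using pos by (simp add: pos_le_divide_eq)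
  qed
  then show ?thesis by blast
qed

text \<open>The determinant of \<open>(x, y)\<close> and its image \<open>(ux k x y, uy k x y)\<close> is an integer.  At \<open>i\<close> it is smaller than the inverse of the
  expansion by a factor \<open>\<eta> k\<close> that tends to 0, because there the image is almost parallel to the row-\<open>a\<close> zero line; at
  \<open>i'\<close> it is at most the expansion.  As the two expansions are comparable, it vanishes for large \<open>k\<close>.\<close>

lemma eventually_fixed_direction:
  assumes i: "i \<noteq> i'" and supp: "\<forall>k j. j \<noteq> i \<longrightarrow> j \<noteq> i' \<longrightarrow> z k $ j = 0"
    and v: "algebraic_int x" "algebraic_int y"
    and zero: "row_form g i a x y = 0"
    and top': "filterlim (\<lambda>k. cmod (E a' k i')) at_top sequentially"
    and comp: "\<forall>\<^sub>F k in sequentially. cmod (E a' k i') ^ local_degree i' \<le> C * cmod (E a k i) ^ local_degree i"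
  shows "\<forall>\<^sub>F k in sequentially. x * uy k x y = ux k x y * y"
proof -
  obtain C1 where C1: "C1 > 0" "\<forall>k j x y. cmod (\<sigma> j (ux k x y)) \<le> C1 * W x y k j \<and> cmod (\<sigma> j (uy k x y)) \<le> C1 * W x y k j"
    using u_bound by (elim exE conjE) (rule that)
  obtain b where b: "b \<noteq> a" using that[of 1] that[of 2] by (cases "a = 1") auto
  define w where "w k = x * uy k x y - ux k x y * y" for k
  define l where "l = cmod (row_form g i b x y)"
  define \<eta> where "\<eta> k = cmod (N k $ i $ a $ b) * (l * l)" for k
  define c where "c j = (cmod (\<sigma> j x) + cmod (\<sigma> j y)) * C1" for j
  define m where "m j = cmod (row_form g j 1 x y) + cmod (row_form g j 2 x y)" for j
  have c: "c j \<ge> 0" for j using C1(1) by (simp add: c_def)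
  have m: "m j \<ge> 0" for j by (simp add: m_def)
  have \<eta>0: "\<eta> \<longlonglongrightarrow> 0"
  proof -
    have "(\<lambda>k. N k $ i $ a $ b) \<longlonglongrightarrow> 0"
      using N_tendsto[of i a b] b by (simp add: mat_def)
    then have "(\<lambda>k. cmod (N k $ i $ a $ b) * (l * l)) \<longlonglongrightarrow> cmod 0 * (l * l)"
      by (intro tendsto_intros)
    then show ?thesis by (simp add: \<eta>_def[abs_def])
  qed
  have wi: "cmod (\<sigma> i (w k)) = \<eta> k / cmod (E a k i)" for k
  proof -
    let ?X = "ux k x y" and ?Y = "uy k x y"
    have lfa: "row_form g i a ?X ?Y = N k $ i $ a $ b * (E b k i * row_form g i b x y)"
      unfolding row_form_u using zero b exhaust_2[of a] exhaust_2[of b] by auto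
    have "\<sigma> i (w k) = row_form g i 1 x y * row_form g i 2 ?X ?Y - row_form g i 1 ?X ?Y * row_form g i 2 x y"
      unfolding w_def by (rule row_form_det[OF g, symmetric])
    then have "cmod (\<sigma> i (w k)) = cmod (row_form g i a ?X ?Y) * l"
      using zero b exhaust_2[of a] exhaust_2[of b] by (auto simp: l_def norm_mult mult.commute)
    moreover have "cmod (E b k i) = inverse (cmod (E a k i))"
      using row_scale_other[of a b] b by (simp add: E_def norm_inverse)
    ultimately show ?thesis
      unfolding lfa \<eta>_def by (simp add: norm_mult l_def divide_inverse mult_ac)
  qed
  have wj: "cmod (\<sigma> j (w k)) \<le> c j * W x y k j" for k j
  proof -
    have "cmod (\<sigma> j (w k)) \<le> cmod (\<sigma> j x) * cmod (\<sigma> j (uy k x y)) + cmod (\<sigma> j (ux k x y)) * cmod (\<sigma> j y)"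
      unfolding w_def using norm_triangle_ineq4[of "\<sigma> j x * \<sigma> j (uy k x y)" "\<sigma> j (ux k x y) * \<sigma> j y"]
      by (simp add: norm_mult)
    also have "\<dots> \<le> cmod (\<sigma> j x) * (C1 * W x y k j) + (C1 * W x y k j) * cmod (\<sigma> j y)"
      using C1(2) by (intro add_mono mult_left_mono mult_right_mono) auto
    finally show ?thesis by (simp add: c_def algebra_simps)
  qed
  have Wj: "W x y k j = m j" if "j \<noteq> i" "j \<noteq> i'" for k j
    using supp[rule_format, OF that] by (simp add: W_def m_def E_def row_scale_def)
  define P where "P = (c i' * m i') ^ local_degree i' * (\<Prod>j\<in>UNIV - {i, i'}. (c j * m j) ^ local_degree j)"
  have P: "P \<ge> 0" unfolding P_def using c m by (intro mult_nonneg_nonneg prod_nonneg) auto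
  have "(\<lambda>k. \<eta> k ^ local_degree i * (\<bar>C\<bar> * P)) \<longlonglongrightarrow> 0 ^ local_degree i * (\<bar>C\<bar> * P)"
    by (intro tendsto_intros \<eta>0)
  moreover have "local_degree i \<noteq> 0" by (simp add: local_degree_def)
  ultimately have "(\<lambda>k. \<eta> k ^ local_degree i * (\<bar>C\<bar> * P)) \<longlonglongrightarrow> 0" by (simp add: zero_power)
  then have small: "\<forall>\<^sub>F k in sequentially. \<eta> k ^ local_degree i * (\<bar>C\<bar> * P) < 1"
    by (rule order_tendstoD) simp
  have big: "\<forall>\<^sub>F k in sequentially. cmod (E a' k i') \<ge> 1"
    using top' by (simp add: filterlim_at_top)
  from small big comp show ?thesis
  proof eventually_elim
    case (elim k)
    have "w k = 0"
    proof (rule ccontr)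
      assume nz: "w k \<noteq> 0"
      have "algebraic_int (w k)"
        unfolding w_def using u_int[OF v] v by (intro algebraic_int_diff algebraic_int_mult) auto
      then have "1 \<le> (\<Prod>j\<in>UNIV. cmod (\<sigma> j (w k)) ^ local_degree j)"
        using nz by (rule algebraic_int_norm_ge_1)
      also have "\<dots> = cmod (\<sigma> i (w k)) ^ local_degree i * cmod (\<sigma> i' (w k)) ^ local_degree i' *
          (\<Prod>j\<in>UNIV - {i, i'}. cmod (\<sigma> j (w k)) ^ local_degree j)"
        by (rule prod_split_two[OF i])
      also have "\<dots> \<le> (\<eta> k / cmod (E a k i)) ^ local_degree i * (c i' * m i' * cmod (E a' k i')) ^ local_degree i' *
          (\<Prod>j\<in>UNIV - {i, i'}. (c j * m j) ^ local_degree j)"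
      proof (intro mult_mono prod_mono conjI power_mono prod_nonneg mult_nonneg_nonneg zero_le_power)
        show "cmod (\<sigma> i (w k)) \<le> \<eta> k / cmod (E a k i)" by (simp add: wi)
        have "c i' * W x y k i' \<le> c i' * (m i' * cmod (E a' k i'))"
          using c W_le[OF elim(2), of x y] by (intro mult_left_mono) (auto simp: m_def)
        then show "cmod (\<sigma> i' (w k)) \<le> c i' * m i' * cmod (E a' k i')"
          using wj[of i' k] by (simp add: mult.assoc)
        show "cmod (\<sigma> j (w k)) \<le> c j * m j" if "j \<in> UNIV - {i, i'}" for j
          using wj[of j k] Wj[of j k] that by simp
      qed (use c m in \<open>auto simp: \<eta>_def\<close>)
      also have "\<dots> = \<eta> k ^ local_degree i * P * (cmod (E a' k i') ^ local_degree i' / cmod (E a k i) ^ local_degree i)"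
        by (simp add: P_def power_divide power_mult_distrib)
      also have "\<dots> \<le> \<eta> k ^ local_degree i * P * \<bar>C\<bar>"
      proof (rule mult_left_mono)
        have pos: "cmod (E a k i) > 0" by (simp add: E_def)
        have "cmod (E a' k i') ^ local_degree i' \<le> \<bar>C\<bar> * cmod (E a k i) ^ local_degree i"
          using elim(3) by (rule order.trans) (intro mult_right_mono, auto)
        then show "cmod (E a' k i') ^ local_degree i' / cmod (E a k i) ^ local_degree i \<le> \<bar>C\<bar>"
          using pos by (simp add: pos_divide_le_eq)
        show "0 \<le> \<eta> k ^ local_degree i * P" using P by (simp add: \<eta>_def l_def)
      qed
      also have "\<dots> < 1" using elim(1) by (simp add: mult_ac)
      finally show False by simp
    qed
    then show ?case by (simp add: w_def)
  qed
qed

text \<open>If the direction of \<open>(x, y)\<close> is preserved, the two rows of its image under \<open>g\<close> are multiplied by the same scalar; but \<open>torus_exp (z k)\<close>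
  stretches row \<open>a\<close> and shrinks row \<open>b\<close>, and \<open>N k\<close> is close to the identity.\<close>

lemma fixed_direction_row:
  assumes top: "filterlim (\<lambda>k. cmod (E a k i)) at_top sequentially"
    and fix': "\<forall>\<^sub>F k in sequentially. x * uy k x y = ux k x y * y" and v: "x \<noteq> 0 \<or> y \<noteq> 0"
    and b: "b \<noteq> a" and pa: "row_form g i a x y \<noteq> 0"
  shows "row_form g i b x y = 0"
proof -
  let ?p = "row_form g i a x y" and ?q = "row_form g i b x y"
  have Einv: "E b k i = inverse (E a k i)" for k
    using row_scale_other[of a b] b by (simp add: E_def)
  have Ek: "E a k i \<noteq> 0" for k by (simp add: E_def)
  have two: "row_form g i c (ux k x y) (uy k x y) = N k $ i $ c $ a * (E a k i * ?p) + N k $ i $ c $ b * (inverse (E a k i) * ?q)" for c k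
    unfolding row_form_u Einv[symmetric] using b exhaust_2[of a] exhaust_2[of b] by auto
  have inv0: "(\<lambda>k. inverse (E a k i)) \<longlonglongrightarrow> 0"
    using filterlim_at_infinity_conv_norm_at_top[of "\<lambda>k. E a k i" sequentially] top
    by (auto intro: tendsto_compose_filtermap filterlim_compose[OF tendsto_inverse_0])
  have limN: "(\<lambda>k. N k $ i $ a $ a) \<longlonglongrightarrow> 1" "(\<lambda>k. N k $ i $ b $ b) \<longlonglongrightarrow> 1"
    "(\<lambda>k. N k $ i $ a $ b) \<longlonglongrightarrow> 0" "(\<lambda>k. N k $ i $ b $ a) \<longlonglongrightarrow> 0"
    using N_tendsto[of i a a] N_tendsto[of i b b] N_tendsto[of i a b] N_tendsto[of i b a] b by (simp_all add: mat_def)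
  \<comment> \<open>Eliminating the common scalar from the two row equations and dividing by the expansion gives \<open>F k = 0\<close>.\<close>
  define F where "F k = ?q * (N k $ i $ a $ a * ?p + N k $ i $ a $ b * (inverse (E a k i) * inverse (E a k i) * ?q))
      - ?p * (N k $ i $ b $ a * ?p + N k $ i $ b $ b * (inverse (E a k i) * inverse (E a k i) * ?q))" for k
  have "F \<longlonglongrightarrow> ?q * (1 * ?p + 0 * (0 * 0 * ?q)) - ?p * (0 * ?p + 1 * (0 * 0 * ?q))"
    unfolding F_def[abs_def] by (intro tendsto_intros limN inv0)
  moreover have "\<forall>\<^sub>F k in sequentially. F k = 0"
    using fix'
  proof eventually_elim
    case (elim k)
    obtain \<xi> where "ux k x y = \<xi> * x" "uy k x y = \<xi> * y"
      using proportional_vectors[OF elim v] by blast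
    then have lfx: "row_form g i c (ux k x y) (uy k x y) = \<sigma> i \<xi> * row_form g i c x y" for c
      by (simp add: row_form_scale)
    have "E a k i * F k = ?q * row_form g i a (ux k x y) (uy k x y) - ?p * row_form g i b (ux k x y) (uy k x y)"
      unfolding two F_def using Ek[of k] by (simp add: field_simps)
    also have "\<dots> = 0" unfolding lfx by simp
    finally have "E a k i * F k = 0" .
    then show ?case using Ek[of k] by simp
  qed
  ultimately have "?q * (1 * ?p + 0 * (0 * 0 * ?q)) - ?p * (0 * ?p + 1 * (0 * 0 * ?q)) = 0"
    using tendsto_unique[OF sequentially_bot] tendsto_eventually by blast
  then show ?thesis using pa by simp
qed

text \<open>The columns of \<open>q\<close> are the vectors contracted at \<open>i\<close> and at \<open>i'\<close>, one of them scaled to make the determinant 1.\<close>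

lemma expanding_both_imp_monomial:
  assumes i: "i \<noteq> i'" and supp: "\<forall>k j. j \<noteq> i \<longrightarrow> j \<noteq> i' \<longrightarrow> z k $ j = 0"
    and top: "filterlim (\<lambda>k. cmod (E a k i)) at_top sequentially"
    and top': "filterlim (\<lambda>k. cmod (E a' k i')) at_top sequentially"
    and v: "algebraic_int x" "algebraic_int y" "x \<noteq> 0 \<or> y \<noteq> 0" "row_form g i a x y = 0"
    and v': "algebraic_int x'" "algebraic_int y'" "x' \<noteq> 0 \<or> y' \<noteq> 0" "row_form g i' a' x' y' = 0"
  shows "\<exists>q\<in>SL2 UNIV. monomial2 ((g \<odot> emb q) $ i) \<and> monomial2 ((g \<odot> emb q) $ i')"
proof -
  have supp': "\<forall>k j. j \<noteq> i' \<longrightarrow> j \<noteq> i \<longrightarrow> z k $ j = 0" using supp by blast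
  have i'': "i' \<noteq> i" using i by simp
  obtain b where b: "b \<noteq> a" using that[of 1] that[of 2] by (cases "a = 1") auto
  obtain b' where b': "b' \<noteq> a'" using that[of 1] that[of 2] by (cases "a' = 1") auto
  have small: "\<forall>\<^sub>F k in sequentially. W x y k i \<le> 1"
    if "filterlim (\<lambda>k. cmod (E a k i)) at_top sequentially" "row_form g i a x y = 0" "b \<noteq> a" for x y i a b
  proof -
    have "(\<lambda>k. W x y k i) \<longlonglongrightarrow> 0"
      unfolding W_row_zero[OF that(2,3)]
      by (rule tendsto_divide_0[OF tendsto_const filterlim_at_top_imp_at_infinity[OF that(1)]])
    then have "\<forall>\<^sub>F k in sequentially. W x y k i < 1" by (rule order_tendstoD) simp
    then show ?thesis by eventually_elim simp
  qed
  have pa: "row_form g i a x' y' \<noteq> 0"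
    using contracted_vector_contradiction[OF i supp v'(1-3) top _ small[OF top' v'(4) b']] by blast
  have pa': "row_form g i' a' x y \<noteq> 0"
    using contracted_vector_contradiction[OF i'' supp' v(1-3) top' _ small[OF top v(4) b]] by blast
  obtain C where C: "\<forall>\<^sub>F k in sequentially. cmod (E a k i) ^ local_degree i \<le> C * cmod (E a' k i') ^ local_degree i'"
    using expansion_comparison[OF i supp v top'] by (elim exE) (rule that)
  obtain C' where C': "\<forall>\<^sub>F k in sequentially. cmod (E a' k i') ^ local_degree i' \<le> C' * cmod (E a k i) ^ local_degree i"
    using expansion_comparison[OF i'' supp' v' top] by (elim exE) (rule that)
  have fx: "\<forall>\<^sub>F k in sequentially. x * uy k x y = ux k x y * y"
    by (rule eventually_fixed_direction[OF i supp v(1,2,4) top' C'])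
  have fx': "\<forall>\<^sub>F k in sequentially. x' * uy k x' y' = ux k x' y' * y'"
    by (rule eventually_fixed_direction[OF i'' supp' v'(1,2,4) top C])
  have z1: "row_form g i b x' y' = 0" by (rule fixed_direction_row[OF top fx' v'(3) b pa])
  have z2: "row_form g i' b' x y = 0" by (rule fixed_direction_row[OF top' fx v(3) b' pa'])
  define d where "d = x * y' - x' * y"
  have d: "d \<noteq> 0"
  proof
    assume "d = 0"
    then have "x * y' = x' * y" by (simp add: d_def)
    then obtain m where m: "x' = m * x" "y' = m * y" using proportional_vectors[OF _ v(3)] by blast
    then show False using pa v(4) by (simp add: row_form_scale)
  qed
  define q :: "'k^2^2" where "q = (\<chi> a b. if b = 1 then (if a = 1 then x else y) else (if a = 1 then x' / d else y' / d))"
  have q: "q $ 1 $ 1 = x" "q $ 2 $ 1 = y" "q $ 1 $ 2 = x' / d" "q $ 2 $ 2 = y' / d" by (simp_all add: q_def)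
  have "q \<in> SL2 UNIV"
    using d unfolding SL2_iff q by (simp add: d_def diff_divide_distrib[symmetric] mult.commute)
  moreover have "(g \<odot> emb q) $ j $ c $ 2 = \<sigma> j (1 / d) * row_form g j c x' y'" "(g \<odot> emb q) $ j $ c $ 1 = row_form g j c x y" for j c
    unfolding pmult_emb_entry q row_form_scale[symmetric] by simp_all
  then have "monomial2 ((g \<odot> emb q) $ i)" "monomial2 ((g \<odot> emb q) $ i')"
    using v(4) v'(4) z1 z2 b b' exhaust_2[of a] exhaust_2[of b] exhaust_2[of a'] exhaust_2[of b']
    unfolding monomial2_def by auto
  ultimately show ?thesis by blast
qed

end

section \<open>Closed subgroups of the diagonal group\<close>

text \<open>Small elements of \<open>A\<close> outside \<open>V\<close> could be chosen orthogonal to \<open>V\<close>.  The multiples of such elements become dense in a line in the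
  limit, which would then belong to \<open>A\<close> and be orthogonal to \<open>V\<close>.\<close>

lemma closed_subgroup_largest_subspace:
  fixes A :: "'a::euclidean_space set"
  assumes closed: "closed A" and zero: "0 \<in> A"
    and add: "\<And>x y. x \<in> A \<Longrightarrow> y \<in> A \<Longrightarrow> x + y \<in> A" and neg: "\<And>x. x \<in> A \<Longrightarrow> - x \<in> A"
  defines "V \<equiv> {v. \<forall>t::real. t *\<^sub>R v \<in> A}"
  shows "subspace V" "\<exists>e>0. \<forall>a\<in>A. norm a < e \<longrightarrow> a \<in> V"
proof -
  show V: "subspace V"
    unfolding subspace_def V_def using zero add by (auto simp: scaleR_right_distrib)
  have nat_mult: "of_nat n *\<^sub>R a \<in> A" if "a \<in> A" for n a
    by (induction n) (use zero add that in \<open>auto simp: scaleR_left_distrib\<close>)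
  have int_mult: "of_int n *\<^sub>R a \<in> A" if "a \<in> A" for n a
    by (cases n rule: int_cases2) (use nat_mult[OF that] neg in auto)
  have VA: "v \<in> A" if "v \<in> V" for v using that unfolding V_def by (metis (mono_tags) mem_Collect_eq scaleR_one)
  show "\<exists>e>0. \<forall>a\<in>A. norm a < e \<longrightarrow> a \<in> V"
  proof (rule ccontr)
    assume neg_ex: "\<not> (\<exists>e>0. \<forall>a\<in>A. norm a < e \<longrightarrow> a \<in> V)"
    have "\<exists>b. b \<in> A \<and> b \<noteq> 0 \<and> norm b < 1 / real (Suc n) \<and> (\<forall>w\<in>V. orthogonal b w)" for n
    proof -
      obtain a where a: "a \<in> A" "norm a < 1 / real (Suc n)" "a \<notin> V"
        using neg_ex by (metis of_nat_0_less_iff zero_less_Suc zero_less_divide_1_iff)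
      obtain v b where vb: "v \<in> span V" "\<And>w. w \<in> span V \<Longrightarrow> orthogonal b w" "a = v + b"
        using orthogonal_subspace_decomp_exists[of V a] by blast
      have vV: "v \<in> V" using vb(1) V by (simp add: span_eq_iff[THEN iffD2])
      have "b = a + - v" using vb(3) by simp
      then have "b \<in> A" using add[OF a(1) neg[OF VA[OF vV]]] by simp
      moreover have "b \<noteq> 0" using vb(3) vV a(3) by auto
      moreover have "norm b \<le> norm a"
      proof -
        have "orthogonal v b" using vb(2)[OF vb(1)] by (simp add: orthogonal_commute)
        then have "(norm a)\<^sup>2 = (norm v)\<^sup>2 + (norm b)\<^sup>2"
          unfolding vb(3) by (rule norm_add_Pythagorean)
        then have "(norm b)\<^sup>2 \<le> (norm a)\<^sup>2" by simp
        then show ?thesis by (rule power2_le_imp_le) simp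
      qed
      ultimately show ?thesis using a(2) vb(2) span_superset[of V] by (intro exI[of _ b]) auto
    qed
    then obtain b where b: "\<And>n. b n \<in> A" "\<And>n. b n \<noteq> 0" "\<And>n. norm (b n) < 1 / real (Suc n)"
      "\<And>n w. w \<in> V \<Longrightarrow> orthogonal (b n) w"
      by metis
    have b0: "(\<lambda>n. norm (b n)) \<longlonglongrightarrow> 0"
      by (rule tendsto_sandwich[OF _ _ tendsto_const LIMSEQ_Suc[OF lim_1_over_n]])
        (use b(3) less_imp_le in \<open>auto intro!: always_eventually\<close>)
    define u where "u n = b n /\<^sub>R norm (b n)" for n
    have "\<forall>n. u n \<in> sphere 0 1" using b(2) by (simp add: u_def)
    then obtain l r where lr: "l \<in> sphere 0 1" "strict_mono (r :: nat \<Rightarrow> nat)" "(u \<circ> r) \<longlonglongrightarrow> l"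
      using compact_sphere[of "0::'a" 1] unfolding compact_def by meson
    have br: "(\<lambda>n. norm (b (r n))) \<longlonglongrightarrow> 0"
      using LIMSEQ_subseq_LIMSEQ[OF b0 lr(2)] by (simp add: o_def)
    have "t *\<^sub>R l \<in> A" for t :: real
    proof -
      define c where "c n = of_int \<lfloor>t / norm (b (r n))\<rfloor> * norm (b (r n))" for n
      have "(\<lambda>n. t - c n) \<longlonglongrightarrow> 0"
      proof (rule tendsto_sandwich[OF _ _ tendsto_const br])
        have "0 \<le> t - c n \<and> t - c n \<le> norm (b (r n))" for n
        proof -
          have p: "norm (b (r n)) > 0" using b(2) by simp
          have "of_int \<lfloor>t / norm (b (r n))\<rfloor> \<le> t / norm (b (r n))" "t / norm (b (r n)) \<le> of_int \<lfloor>t / norm (b (r n))\<rfloor> + 1"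
            by linarith+
          then have "of_int \<lfloor>t / norm (b (r n))\<rfloor> * norm (b (r n)) \<le> t / norm (b (r n)) * norm (b (r n))"
            "t / norm (b (r n)) * norm (b (r n)) \<le> (of_int \<lfloor>t / norm (b (r n))\<rfloor> + 1) * norm (b (r n))"
            by (intro mult_right_mono; simp)+
          moreover have "t / norm (b (r n)) * norm (b (r n)) = t" using p by simp
          ultimately show ?thesis unfolding c_def distrib_right by linarith
        qed
        then show "\<forall>\<^sub>F n in sequentially. 0 \<le> t - c n" "\<forall>\<^sub>F n in sequentially. t - c n \<le> norm (b (r n))"
          by simp_all
      qed
      from tendsto_diff[OF tendsto_const[of t] this] have "c \<longlonglongrightarrow> t" by simp
      then have lim: "(\<lambda>n. c n *\<^sub>R (u \<circ> r) n) \<longlonglongrightarrow> t *\<^sub>R l" by (intro tendsto_scaleR lr(3))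
      have mem: "c n *\<^sub>R (u \<circ> r) n \<in> A" for n
        using int_mult[OF b(1)[of "r n"], of "\<lfloor>t / norm (b (r n))\<rfloor>"] b(2)[of "r n"] by (simp add: c_def u_def mult.assoc)
      show ?thesis by (rule closed_sequentially[OF closed mem lim])
    qed
    then have "l \<in> V" by (simp add: V_def)
    then have "orthogonal ((u \<circ> r) n) l" for n
      using b(4) by (simp add: u_def orthogonal_def)
    then have "\<And>n. (u \<circ> r) n \<bullet> l = 0" by (simp add: orthogonal_def)
    moreover have "(\<lambda>n. (u \<circ> r) n \<bullet> l) \<longlonglongrightarrow> l \<bullet> l" by (intro tendsto_inner lr(3) tendsto_const)
    ultimately have "(\<lambda>n::nat. 0) \<longlonglongrightarrow> l \<bullet> l" by simp
    then have "l \<bullet> l = 0" by (simp add: LIMSEQ_const_iff)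
    then show False using lr(1) by simp
  qed
qed

lemma padj_torus_exp: "padj (torus_exp z) = torus_exp (- z)"
  by (simp add: vec_eq_iff forall_2)

lemma torus_exp_commute: "torus_exp z \<odot> torus_exp w = torus_exp w \<odot> torus_exp z"
  by (simp flip: torus_exp_add add: add.commute)

context arch_number_field
begin

text \<open>The Lie algebra of the full diagonal group \<open>D \<sigma> UNIV\<close>, which \<open>torus_exp\<close> maps onto that group.\<close>

definition Lie :: "(complex^'r) set" where
  "Lie = {z. \<forall>j. z $ j \<in> arch_completion (\<sigma> j)}"

lemma subspace_Lie: "subspace Lie"
proof -
  have "t *\<^sub>R w \<in> arch_completion (\<sigma> j)" if "w \<in> arch_completion (\<sigma> j)" for t w j
    using completion_closed(2)[OF completion_closed(5)[of t j] that] by (simp add: scaleR_conv_of_real)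
  then show ?thesis
    unfolding subspace_def Lie_def using completion_closed(1) completion_closed(5)[of 0] by auto
qed

lemma closed_Lie: "closed Lie"
  by (rule closed_subspace[OF subspace_Lie])

lemma Lie_ops: "z \<in> Lie \<Longrightarrow> w \<in> Lie \<Longrightarrow> z + w \<in> Lie" "z \<in> Lie \<Longrightarrow> - z \<in> Lie" "z \<in> Lie \<Longrightarrow> w \<in> Lie \<Longrightarrow> z - w \<in> Lie" "0 \<in> Lie"
  using subspace_Lie by (auto intro: subspace_add subspace_neg subspace_diff subspace_0)

lemma D_eq: "D \<sigma> I = torus_exp ` {z \<in> Lie. \<forall>j. j \<notin> I \<longrightarrow> z $ j = 0}"
proof
  show "D \<sigma> I \<subseteq> torus_exp ` {z \<in> Lie. \<forall>j. j \<notin> I \<longrightarrow> z $ j = 0}"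
  proof
    fix h assume h: "h \<in> D \<sigma> I"
    have "\<exists>w. w \<in> arch_completion (\<sigma> j) \<and> (j \<notin> I \<longrightarrow> w = 0) \<and> h $ j = diag_exp w" for j
    proof (cases "j \<in> I")
      case True
      then show ?thesis using h by (auto simp: D_def D_factor_eq dest!: spec[of _ j])
    next
      case False
      then have "h $ j = diag_exp 0" using h by (auto simp: D_def dest!: spec[of _ j])
      then show ?thesis using completion_closed(5)[of 0 j] by (intro exI[of _ 0]) simp
    qed
    then obtain w where w: "\<And>j. w j \<in> arch_completion (\<sigma> j) \<and> (j \<notin> I \<longrightarrow> w j = 0) \<and> h $ j = diag_exp (w j)"
      by metis
    have "h = torus_exp (\<chi> j. w j)" using w by (simp add: vec_eq_iff[of h])
    then show "h \<in> torus_exp ` {z \<in> Lie. \<forall>j. j \<notin> I \<longrightarrow> z $ j = 0}"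
      using w by (intro image_eqI) (auto simp: Lie_def)
  qed
next
  show "torus_exp ` {z \<in> Lie. \<forall>j. j \<notin> I \<longrightarrow> z $ j = 0} \<subseteq> D \<sigma> I"
    by (auto simp: D_def D_factor_eq Lie_def)
qed

lemma DR_eq: "DR \<sigma> I = torus_exp ` {z. \<forall>j. z $ j \<in> (if j \<in> I then \<real> else {0})}"
proof
  show "DR \<sigma> I \<subseteq> torus_exp ` {z. \<forall>j. z $ j \<in> (if j \<in> I then \<real> else {0})}"
  proof
    fix h assume h: "h \<in> DR \<sigma> I"
    have "\<exists>w. w \<in> (if j \<in> I then \<real> else {0}) \<and> h $ j = diag_exp w" for j
      using h by (cases "j \<in> I") (auto simp: DR_def DR_factor_eq dest!: spec[of _ j])
    then obtain w where w: "\<And>j. w j \<in> (if j \<in> I then \<real> else {0}) \<and> h $ j = diag_exp (w j)"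
      by metis
    have "h = torus_exp (\<chi> j. w j)" using w by (simp add: vec_eq_iff[of h])
    moreover have "(\<chi> j. w j) \<in> {z. \<forall>j. z $ j \<in> (if j \<in> I then \<real> else {0})}"
      by (simp only: vec_lambda_beta mem_Collect_eq) (use w in blast)
    ultimately show "h \<in> torus_exp ` {z. \<forall>j. z $ j \<in> (if j \<in> I then \<real> else {0})}"
      by (rule image_eqI)
  qed
next
  show "torus_exp ` {z. \<forall>j. z $ j \<in> (if j \<in> I then \<real> else {0})} \<subseteq> DR \<sigma> I"
  proof (rule image_subsetI)
    fix z :: "complex^'r" assume z: "z \<in> {z. \<forall>j. z $ j \<in> (if j \<in> I then \<real> else {0})}"
    have "torus_exp z $ j \<in> (if j \<in> I then DR_factor (\<sigma> j) else {mat 1})" for j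
      using z by (auto simp: DR_factor_eq dest!: spec[of _ j])
    then show "torus_exp z \<in> DR \<sigma> I" by (simp add: DR_def)
  qed
qed

lemma torus_exp_carrier:
  assumes "z \<in> Lie"
  shows "torus_exp z \<in> carrier (G \<sigma>)"
proof -
  have "diag_exp (z $ j) \<in> SL2 (arch_completion (\<sigma> j))" for j
  proof -
    have z: "z $ j \<in> arch_completion (\<sigma> j)" using assms by (simp add: Lie_def)
    have "exp (z $ j) \<in> arch_completion (\<sigma> j)" "exp (- z $ j) \<in> arch_completion (\<sigma> j)"
      using completion_closed(4)[OF z] completion_closed(4)[OF completion_closed(3)[OF z]] by simp_all
    moreover have "0 \<in> arch_completion (\<sigma> j)" using completion_closed(5)[of 0 j] by simp
    moreover have "exp (z $ j) * exp (- z $ j) = 1" by (simp add: exp_minus)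
    ultimately show ?thesis unfolding SL2_iff diag_exp_entries by simp
  qed
  then show ?thesis by (simp add: G_simps(3))
qed

lemma closed_real_diagonals: "closed {A :: complex^2^2. A $ 1 $ 2 = 0 \<and> A $ 2 $ 1 = 0 \<and> A $ 1 $ 1 * A $ 2 $ 2 = 1 \<and> Im (A $ 1 $ 1) = 0 \<and> Re (A $ 1 $ 1) \<ge> 0}"
  by (intro closed_Collect_conj closed_Collect_eq closed_Collect_le continuous_intros)

lemma closed_diagonals: "closed {A :: complex^2^2. A $ 1 $ 2 = 0 \<and> A $ 2 $ 1 = 0 \<and> A $ 1 $ 1 * A $ 2 $ 2 = 1}"
  by (intro closed_Collect_conj closed_Collect_eq continuous_intros)

lemma diag_exp_image_UNIV: "diag_exp ` UNIV = {A. A $ 1 $ 2 = 0 \<and> A $ 2 $ 1 = 0 \<and> A $ 1 $ 1 * A $ 2 $ 2 = 1}"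
  unfolding diag_SL2_UNIV[symmetric] by (auto simp: diag_SL2_iff)

lemma diag_exp_Ln:
  assumes "A $ 1 $ 2 = 0" "A $ 2 $ 1 = 0" "A $ 1 $ 1 * A $ 2 $ 2 = 1"
  shows "A = diag_exp (Ln (A $ 1 $ 1))"
proof -
  have nz: "A $ 1 $ 1 \<noteq> 0" using assms(3) by auto
  then have "A $ 2 $ 2 = inverse (A $ 1 $ 1)" using assms(3) by (metis inverse_unique)
  then show ?thesis using assms nz by (intro matrix_2_eqI) (auto simp: exp_minus)
qed

lemma diag_exp_image_Reals:
  "diag_exp ` \<real> = {A. A $ 1 $ 2 = 0 \<and> A $ 2 $ 1 = 0 \<and> A $ 1 $ 1 * A $ 2 $ 2 = 1 \<and> Im (A $ 1 $ 1) = 0 \<and> Re (A $ 1 $ 1) \<ge> 0}"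
    (is "_ = ?R")
proof
  show "diag_exp ` \<real> \<subseteq> ?R" by (auto simp: exp_minus exp_of_real elim!: Reals_cases)
  show "?R \<subseteq> diag_exp ` \<real>"
  proof
    fix A assume A: "A \<in> ?R"
    then have nz: "A $ 1 $ 1 \<noteq> 0" by auto
    obtain x where x: "A $ 1 $ 1 = of_real x"
    proof
      show "A $ 1 $ 1 = of_real (Re (A $ 1 $ 1))" using A by (simp add: complex_eq_iff)
    qed
    then have "x > 0" using A nz by auto
    then have "Ln (A $ 1 $ 1) \<in> \<real>" unfolding x by (simp add: Ln_of_real)
    moreover have "A = diag_exp (Ln (A $ 1 $ 1))" using A by (intro diag_exp_Ln) auto
    ultimately show "A \<in> diag_exp ` \<real>" by blast
  qed
qed

lemma closed_diag_exp_image: "closed (diag_exp ` UNIV)" "closed (diag_exp ` \<real>)" "closed (diag_exp ` arch_completion (\<sigma> j))"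
proof -
  show 1: "closed (diag_exp ` UNIV)" unfolding diag_exp_image_UNIV by (rule closed_diagonals)
  show 2: "closed (diag_exp ` \<real>)" unfolding diag_exp_image_Reals by (rule closed_real_diagonals)
  show "closed (diag_exp ` arch_completion (\<sigma> j))" using 1 2 by (simp add: arch_completion_eq)
qed

lemma closed_componentwise:
  fixes S :: "'r \<Rightarrow> (complex^2^2) set"
  assumes "\<And>i. closed (S i)"
  shows "closed {g. \<forall>i. g $ i \<in> S i}"
proof -
  have "{g. \<forall>i. g $ i \<in> S i} = (\<Inter>i. (\<lambda>g. g $ i) -` S i)" by auto
  moreover have "closed ((\<lambda>g :: complex^2^2^'r. g $ i) -` S i)" for i
    by (intro continuous_closed_vimage assms) (intro continuous_intros)
  ultimately show ?thesis by (simp only:) (intro closed_INT ballI; assumption)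
qed

lemma closed_D: "closed (D \<sigma> I)" and closed_DR: "closed (DR \<sigma> I)"
  unfolding D_def DR_def
  by (intro closed_componentwise; simp add: D_factor_eq DR_factor_eq closed_diag_exp_image)+

lemma D_UNIV: "D \<sigma> UNIV = torus_exp ` Lie"
  unfolding D_eq by simp

text \<open>The principal logarithm is a continuous local inverse of \<open>torus_exp\<close> near the identity.\<close>

lemma small_log:
  assumes h: "\<And>n. h n \<in> D \<sigma> UNIV" "h \<longlonglongrightarrow> pone"
  shows "\<exists>a. (\<forall>n. a n \<in> Lie \<and> torus_exp (a n) = h n) \<and> a \<longlonglongrightarrow> 0"
proof -
  define a where "a n = (\<chi> j. Ln (h n $ j $ 1 $ 1))" for n
  have hd: "h n $ j \<in> diag_exp ` arch_completion (\<sigma> j)" for n j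
    using h(1)[of n] by (auto simp: D_def D_factor_eq)
  have "a n $ j \<in> arch_completion (\<sigma> j) \<and> diag_exp (a n $ j) = h n $ j" for n j
  proof
    have "h n $ j \<in> diag_exp ` UNIV" using hd[of n j] by blast
    then show "diag_exp (a n $ j) = h n $ j" unfolding diag_exp_image_UNIV a_def using diag_exp_Ln[of "h n $ j"] by simp
    show "a n $ j \<in> arch_completion (\<sigma> j)"
    proof (cases "range (\<sigma> j) \<subseteq> \<real>")
      case True
      then obtain t where "h n $ j = diag_exp (of_real t)"
        using hd[of n j] arch_completion_eq[OF embedding, of j] by (auto elim!: Reals_cases)
      then have "h n $ j $ 1 $ 1 = of_real (exp t)" by (simp add: exp_of_real)
      then have "a n $ j = of_real (ln (exp t))" unfolding a_def by (simp add: Ln_of_real)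
      then show ?thesis by (simp add: completion_closed)
    qed (simp add: arch_completion_eq)
  qed
  then have "\<forall>n. a n \<in> Lie \<and> torus_exp (a n) = h n" by (simp add: Lie_def vec_eq_iff[of "torus_exp _"])
  moreover have "a \<longlonglongrightarrow> 0"
  proof (rule vec_tendstoI)
    fix j
    have "(\<lambda>n. h n $ j $ 1 $ 1) \<longlonglongrightarrow> pone $ j $ 1 $ 1" by (intro tendsto_vec_nth h(2))
    then have "(\<lambda>n. Ln (h n $ j $ 1 $ 1)) \<longlonglongrightarrow> Ln 1" by (intro tendsto_Ln) auto
    then show "(\<lambda>n. a n $ j) \<longlonglongrightarrow> 0 $ j" by (simp add: a_def)
  qed
  ultimately show ?thesis by blast
qed

lemma finite_bounded_\<Gamma>: "finite {\<gamma> \<in> \<Gamma> \<sigma>. norm \<gamma> \<le> R}"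
proof -
  define F where "F = {\<alpha>. algebraic_int \<alpha> \<and> (\<forall>j. cmod (\<sigma> j \<alpha>) \<le> R)}"
  define mk where "mk = (\<lambda>(p, q, r, s). emb (\<chi> a b. if a = 1 then (if b = 1 then p else q) else (if b = 1 then r else s)))"
  have "{\<gamma> \<in> \<Gamma> \<sigma>. norm \<gamma> \<le> R} \<subseteq> mk ` (F \<times> F \<times> F \<times> F)"
  proof
    fix \<gamma> assume \<gamma>: "\<gamma> \<in> {\<gamma> \<in> \<Gamma> \<sigma>. norm \<gamma> \<le> R}"
    then obtain A where A: "\<gamma> = emb A" "A \<in> SLO" by (auto simp: \<Gamma>_eq)
    have "A $ a $ b \<in> F" for a b
    proof -
      have "cmod (\<sigma> j (A $ a $ b)) \<le> R" for j
        using entry_le_norm[of \<gamma> j a b] \<gamma> by (simp add: A(1))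
      then show ?thesis using A(2) by (simp add: SL2_def F_def)
    qed
    then have mem: "(A $ 1 $ 1, A $ 1 $ 2, A $ 2 $ 1, A $ 2 $ 2) \<in> F \<times> F \<times> F \<times> F" by blast
    have mk: "mk (A $ 1 $ 1, A $ 1 $ 2, A $ 2 $ 1, A $ 2 $ 2) = \<gamma>"
      unfolding mk_def A(1) by (simp, rule arg_cong[of _ _ emb], rule matrix_2_eqI) simp_all
    show "\<gamma> \<in> mk ` (F \<times> F \<times> F \<times> F)"
      using imageI[OF mem, of mk] unfolding mk .
  qed
  moreover have "finite F" unfolding F_def by (rule finite_bounded_algebraic_ints)
  ultimately show ?thesis
    by (elim finite_subset) (intro finite_imageI finite_cartesian_product)
qed

text \<open>The products of entries from different rows are exactly the polynomials that diagonal matrices of determinant 1, acting from the left,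
  leave invariant.\<close>

lemma equal_row_products:
  fixes X Y :: "'k^2^2"
  assumes X: "X \<in> SL2 UNIV" and Y: "Y \<in> SL2 UNIV"
    and eq: "\<And>a b. X $ 1 $ a * X $ 2 $ b = Y $ 1 $ a * Y $ 2 $ b"
  shows "(X ** adj2 Y) $ 1 $ 2 = 0" "(X ** adj2 Y) $ 2 $ 1 = 0"
proof -
  have X1: "X $ 1 $ 1 * X $ 2 $ 2 - X $ 1 $ 2 * X $ 2 $ 1 = 1" and Y1: "Y $ 1 $ 1 * Y $ 2 $ 2 - Y $ 1 $ 2 * Y $ 2 $ 1 = 1"
    using X Y by (simp_all add: SL2_iff)
  let ?u = "X $ 1 $ 2 * Y $ 1 $ 1 - X $ 1 $ 1 * Y $ 1 $ 2"
  let ?v = "X $ 2 $ 1 * Y $ 2 $ 2 - X $ 2 $ 2 * Y $ 2 $ 1"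
  have "?u * X $ 2 $ b = (X $ 1 $ 2 * X $ 2 $ b) * Y $ 1 $ 1 - (X $ 1 $ 1 * X $ 2 $ b) * Y $ 1 $ 2" for b
    by (simp add: algebra_simps)
  then have u: "?u * X $ 2 $ b = 0" for b unfolding eq by simp
  have "?u = ?u * (X $ 1 $ 1 * X $ 2 $ 2 - X $ 1 $ 2 * X $ 2 $ 1)" using X1 by simp
  also have "\<dots> = X $ 1 $ 1 * (?u * X $ 2 $ 2) - X $ 1 $ 2 * (?u * X $ 2 $ 1)" by (simp add: algebra_simps)
  also have "\<dots> = 0" unfolding u by simp
  finally show "(X ** adj2 Y) $ 1 $ 2 = 0" by (simp add: entry_mult_2 algebra_simps)
  have "X $ 1 $ b * ?v = (X $ 1 $ b * X $ 2 $ 1) * Y $ 2 $ 2 - (X $ 1 $ b * X $ 2 $ 2) * Y $ 2 $ 1" for b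
    by (simp add: algebra_simps)
  then have v: "X $ 1 $ b * ?v = 0" for b unfolding eq by simp
  have "?v = ?v * (X $ 1 $ 1 * X $ 2 $ 2 - X $ 1 $ 2 * X $ 2 $ 1)" using X1 by simp
  also have "\<dots> = X $ 2 $ 2 * (X $ 1 $ 1 * ?v) - X $ 2 $ 1 * (X $ 1 $ 2 * ?v)" by (simp add: algebra_simps)
  also have "\<dots> = 0" unfolding v by simp
  finally show "(X ** adj2 Y) $ 2 $ 1 = 0" by (simp add: entry_mult_2 algebra_simps)
qed

lemma matrix_common_denominator:
  "\<exists>m\<noteq>0. \<forall>a b. algebraic_int (m * (P :: 'k^2^2) $ a $ b)"
proof -
  obtain N :: "'k \<Rightarrow> int" where N: "\<And>x. N x > 0" "\<And>x. algebraic_int (of_int (N x) * x)"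
    using int_multiple_algebraic_int[OF number_field] by metis
  define m :: 'k where "m = of_int (N (P $ 1 $ 1)) * of_int (N (P $ 1 $ 2)) * of_int (N (P $ 2 $ 1)) * of_int (N (P $ 2 $ 2))"
  have i: "algebraic_int (of_int (N x))" for x by simp
  have "algebraic_int (of_int (N x2) * of_int (N x3) * of_int (N x4) * (of_int (N x) * x))" for x x2 x3 x4
    by (intro algebraic_int_mult i N(2))
  note t = this
  have "algebraic_int (m * P $ 1 $ 1)" "algebraic_int (m * P $ 1 $ 2)" "algebraic_int (m * P $ 2 $ 1)" "algebraic_int (m * P $ 2 $ 2)"
    using t[of "P $ 1 $ 2" "P $ 2 $ 1" "P $ 2 $ 2" "P $ 1 $ 1"] t[of "P $ 1 $ 1" "P $ 2 $ 1" "P $ 2 $ 2" "P $ 1 $ 2"]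
      t[of "P $ 1 $ 1" "P $ 1 $ 2" "P $ 2 $ 2" "P $ 2 $ 1"] t[of "P $ 1 $ 1" "P $ 1 $ 2" "P $ 2 $ 1" "P $ 2 $ 2"]
    unfolding m_def by (simp_all only: mult_ac)
  then have "\<forall>a b. algebraic_int (m * P $ a $ b)" by (simp add: forall_2)
  moreover have "m \<noteq> 0" unfolding m_def using N(1) by (simp add: less_imp_neq[symmetric])
  ultimately show ?thesis by blast
qed

end

section \<open>Torus orbits of rational points\<close>

text \<open>This covers both tori at once: \<open>M\<close> is the Lie algebra of the torus \<open>torus_exp ` M\<close> with active places \<open>I\<close>.  Invariance under
  changing signs place by place says that monomial matrices normalise the torus.\<close>

locale torus_action = arch_number_field \<sigma>
  for \<sigma> :: "'r::finite \<Rightarrow> 'k::field_char_0 \<Rightarrow> complex" +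
  fixes M :: "(complex^'r) set" and I :: "'r set"
  assumes subspace_M: "subspace M" and M_Lie: "M \<subseteq> Lie"
    and M_supp: "\<And>z j. z \<in> M \<Longrightarrow> j \<notin> I \<Longrightarrow> z $ j = 0"
    and closed_T: "closed (torus_exp ` M)"
    and M_flip: "\<And>s z. z \<in> M \<Longrightarrow> (\<chi> j. if s j then - z $ j else z $ j) \<in> M"
begin

text \<open>The preimage in \<open>G \<sigma>\<close> of the orbit through \<open>\<pi> \<sigma> g\<close>.\<close>

definition Orb :: "complex^2^2^'r \<Rightarrow> (complex^2^2^'r) set" where
  "Orb g = (\<lambda>(z, \<gamma>). torus_exp z \<odot> g \<odot> \<gamma>) ` (M \<times> \<Gamma> \<sigma>)"

lemma OrbI: "z \<in> M \<Longrightarrow> \<gamma> \<in> \<Gamma> \<sigma> \<Longrightarrow> torus_exp z \<odot> g \<odot> \<gamma> \<in> Orb g"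
  unfolding Orb_def by (rule image_eqI[of _ _ "(z, \<gamma>)"]) auto

lemma OrbE:
  assumes "h \<in> Orb g"
  obtains z \<gamma> where "z \<in> M" "\<gamma> \<in> \<Gamma> \<sigma>" "h = torus_exp z \<odot> g \<odot> \<gamma>"
  using assms unfolding Orb_def by auto

lemma M_ops: "z \<in> M \<Longrightarrow> w \<in> M \<Longrightarrow> z + w \<in> M" "z \<in> M \<Longrightarrow> - z \<in> M" "z \<in> M \<Longrightarrow> w \<in> M \<Longrightarrow> z - w \<in> M" "0 \<in> M"
  using subspace_M by (auto intro: subspace_add subspace_neg subspace_diff subspace_0)

lemma M_in_Lie: "z \<in> M \<Longrightarrow> z \<in> Lie"
  using M_Lie by blast

lemma D_UNIV_E:
  assumes "h \<in> D \<sigma> UNIV"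
  obtains z where "z \<in> Lie" "h = torus_exp z"
  using assms unfolding D_UNIV by auto

lemma D_UNIV_I: "z \<in> Lie \<Longrightarrow> torus_exp z \<in> D \<sigma> UNIV"
  unfolding D_UNIV by (rule imageI)

lemma D_UNIV_ops:
  assumes "h \<in> D \<sigma> UNIV" "k \<in> D \<sigma> UNIV"
  shows "h \<odot> k \<in> D \<sigma> UNIV" "padj h \<in> D \<sigma> UNIV" "h \<odot> k = k \<odot> h" "h \<in> carrier (G \<sigma>)"
proof -
  obtain z where z: "z \<in> Lie" "h = torus_exp z" using assms(1) by (rule D_UNIV_E)
  obtain w where w: "w \<in> Lie" "k = torus_exp w" using assms(2) by (rule D_UNIV_E)
  show "h \<odot> k \<in> D \<sigma> UNIV"
    unfolding z w torus_exp_add[symmetric] by (intro D_UNIV_I Lie_ops z w)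
  show "padj h \<in> D \<sigma> UNIV"
    unfolding z padj_torus_exp by (intro D_UNIV_I Lie_ops z)
  show "h \<odot> k = k \<odot> h" unfolding z w by (rule torus_exp_commute)
  show "h \<in> carrier (G \<sigma>)" unfolding z by (rule torus_exp_carrier[OF z(1)])
qed

text \<open>For a rational point \<open>p\<close> the orbit map of the full diagonal group is proper modulo its stabiliser \<open>\<Delta>\<close>: if \<open>torus_exp (z n) p \<gamma>\<^sub>n\<close>
  converges, the products of entries from different rows of \<open>p \<gamma>\<^sub>n\<close> are unchanged by \<open>torus_exp (z n)\<close>, so they are bounded and have bounded
  denominators; they take finitely many values, and \<open>p \<gamma>\<^sub>n\<close> is constant up to \<open>\<Delta>\<close> on a subsequence.  Hence the closure is the
  orbit of \<open>H'\<close>, the closure of \<open>T \<Delta>\<close>.  The largest subspace \<open>V\<close> of the Lie algebra of \<open>H'\<close> exponentiates to an open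
  subgroup of \<open>H'\<close> containing \<open>T\<close>, so \<open>H' = torus_exp V \<Delta>\<close>, and \<open>\<Delta>\<close> acts trivially on the point.\<close>

lemma rational_torus_orbit_closure:
  assumes P: "P \<in> SL2 (UNIV :: 'k set)"
  shows "\<exists>V. subspace V \<and> V \<subseteq> Lie \<and> closed (torus_exp ` V) \<and>
    closure (Orb (emb P)) = (\<lambda>(v, \<gamma>). torus_exp v \<odot> emb P \<odot> \<gamma>) ` (V \<times> \<Gamma> \<sigma>)"
proof -
  define p where "p = emb P"
  have p: "p \<in> carrier (G \<sigma>)" unfolding p_def by (rule emb_carrier[OF P])
  define \<Delta> where "\<Delta> = {d \<in> D \<sigma> UNIV. \<exists>\<gamma>\<in>\<Gamma> \<sigma>. d \<odot> p = p \<odot> \<gamma>}"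
  have \<Delta>I: "d \<in> \<Delta>" if "d \<in> D \<sigma> UNIV" "\<gamma> \<in> \<Gamma> \<sigma>" "d \<odot> p = p \<odot> \<gamma>" for d \<gamma>
    using that unfolding \<Delta>_def by auto
  have \<Delta>D: "d \<in> D \<sigma> UNIV" if "d \<in> \<Delta>" for d using that unfolding \<Delta>_def by auto
  have \<Delta>E: "\<exists>\<gamma>\<in>\<Gamma> \<sigma>. d \<odot> p = p \<odot> \<gamma>" if "d \<in> \<Delta>" for d using that unfolding \<Delta>_def by auto
  have one\<Delta>: "pone \<in> \<Delta>"
    using D_UNIV_I[OF Lie_ops(4)] \<Gamma>_closed(3) by (intro \<Delta>I[of _ pone]) auto
  have mult\<Delta>: "d \<odot> e \<in> \<Delta>" if d: "d \<in> \<Delta>" and e: "e \<in> \<Delta>" for d e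
  proof -
    obtain \<gamma> where \<gamma>: "\<gamma> \<in> \<Gamma> \<sigma>" "d \<odot> p = p \<odot> \<gamma>" using \<Delta>E[OF d] by (elim bexE) (rule that)
    obtain \<gamma>' where \<gamma>': "\<gamma>' \<in> \<Gamma> \<sigma>" "e \<odot> p = p \<odot> \<gamma>'" using \<Delta>E[OF e] by (elim bexE) (rule that)
    have "d \<odot> e \<odot> p = (d \<odot> p) \<odot> \<gamma>'" by (simp only: pmult_assoc \<gamma>'(2))
    also have "\<dots> = p \<odot> (\<gamma> \<odot> \<gamma>')" by (simp only: pmult_assoc \<gamma>(2))
    finally show ?thesis
      by (rule \<Delta>I[OF D_UNIV_ops(1)[OF \<Delta>D[OF d] \<Delta>D[OF e]] \<Gamma>_closed(1)[OF \<gamma>(1) \<gamma>'(1)]])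
  qed
  have inv\<Delta>: "padj d \<in> \<Delta>" if d: "d \<in> \<Delta>" for d
  proof -
    obtain \<gamma> where \<gamma>: "\<gamma> \<in> \<Gamma> \<sigma>" "d \<odot> p = p \<odot> \<gamma>" using \<Delta>E[OF d] by (elim bexE) (rule that)
    have dc: "d \<in> carrier (G \<sigma>)" by (rule D_UNIV_ops(4)[OF \<Delta>D[OF d] \<Delta>D[OF d]])
    have "d \<odot> (p \<odot> padj \<gamma>) = p"
      using padj_mult(2)[OF \<Gamma>_carrier[OF \<gamma>(1)]] by (simp only: pmult_assoc[symmetric] \<gamma>(2)) (simp add: pmult_assoc)
    then have "padj d \<odot> p = padj d \<odot> (d \<odot> (p \<odot> padj \<gamma>))" by simp
    also have "\<dots> = p \<odot> padj \<gamma>" by (rule padj_mult_assoc(1)[OF dc])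
    finally show ?thesis
      by (rule \<Delta>I[OF D_UNIV_ops(2)[OF \<Delta>D[OF d] \<Delta>D[OF d]] \<Gamma>_closed(2)[OF \<gamma>(1)]])
  qed
  define S where "S = (\<lambda>(z, d). torus_exp z \<odot> d) ` (M \<times> \<Delta>)"
  have SI: "torus_exp z \<odot> d \<in> S" if "z \<in> M" "d \<in> \<Delta>" for z d
    unfolding S_def by (rule image_eqI[of _ _ "(z, d)"]) (use that in auto)
  have SE: "\<exists>z\<in>M. \<exists>d\<in>\<Delta>. s = torus_exp z \<odot> d" if "s \<in> S" for s using that unfolding S_def by auto
  have SD: "s \<in> D \<sigma> UNIV" if s: "s \<in> S" for s
  proof -
    obtain z d where "z \<in> M" "d \<in> \<Delta>" "s = torus_exp z \<odot> d" using SE[OF s] by auto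
    then show ?thesis using D_UNIV_ops(1)[OF D_UNIV_I[OF M_in_Lie] \<Delta>D] by simp
  qed
  have Smult: "s \<odot> t \<in> S" if s: "s \<in> S" and t: "t \<in> S" for s t
  proof -
    obtain z d where zd: "z \<in> M" "d \<in> \<Delta>" "s = torus_exp z \<odot> d" using SE[OF s] by auto
    obtain w e where we: "w \<in> M" "e \<in> \<Delta>" "t = torus_exp w \<odot> e" using SE[OF t] by auto
    have "d \<odot> torus_exp w = torus_exp w \<odot> d" by (rule D_UNIV_ops(3)[OF \<Delta>D[OF zd(2)] D_UNIV_I[OF M_in_Lie[OF we(1)]]])
    then have "s \<odot> t = torus_exp (z + w) \<odot> (d \<odot> e)"
      unfolding zd we torus_exp_add by (metis pmult_assoc)
    then show ?thesis using SI[OF M_ops(1)[OF zd(1) we(1)] mult\<Delta>[OF zd(2) we(2)]] by simp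
  qed
  have Sinv: "padj s \<in> S" if s: "s \<in> S" for s
  proof -
    obtain z d where zd: "z \<in> M" "d \<in> \<Delta>" "s = torus_exp z \<odot> d" using SE[OF s] by auto
    obtain w where w: "w \<in> Lie" "d = torus_exp w" using \<Delta>D[OF zd(2)] by (rule D_UNIV_E)
    have "padj s = torus_exp (- z) \<odot> padj d"
      unfolding zd w padj_torus_exp torus_exp_add[symmetric] by (simp add: torus_exp_add[symmetric] padj_torus_exp)
    then show ?thesis using SI[OF M_ops(2)[OF zd(1)] inv\<Delta>[OF zd(2)]] by simp
  qed
  define H' where "H' = closure S"
  have H'seq: "h \<in> H' \<longleftrightarrow> (\<exists>s. (\<forall>n. s n \<in> S) \<and> s \<longlonglongrightarrow> h)" for h
    unfolding H'_def by (rule closure_sequential)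
  have H'D: "h \<in> D \<sigma> UNIV" if "h \<in> H'" for h
  proof -
    have "closure S \<subseteq> D \<sigma> UNIV" using SD by (intro closure_minimal closed_D subsetI)
    then show ?thesis using that unfolding H'_def by blast
  qed
  have H'mult: "h \<odot> k \<in> H'" if hk: "h \<in> H'" "k \<in> H'" for h k
  proof -
    obtain s where s: "\<forall>n. s n \<in> S" "s \<longlonglongrightarrow> h" using hk(1) unfolding H'seq by (elim exE conjE) (rule that)
    obtain t where t: "\<forall>n. t n \<in> S" "t \<longlonglongrightarrow> k" using hk(2) unfolding H'seq by (elim exE conjE) (rule that)
    have "(\<lambda>n. s n \<odot> t n) \<longlonglongrightarrow> h \<odot> k" by (intro tendsto_intros s t)
    moreover have "\<forall>n. s n \<odot> t n \<in> S" using s(1) t(1) Smult by simp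
    ultimately show ?thesis unfolding H'seq by (intro exI[of _ "\<lambda>n. s n \<odot> t n"]) simp
  qed
  have H'inv: "padj h \<in> H'" if h: "h \<in> H'" for h
  proof -
    obtain s where s: "\<forall>n. s n \<in> S" "s \<longlonglongrightarrow> h" using h unfolding H'seq by (elim exE conjE) (rule that)
    have "(\<lambda>n. padj (s n)) \<longlonglongrightarrow> padj h" by (intro tendsto_intros s)
    moreover have "\<forall>n. padj (s n) \<in> S" using s(1) Sinv by simp
    ultimately show ?thesis unfolding H'seq by (intro exI[of _ "\<lambda>n. padj (s n)"]) simp
  qed
  have SH': "s \<in> H'" if "s \<in> S" for s using that closure_subset unfolding H'_def by blast
  have MH': "torus_exp z \<in> H'" if "z \<in> M" for z using SH'[OF SI[OF that one\<Delta>]] by simp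
  define A where "A = {z \<in> Lie. torus_exp z \<in> H'}"
  have clA: "closed A"
  proof -
    have "A = Lie \<inter> torus_exp -` H'" unfolding A_def by auto
    moreover have "closed (torus_exp -` H' :: (complex^'r) set)"
      unfolding H'_def using continuous_on_torus_exp[of UNIV "\<lambda>x::complex^'r. x"]
      by (intro continuous_closed_vimage closed_closure) (simp add: continuous_on_eq_continuous_at)
    ultimately show ?thesis using closed_Lie by (simp add: closed_Int)
  qed
  have A0: "0 \<in> A" unfolding A_def using Lie_ops(4) MH'[OF M_ops(4)] by simp
  have Aadd: "x + y \<in> A" if "x \<in> A" "y \<in> A" for x y
    using that Lie_ops(1) H'mult unfolding A_def by (simp add: torus_exp_add)
  have Aneg: "- x \<in> A" if "x \<in> A" for x
    using that Lie_ops(2) H'inv unfolding A_def by (simp flip: padj_torus_exp)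
  define V where "V = {v. \<forall>t::real. t *\<^sub>R v \<in> A}"
  have subV: "subspace V"
    unfolding V_def by (rule closed_subgroup_largest_subspace(1)[OF clA A0]) (fact Aadd, fact Aneg)
  have "\<exists>e>0. \<forall>a\<in>A. norm a < e \<longrightarrow> a \<in> V"
    unfolding V_def by (rule closed_subgroup_largest_subspace(2)[OF clA A0]) (fact Aadd, fact Aneg)
  then obtain \<epsilon> where \<epsilon>: "\<epsilon> > 0" "\<forall>a\<in>A. norm a < \<epsilon> \<longrightarrow> a \<in> V" by (elim exE conjE) (rule that)
  have VsubA: "v \<in> A" if v: "v \<in> V" for v
  proof -
    have "1 *\<^sub>R v \<in> A" using v unfolding V_def by blast
    then show ?thesis by simp
  qed
  have VLie: "v \<in> Lie" if "v \<in> V" for v using VsubA[OF that] unfolding A_def by simp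
  have VH': "torus_exp v \<in> H'" if "v \<in> V" for v using VsubA[OF that] unfolding A_def by simp
  have MV: "z \<in> V" if z: "z \<in> M" for z
  proof -
    have "t *\<^sub>R z \<in> A" for t :: real
      unfolding A_def using subspace_scale[OF subspace_M z, of t] MH' M_in_Lie by simp
    then show ?thesis unfolding V_def by simp
  qed
  have near: "\<exists>n. \<exists>v\<in>V. h n = torus_exp v" if h: "\<And>n. h n \<in> H'" "h \<longlonglongrightarrow> pone" for h
  proof -
    obtain a where a: "\<forall>n. a n \<in> Lie \<and> torus_exp (a n) = h n" "a \<longlonglongrightarrow> 0"
      using small_log[of h, OF H'D[OF h(1)] h(2)] by (elim exE conjE) (rule that)
    have "(\<lambda>n. norm (a n)) \<longlonglongrightarrow> 0" using tendsto_norm[OF a(2)] by simp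
    then have "\<forall>\<^sub>F n in sequentially. norm (a n) < \<epsilon>" using \<epsilon>(1) by (rule order_tendstoD)
    then obtain n where n: "norm (a n) < \<epsilon>" unfolding eventually_sequentially by blast
    have "a n \<in> A" unfolding A_def using a(1) h(1)[of n] by simp
    then have "a n \<in> V" using \<epsilon>(2) n by blast
    moreover have "h n = torus_exp (a n)" using a(1) by simp
    ultimately show ?thesis by (intro exI[of _ n] bexI[of _ "a n"])
  qed
  have Vops: "v + w \<in> V" "v - w \<in> V" if "v \<in> V" "w \<in> V" for v w
    using that subV by (auto intro: subspace_add subspace_diff)
  have closedH: "closed (torus_exp ` V)"
    unfolding closed_sequential_limits
  proof (intro allI impI)
    fix h l assume hl: "(\<forall>n. h n \<in> torus_exp ` V) \<and> h \<longlonglongrightarrow> l"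
    have hH': "h n \<in> H'" for n
    proof -
      obtain v where "v \<in> V" "h n = torus_exp v" using hl by blast
      then show ?thesis using VH' by simp
    qed
    have lH': "l \<in> H'"
      by (rule closed_sequentially[of H' h]) (use hl hH' in \<open>auto simp: H'_def\<close>)
    have lc: "l \<in> carrier (G \<sigma>)" by (rule D_UNIV_ops(4)[OF H'D[OF lH'] H'D[OF lH']])
    have "(\<lambda>n. padj l \<odot> h n) \<longlonglongrightarrow> padj l \<odot> l" using hl by (intro tendsto_intros) auto
    then have to1: "(\<lambda>n. padj l \<odot> h n) \<longlonglongrightarrow> pone" using padj_mult(1)[OF lc] by simp
    have "padj l \<odot> h n \<in> H'" for n by (intro H'mult H'inv lH' hH')
    from near[of "\<lambda>n. padj l \<odot> h n", OF this to1]
    obtain n v where nv: "v \<in> V" "padj l \<odot> h n = torus_exp v" by (elim exE bexE) (rule that)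
    obtain w where w: "w \<in> V" "h n = torus_exp w" using hl by auto
    have "l \<odot> torus_exp v = h n" unfolding nv(2)[symmetric] by (rule padj_mult_assoc(2)[OF lc])
    then have "l \<odot> (torus_exp v \<odot> torus_exp (- v)) = torus_exp w \<odot> torus_exp (- v)" unfolding w(2)[symmetric] by (simp only: pmult_assoc[symmetric])
    then have "l = torus_exp (w - v)" by (simp add: torus_exp_add[symmetric])
    then show "l \<in> torus_exp ` V" using Vops(2)[OF w(1) nv(1)] by simp
  qed
  have H'split: "\<exists>v\<in>V. \<exists>d\<in>\<Delta>. h = torus_exp v \<odot> d" if h: "h \<in> H'" for h
  proof -
    obtain s where s: "\<forall>n. s n \<in> S" "s \<longlonglongrightarrow> h" using h unfolding H'seq by (elim exE conjE) (rule that)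
    have hc: "h \<in> carrier (G \<sigma>)" by (rule D_UNIV_ops(4)[OF H'D[OF h] H'D[OF h]])
    have "(\<lambda>n. padj h \<odot> s n) \<longlonglongrightarrow> padj h \<odot> h" by (intro tendsto_intros s)
    then have to1: "(\<lambda>n. padj h \<odot> s n) \<longlonglongrightarrow> pone" using padj_mult(1)[OF hc] by simp
    have "padj h \<odot> s n \<in> H'" for n using s(1) by (intro H'mult H'inv h SH') simp
    from near[of "\<lambda>n. padj h \<odot> s n", OF this to1]
    obtain n v where nv: "v \<in> V" "padj h \<odot> s n = torus_exp v" by (elim exE bexE) (rule that)
    obtain z d where zd: "z \<in> M" "d \<in> \<Delta>" "s n = torus_exp z \<odot> d" using SE[of "s n"] s(1) by auto
    have eq: "h \<odot> torus_exp v = torus_exp z \<odot> d" unfolding nv(2)[symmetric] zd(3)[symmetric] by (rule padj_mult_assoc(2)[OF hc])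
    obtain w where w: "w \<in> Lie" "d = torus_exp w" using \<Delta>D[OF zd(2)] by (rule D_UNIV_E)
    have "h = (h \<odot> torus_exp v) \<odot> torus_exp (- v)" by (simp add: pmult_assoc torus_exp_add[symmetric])
    also have "\<dots> = torus_exp (z - v) \<odot> d" unfolding eq w torus_exp_add[symmetric] by (simp add: algebra_simps)
    finally show ?thesis using zd(2) Vops(2)[OF MV[OF zd(1)] nv(1)] by blast
  qed
  let ?W = "(\<lambda>(v, \<gamma>). torus_exp v \<odot> p \<odot> \<gamma>) ` (V \<times> \<Gamma> \<sigma>)"
  have "closure (Orb p) = ?W"
  proof
    show "?W \<subseteq> closure (Orb p)"
    proof
      fix y assume "y \<in> ?W"
      then obtain v \<gamma> where v: "v \<in> V" "\<gamma> \<in> \<Gamma> \<sigma>" "y = torus_exp v \<odot> p \<odot> \<gamma>" by auto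
      obtain s where s: "\<forall>n. s n \<in> S" "s \<longlonglongrightarrow> torus_exp v" using VH'[OF v(1)] unfolding H'seq by (elim exE conjE) (rule that)
      have "(\<lambda>n. s n \<odot> p \<odot> \<gamma>) \<longlonglongrightarrow> y" unfolding v(3) by (intro tendsto_intros s)
      moreover have "s n \<odot> p \<odot> \<gamma> \<in> Orb p" for n
      proof -
        obtain z d where zd: "z \<in> M" "d \<in> \<Delta>" "s n = torus_exp z \<odot> d" using SE[of "s n"] s(1) by auto
        obtain \<gamma>' where \<gamma>': "\<gamma>' \<in> \<Gamma> \<sigma>" "d \<odot> p = p \<odot> \<gamma>'" using \<Delta>E[OF zd(2)] by (elim bexE) (rule that)
        have "s n \<odot> p \<odot> \<gamma> = torus_exp z \<odot> p \<odot> (\<gamma>' \<odot> \<gamma>)" unfolding zd(3) using \<gamma>'(2) by (metis pmult_assoc)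
        then show ?thesis using OrbI[OF zd(1) \<Gamma>_closed(1)[OF \<gamma>'(1) v(2)]] by simp
      qed
      ultimately show "y \<in> closure (Orb p)" unfolding closure_sequential by (intro exI[of _ "\<lambda>n. s n \<odot> p \<odot> \<gamma>"]) simp
    qed
    show "closure (Orb p) \<subseteq> ?W"
    proof
      fix y assume "y \<in> closure (Orb p)"
      then obtain h where h: "\<forall>n. h n \<in> Orb p" "h \<longlonglongrightarrow> y" unfolding closure_sequential by (elim exE conjE) (rule that)
      have "\<exists>z B. z \<in> M \<and> B \<in> SLO \<and> h n = torus_exp z \<odot> p \<odot> emb B" for n
      proof -
        have "h n \<in> Orb p" using h(1) by simp
        then obtain z \<gamma> where z: "z \<in> M" "\<gamma> \<in> \<Gamma> \<sigma>" "h n = torus_exp z \<odot> p \<odot> \<gamma>" by (rule OrbE)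
        then obtain B where "B \<in> SLO" "\<gamma> = emb B" unfolding \<Gamma>_eq by blast
        then show ?thesis using z by (intro exI[of _ z] exI[of _ B]) simp
      qed
      then obtain z B where zB: "\<And>n. z n \<in> M" "\<And>n. B n \<in> SLO" "\<And>n. h n = torus_exp (z n) \<odot> p \<odot> emb (B n)" by metis
      define X where "X n = P ** B n" for n
      have embX: "emb (X n) = p \<odot> emb (B n)" for n by (simp add: X_def emb_mult p_def)
      have hX: "h n = torus_exp (z n) \<odot> emb (X n)" for n by (simp add: zB(3) embX pmult_assoc)
      have XSL: "X n \<in> SL2 UNIV" for n
        using P SLO_UNIV[OF zB(2)[of n]] by (simp add: X_def SL2_def det_mul)
      obtain m where m: "m \<noteq> 0" "\<forall>a b. algebraic_int (m * P $ a $ b)"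
        using matrix_common_denominator[of P] by (elim exE conjE) (rule that)
      have mX: "algebraic_int (m * X n $ a $ b)" for n a b
      proof -
        have "m * X n $ a $ b = m * P $ a $ 1 * B n $ 1 $ b + m * P $ a $ 2 * B n $ 2 $ b"
          by (simp add: X_def entry_mult_2 algebra_simps)
        moreover have "algebraic_int (B n $ c $ d)" for c d using zB(2)[of n] by (simp add: SL2_def)
        ultimately show ?thesis using m(2) by (simp add: algebraic_int_add algebraic_int_mult)
      qed
      define w where "w n a b = (m * X n $ 1 $ a) * (m * X n $ 2 $ b)" for n a b
      have "Bseq h" using h(2) convergent_imp_Bseq convergentI by blast
      then obtain R where R: "\<And>n. norm (h n) \<le> R" by (rule BseqE) blast
      define Q where "Q = (\<Sum>j\<in>UNIV. (cmod (\<sigma> j m))\<^sup>2) * (R * R)"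
      define F where "F = {\<alpha>. algebraic_int \<alpha> \<and> (\<forall>j. cmod (\<sigma> j \<alpha>) \<le> Q)}"
      have finF: "finite F" unfolding F_def by (rule finite_bounded_algebraic_ints)
      have wF: "w n a b \<in> F" for n a b
      proof -
        have "cmod (\<sigma> j (w n a b)) \<le> Q" for j
        proof -
          have e: "h n $ j $ 1 $ a = exp (z n $ j) * \<sigma> j (X n $ 1 $ a)" "h n $ j $ 2 $ b = exp (- (z n $ j)) * \<sigma> j (X n $ 2 $ b)"
            unfolding hX by (simp_all add: entry_mult_2)
          have "h n $ j $ 1 $ a * h n $ j $ 2 $ b = \<sigma> j (X n $ 1 $ a) * \<sigma> j (X n $ 2 $ b)"
            unfolding e by (simp add: exp_minus)
          then have "\<sigma> j (w n a b) = (\<sigma> j m)\<^sup>2 * (h n $ j $ 1 $ a * h n $ j $ 2 $ b)"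
            by (simp add: w_def power2_eq_square mult_ac)
          then have "cmod (\<sigma> j (w n a b)) = (cmod (\<sigma> j m))\<^sup>2 * (cmod (h n $ j $ 1 $ a) * cmod (h n $ j $ 2 $ b))"
            by (simp add: norm_mult norm_power)
          also have "\<dots> \<le> (\<Sum>j\<in>UNIV. (cmod (\<sigma> j m))\<^sup>2) * (R * R)"
          proof (intro mult_mono)
            show "(cmod (\<sigma> j m))\<^sup>2 \<le> (\<Sum>j\<in>UNIV. (cmod (\<sigma> j m))\<^sup>2)"
              by (rule member_le_sum[of j UNIV "\<lambda>j. (cmod (\<sigma> j m))\<^sup>2"]) auto
            show "cmod (h n $ j $ 1 $ a) \<le> R" "cmod (h n $ j $ 2 $ b) \<le> R"
              using entry_le_norm[of "h n"] R[of n] order.trans by blast+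
            show "0 \<le> R" using norm_ge_zero[of "h n"] R[of n] by linarith
          qed (auto intro: sum_nonneg)
          finally show ?thesis by (simp add: Q_def)
        qed
        moreover have "algebraic_int (w n a b)" unfolding w_def by (intro algebraic_int_mult mX)
        ultimately show ?thesis by (simp add: F_def)
      qed
      \<comment> \<open>The signs at the real places keep the quotient of two terms in the identity component of the diagonal group.\<close>
      define f where "f n = ((\<lambda>c. w n (fst c) (snd c)), (\<lambda>c. Re (\<sigma> (fst c) (X n $ 1 $ (snd c))) > 0))" for n
      have "range f \<subseteq> (\<Pi>\<^sub>E c\<in>(UNIV :: (2 \<times> 2) set). F) \<times> (UNIV :: ('r \<times> 2 \<Rightarrow> bool) set)"
        using wF by (auto simp: f_def)
      moreover have "finite ((\<Pi>\<^sub>E c\<in>(UNIV :: (2 \<times> 2) set). F) \<times> (UNIV :: ('r \<times> 2 \<Rightarrow> bool) set))"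
        using finF by (intro finite_cartesian_product finite_PiE) auto
      ultimately have "finite (range f)" by (rule finite_subset)
      from pigeonhole_infinite[OF infinite_UNIV_nat this]
      obtain n0 where "infinite {n \<in> UNIV. f n = f n0}" by blast
      then obtain r :: "nat \<Rightarrow> nat" where r: "strict_mono r" "\<forall>k. r k \<in> {n \<in> UNIV. f n = f n0}"
        using infinite_enumerate by blast
      define Y where "Y = X n0"
      have YSL: "Y \<in> SL2 UNIV" unfolding Y_def by (rule XSL)
      define \<delta> where "\<delta> k = X (r k) ** adj2 Y" for k
      have frk: "f (r k) = f n0" for k using r(2) by simp
      have prods: "X (r k) $ 1 $ a * X (r k) $ 2 $ b = Y $ 1 $ a * Y $ 2 $ b" for k a b
      proof -
        have "w (r k) a b = w n0 a b"
          using fun_cong[OF arg_cong[OF frk[of k], of fst], of "(a, b)"] by (simp add: f_def)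
        then have "(m * m) * (X (r k) $ 1 $ a * X (r k) $ 2 $ b) = (m * m) * (Y $ 1 $ a * Y $ 2 $ b)"
          by (simp add: w_def Y_def mult_ac)
        then show ?thesis using m(1) by simp
      qed
      have offdiag: "\<delta> k $ 1 $ 2 = 0" "\<delta> k $ 2 $ 1 = 0" for k
        unfolding \<delta>_def by (rule equal_row_products[OF XSL YSL prods])+
      have \<delta>Y: "\<delta> k ** Y = X (r k)" for k
      proof -
        have "Y $ 1 $ 1 * Y $ 2 $ 2 - Y $ 1 $ 2 * Y $ 2 $ 1 = 1" using YSL by (simp add: SL2_iff)
        then show ?thesis unfolding \<delta>_def matrix_mul_assoc[symmetric] by (simp add: adj2_mult)
      qed
      have det\<delta>: "\<delta> k $ 1 $ 1 * \<delta> k $ 2 $ 2 = 1" for k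
      proof -
        have "det (\<delta> k) * det Y = det (X (r k))" unfolding det_mul[symmetric] \<delta>Y ..
        then show ?thesis using XSL[of "r k"] YSL offdiag[of k] by (simp add: SL2_def det_2)
      qed
      have sgn: "(Re (\<sigma> j (X (r k) $ 1 $ a)) > 0) = (Re (\<sigma> j (Y $ 1 $ a)) > 0)" for k j a
        using fun_cong[OF arg_cong[OF frk[of k], of snd], of "(j, a)"] by (simp add: f_def Y_def)
      have \<delta>D: "emb (\<delta> k) \<in> D \<sigma> UNIV" for k
      proof -
        have "emb (\<delta> k) $ j \<in> diag_exp ` arch_completion (\<sigma> j)" for j
        proof -
          have d: "emb (\<delta> k) $ j $ 1 $ 2 = 0" "emb (\<delta> k) $ j $ 2 $ 1 = 0" "emb (\<delta> k) $ j $ 1 $ 1 * emb (\<delta> k) $ j $ 2 $ 2 = 1"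
            using offdiag[of k] arg_cong[OF det\<delta>[of k], of "\<sigma> j"] by simp_all
          show ?thesis
          proof (cases "range (\<sigma> j) \<subseteq> \<real>")
            case True
            have re: "\<sigma> j x = of_real (Re (\<sigma> j x))" for x
              using True by (metis of_real_Re rangeI subsetD)
            have "Y $ 1 $ 1 \<noteq> 0 \<or> Y $ 1 $ 2 \<noteq> 0" using YSL by (auto simp: SL2_iff)
            then obtain a where a: "Y $ 1 $ a \<noteq> 0" by blast
            have Xa: "X (r k) $ 1 $ a = \<delta> k $ 1 $ 1 * Y $ 1 $ a"
              unfolding \<delta>Y[symmetric, of k] by (simp add: entry_mult_2 offdiag)
            have nz: "Re (\<sigma> j (Y $ 1 $ a)) \<noteq> 0" using a re[of "Y $ 1 $ a"] by (metis \<sigma>_eq_0_iff of_real_0)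
            have "Re (\<sigma> j (X (r k) $ 1 $ a)) = Re (\<sigma> j (\<delta> k $ 1 $ 1)) * Re (\<sigma> j (Y $ 1 $ a))"
              unfolding Xa \<sigma>_simps by (subst re[of "\<delta> k $ 1 $ 1"], subst re[of "Y $ 1 $ a"]) (simp del: of_real_Re)
            then have "Re (\<sigma> j (\<delta> k $ 1 $ 1)) \<ge> 0"
              using sgn[of j k a] nz by (metis linorder_not_less mult_neg_neg mult_neg_pos not_less_iff_gr_or_eq)
            moreover have "Im (\<sigma> j (\<delta> k $ 1 $ 1)) = 0" using re[of "\<delta> k $ 1 $ 1"] by (metis Im_complex_of_real)
            ultimately have "emb (\<delta> k) $ j \<in> diag_exp ` \<real>" unfolding diag_exp_image_Reals using d by simp
            then show ?thesis using True by (simp add: arch_completion_eq)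
          next
            case False
            have "emb (\<delta> k) $ j \<in> diag_exp ` UNIV" unfolding diag_exp_image_UNIV using d by simp
            then show ?thesis using False by (simp add: arch_completion_eq)
          qed
        qed
        then show ?thesis by (simp add: D_def D_factor_eq)
      qed
      have YG: "emb Y \<in> carrier (G \<sigma>)" by (rule emb_carrier[OF YSL])
      have \<delta>Yemb: "emb (\<delta> k) \<odot> emb Y = emb (X (r k))" for k by (simp flip: emb_mult add: \<delta>Y)
      have B0: "emb (B n0) \<in> \<Gamma> \<sigma>" unfolding \<Gamma>_eq by (rule imageI[OF zB(2)])
      have \<delta>\<Delta>: "emb (\<delta> k) \<in> \<Delta>" for k
      proof (rule \<Delta>I[OF \<delta>D, of "emb (B (r k)) \<odot> padj (emb (B n0))"])
        have Bk: "emb (B (r k)) \<in> \<Gamma> \<sigma>" unfolding \<Gamma>_eq by (rule imageI[OF zB(2)])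
        show "emb (B (r k)) \<odot> padj (emb (B n0)) \<in> \<Gamma> \<sigma>" by (intro \<Gamma>_closed(1) \<Gamma>_closed(2) Bk B0)
        have "emb (\<delta> k) \<odot> p = emb (\<delta> k) \<odot> (p \<odot> emb (B n0)) \<odot> padj (emb (B n0))"
          using padj_mult(2)[OF \<Gamma>_carrier[OF B0]] by (simp add: pmult_assoc)
        also have "\<dots> = p \<odot> (emb (B (r k)) \<odot> padj (emb (B n0)))"
          using \<delta>Yemb[of k] by (simp add: Y_def embX pmult_assoc[symmetric])
        finally show "emb (\<delta> k) \<odot> p = p \<odot> (emb (B (r k)) \<odot> padj (emb (B n0)))" .
      qed
      have "(\<lambda>k. h (r k) \<odot> padj (emb Y)) \<longlonglongrightarrow> y \<odot> padj (emb Y)"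
        using LIMSEQ_subseq_LIMSEQ[OF h(2) r(1)] by (intro tendsto_intros) (simp add: o_def)
      moreover have "h (r k) \<odot> padj (emb Y) \<in> S" for k
      proof -
        have "h (r k) \<odot> padj (emb Y) = torus_exp (z (r k)) \<odot> emb (\<delta> k)"
          unfolding hX \<delta>Yemb[symmetric] using padj_mult(2)[OF YG] by (simp add: pmult_assoc)
        then show ?thesis using SI[OF zB(1) \<delta>\<Delta>] by simp
      qed
      ultimately have "y \<odot> padj (emb Y) \<in> H'" unfolding H'seq by (intro exI[of _ "\<lambda>k. h (r k) \<odot> padj (emb Y)"]) simp
      then obtain v d where vd: "v \<in> V" "d \<in> \<Delta>" "y \<odot> padj (emb Y) = torus_exp v \<odot> d" using H'split by blast
      obtain \<gamma> where \<gamma>: "\<gamma> \<in> \<Gamma> \<sigma>" "d \<odot> p = p \<odot> \<gamma>" using \<Delta>E[OF vd(2)] by (elim bexE) (rule that)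
      have "y = (y \<odot> padj (emb Y)) \<odot> emb Y" using padj_mult(1)[OF YG] by (simp add: pmult_assoc)
      also have "\<dots> = torus_exp v \<odot> (d \<odot> p) \<odot> emb (B n0)" unfolding vd(3) by (simp add: Y_def embX pmult_assoc)
      also have "\<dots> = torus_exp v \<odot> p \<odot> (\<gamma> \<odot> emb (B n0))" unfolding \<gamma>(2) by (simp add: pmult_assoc)
      finally have y: "y = (\<lambda>(v, \<gamma>). torus_exp v \<odot> p \<odot> \<gamma>) (v, \<gamma> \<odot> emb (B n0))" by simp
      show "y \<in> ?W" unfolding y by (rule imageI) (use vd(1) \<Gamma>_closed(1)[OF \<gamma>(1) B0] in simp)
    qed
  qed
  then show ?thesis
    using subV closedH VLie unfolding p_def by (intro exI[of _ V]) auto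
qed

end

section \<open>Orbits that do not return\<close>

lemma real_sequence_subsequence_cases:
  fixes x :: "nat \<Rightarrow> real"
  obtains r where "strict_mono (r :: nat \<Rightarrow> nat)" "filterlim (x \<circ> r) at_top sequentially"
  | r where "strict_mono (r :: nat \<Rightarrow> nat)" "filterlim (x \<circ> r) at_bot sequentially"
  | r C where "strict_mono (r :: nat \<Rightarrow> nat)" "\<And>k. \<bar>x (r k)\<bar> \<le> C"
proof -
  obtain l r where lr: "strict_mono (r :: nat \<Rightarrow> nat)" "((\<lambda>n. ereal (x n)) \<circ> r) \<longlonglongrightarrow> l"
    using compact_complete_linorder[of "\<lambda>n. ereal (x n)"] by (elim exE conjE) (rule that)
  show ?thesis
  proof (cases l)
    case (real c)
    then have "(\<lambda>k. x (r k)) \<longlonglongrightarrow> c" using lr(2) by (simp add: o_def)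
    then have "Bseq (\<lambda>k. x (r k))" using convergent_imp_Bseq convergentI by blast
    then obtain C where "\<And>k. norm (x (r k)) \<le> C" by (rule BseqE) blast
    then show ?thesis using that(3)[OF lr(1), of C] by simp
  next
    case PInf
    then have "filterlim (x \<circ> r) at_top sequentially"
      using lr(2) by (simp add: o_def tendsto_PInfty_eq_at_top)
    then show ?thesis using that(1)[OF lr(1)] by blast
  next
    case MInf
    then have "filterlim (x \<circ> r) at_bot sequentially"
      using lr(2) by (simp add: o_def tendsto_MInfty filterlim_at_bot_dense)
    then show ?thesis using that(2)[OF lr(1)] by blast
  qed
qed

lemma norm_row_scale: "cmod (row_scale a z) = exp (if a = 1 then Re z else - Re z)"
  by (simp add: row_scale_def)

lemma norm_pmult_le:
  fixes g h :: "complex^2^2^'r::finite"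
  shows "norm (g \<odot> h) \<le> CARD('r) * (4 * (2 * (norm g * norm h)))"
proof (rule norm_le_entries)
  fix i a b
  have "cmod ((g \<odot> h) $ i $ a $ b) \<le> cmod (g $ i $ a $ 1) * cmod (h $ i $ 1 $ b) + cmod (g $ i $ a $ 2) * cmod (h $ i $ 2 $ b)"
    unfolding pmult_nth entry_mult_2 by (rule order.trans[OF norm_triangle_ineq]) (simp add: norm_mult)
  also have "\<dots> \<le> norm g * norm h + norm g * norm h"
    by (intro add_mono mult_mono entry_le_norm) auto
  finally show "cmod ((g \<odot> h) $ i $ a $ b) \<le> 2 * (norm g * norm h)" by simp
qed

lemma row_scale_growth:
  fixes z :: "nat \<Rightarrow> complex"
  obtains r a where "strict_mono (r :: nat \<Rightarrow> nat)" "filterlim (\<lambda>k. cmod (row_scale a (z (r k)))) at_top sequentially"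
  | r C where "strict_mono (r :: nat \<Rightarrow> nat)" "\<And>k a. cmod (row_scale a (z (r k))) \<le> C"
proof (cases rule: real_sequence_subsequence_cases[of "\<lambda>k. Re (z k)"])
  case (1 r)
  have "filterlim (\<lambda>k. exp (Re (z (r k)))) at_top sequentially"
    using filterlim_compose[OF exp_at_top 1(2)] by (simp add: o_def)
  then show ?thesis using that(1)[OF 1(1), of 1] by (simp add: norm_row_scale)
next
  case (2 r)
  have "filterlim (\<lambda>k. - Re (z (r k))) at_top sequentially"
    using filterlim_compose[OF filterlim_uminus_at_top_at_bot 2(2)] by (simp add: o_def)
  then have "filterlim (\<lambda>k. exp (- Re (z (r k)))) at_top sequentially"
    by (rule filterlim_compose[OF exp_at_top])
  then show ?thesis using that(1)[OF 2(1), of 2] by (simp add: norm_row_scale)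
next
  case (3 r C)
  have "cmod (row_scale a (z (r k))) \<le> exp C" for a k
    using 3(2)[of k] by (auto simp: norm_row_scale abs_le_iff)
  then show ?thesis using that(2)[OF 3(1), of "exp C"] by blast
qed

lemma filterlim_subseq: "strict_mono (r :: nat \<Rightarrow> nat) \<Longrightarrow> filterlim f F sequentially \<Longrightarrow> filterlim (\<lambda>k. f (r k)) F sequentially"
  by (rule filterlim_compose[OF _ filterlim_subseq])

context arch_number_field
begin

lemma closed_\<Gamma>: "closed (\<Gamma> \<sigma>)"
  unfolding closed_sequential_limits
proof (intro allI impI)
  fix s l assume s: "(\<forall>n. s n \<in> \<Gamma> \<sigma>) \<and> s \<longlonglongrightarrow> l"
  then have "Bseq s" using convergent_imp_Bseq convergentI by blast
  then obtain R where R: "\<And>n. norm (s n) \<le> R" by (rule BseqE) blast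
  have "l \<in> {\<gamma> \<in> \<Gamma> \<sigma>. norm \<gamma> \<le> R}"
    by (rule closed_sequentially[OF finite_imp_closed[OF finite_bounded_\<Gamma>], of s]) (use s R in auto)
  then show "l \<in> \<Gamma> \<sigma>" by simp
qed

lemma right_invariant_mem:
  assumes S: "S \<subseteq> carrier (G \<sigma>)" "\<forall>s\<in>S. \<forall>\<gamma>\<in>\<Gamma> \<sigma>. s \<odot> \<gamma> \<in> S" and h: "h \<in> carrier (G \<sigma>)" "\<pi> \<sigma> h \<in> \<pi> \<sigma> ` S"
  shows "h \<in> S"
proof -
  obtain s where s: "s \<in> S" "\<pi> \<sigma> h = \<pi> \<sigma> s" using h(2) by (elim imageE) (rule that)
  have "s \<in> carrier (G \<sigma>)" using s(1) S(1) by blast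
  then obtain \<gamma> where "\<gamma> \<in> \<Gamma> \<sigma>" "h = s \<odot> \<gamma>" using s(2) \<pi>_eq_iff[OF h(1)] by auto
  then show ?thesis using S(2) s(1) by simp
qed

lemma closedin_\<pi>_image:
  assumes S: "S \<subseteq> carrier (G \<sigma>)" "\<forall>s\<in>S. \<forall>\<gamma>\<in>\<Gamma> \<sigma>. s \<odot> \<gamma> \<in> S" and "closed S"
  shows "closedin (quot_top \<sigma>) (\<pi> \<sigma> ` S)"
proof -
  have "{h \<in> topspace (top_G \<sigma>). \<pi> \<sigma> h \<in> \<pi> \<sigma> ` S} = S"
  proof
    show "{h \<in> topspace (top_G \<sigma>). \<pi> \<sigma> h \<in> \<pi> \<sigma> ` S} \<subseteq> S"
    proof
      fix h assume "h \<in> {h \<in> topspace (top_G \<sigma>). \<pi> \<sigma> h \<in> \<pi> \<sigma> ` S}"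
      then have "h \<in> carrier (G \<sigma>)" "\<pi> \<sigma> h \<in> \<pi> \<sigma> ` S" by auto
      then show "h \<in> S" by (rule right_invariant_mem[OF S])
    qed
  qed (use S(1) in auto)
  moreover have "closedin (top_G \<sigma>) S"
    using S(1) \<open>closed S\<close> by (simp add: closed_subset)
  moreover have "closedin (top_G \<sigma>) {h \<in> topspace (top_G \<sigma>). \<pi> \<sigma> h \<in> \<pi> \<sigma> ` S} \<longleftrightarrow> closedin (quot_top \<sigma>) (\<pi> \<sigma> ` S)"
  proof -
    have "\<pi> \<sigma> ` S \<subseteq> topspace (quot_top \<sigma>)"
      using S(1) by (simp add: topspace_quot_top image_mono)
    then show ?thesis using quotient_map_\<pi>[of \<sigma>] unfolding quotient_map_closedin by blast
  qed
  ultimately show ?thesis by simp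
qed

lemma torus_orbitI:
  assumes V: "subspace V" "V \<subseteq> Lie" "closed (torus_exp ` V)" and k: "k \<in> carrier (G \<sigma>)" and x: "x \<in> carrier (G \<sigma>)"
    and X: "X = (\<lambda>v. \<pi> \<sigma> (k \<odot> torus_exp v \<odot> padj k \<odot> x)) ` V"
  shows "torus_orbit \<sigma> X"
proof -
  let ?H = "torus_exp ` V"
  have HG: "?H \<subseteq> carrier (G \<sigma>)" using V(2) torus_exp_carrier by blast
  have "subgroup ?H (G \<sigma>)"
    unfolding subgroup_G_iff
  proof (intro conjI ballI HG)
    show "pone \<in> ?H" using subspace_0[OF V(1)] by (metis torus_exp_0 imageI)
    fix h assume "h \<in> ?H"
    then obtain v where v: "v \<in> V" "h = torus_exp v" by blast
    then show "padj h \<in> ?H" using subspace_neg[OF V(1)] by (simp add: padj_torus_exp)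
    fix h' assume "h' \<in> ?H"
    then obtain w where w: "w \<in> V" "h' = torus_exp w" by blast
    then show "h \<odot> h' \<in> ?H" using v subspace_add[OF V(1)] by (simp flip: torus_exp_add)
  qed
  moreover have "?H \<subseteq> D \<sigma> UNIV" unfolding D_UNIV using V(2) by (rule image_mono)
  moreover have "closedin (top_G \<sigma>) ?H" using HG V(3) by (simp add: closed_subset)
  moreover have "connected ?H"
    using continuous_on_torus_exp[OF continuous_on_id, of V] convex_connected[OF subspace_imp_convex[OF V(1)]]
    by (intro connected_continuous_image) auto
  ultimately have "torus \<sigma> ((\<lambda>h. k \<otimes>\<^bsub>G \<sigma>\<^esub> h \<otimes>\<^bsub>G \<sigma>\<^esub> inv\<^bsub>G \<sigma>\<^esub> k) ` ?H)"
    unfolding torus_def using k by (intro exI[of _ ?H] exI[of _ k]) simp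
  moreover have "X = coset_orbit \<sigma> ((\<lambda>h. k \<otimes>\<^bsub>G \<sigma>\<^esub> h \<otimes>\<^bsub>G \<sigma>\<^esub> inv\<^bsub>G \<sigma>\<^esub> k) ` ?H) (\<pi> \<sigma> x)"
    unfolding coset_orbit_eq X by (simp add: image_image G_simps(1) inv_G[OF k])
  moreover have "\<pi> \<sigma> x \<in> topspace (quot_top \<sigma>)" using x by (simp add: topspace_quot_top)
  ultimately show ?thesis unfolding torus_orbit_def by blast
qed

end

context torus_action
begin

definition recurrent :: "complex^2^2^'r \<Rightarrow> bool" where
  "recurrent g \<longleftrightarrow> (\<exists>z \<gamma>. (\<forall>k::nat. z k \<in> M \<and> \<gamma> k \<in> \<Gamma> \<sigma>) \<and>
     filterlim (\<lambda>k. norm (torus_exp (z k))) at_top sequentially \<and> (\<lambda>k. torus_exp (z k) \<odot> g \<odot> \<gamma> k) \<longlonglongrightarrow> g)"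

lemma eeM_carrier: "z \<in> M \<Longrightarrow> torus_exp z \<in> carrier (G \<sigma>)"
  by (intro torus_exp_carrier M_in_Lie)

lemma Orb_carrier:
  assumes "g \<in> carrier (G \<sigma>)"
  shows "Orb g \<subseteq> carrier (G \<sigma>)"
  by (auto elim!: OrbE simp: assms eeM_carrier \<Gamma>_carrier)

lemma closure_Orb_carrier: "g \<in> carrier (G \<sigma>) \<Longrightarrow> closure (Orb g) \<subseteq> carrier (G \<sigma>)"
  by (intro closure_minimal Orb_carrier closed_carrier_G)

lemma Orb_right:
  assumes "s \<in> Orb g" "\<gamma> \<in> \<Gamma> \<sigma>"
  shows "s \<odot> \<gamma> \<in> Orb g"
proof -
  obtain z \<gamma>' where "z \<in> M" "\<gamma>' \<in> \<Gamma> \<sigma>" "s = torus_exp z \<odot> g \<odot> \<gamma>'" using assms(1) by (rule OrbE)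
  then show ?thesis using OrbI[of z "\<gamma>' \<odot> \<gamma>" g] \<Gamma>_closed(1)[OF _ assms(2)] by (simp add: pmult_assoc)
qed

lemma Orb_left:
  assumes "s \<in> Orb g" "z \<in> M"
  shows "torus_exp z \<odot> s \<in> Orb g"
proof -
  obtain w \<gamma>' where "w \<in> M" "\<gamma>' \<in> \<Gamma> \<sigma>" "s = torus_exp w \<odot> g \<odot> \<gamma>'" using assms(1) by (rule OrbE)
  then show ?thesis using OrbI[of "z + w" \<gamma>' g] M_ops(1)[OF assms(2)] by (simp add: pmult_assoc torus_exp_add)
qed

lemma closure_Orb_right:
  assumes "s \<in> closure (Orb g)" "\<gamma> \<in> \<Gamma> \<sigma>"
  shows "s \<odot> \<gamma> \<in> closure (Orb g)"
proof -
  obtain f where f: "\<forall>n. f n \<in> Orb g" "f \<longlonglongrightarrow> s" using assms(1) unfolding closure_sequential by (elim exE conjE) (rule that)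
  have "(\<lambda>n. f n \<odot> \<gamma>) \<longlonglongrightarrow> s \<odot> \<gamma>" by (intro tendsto_intros f)
  moreover have "\<forall>n. f n \<odot> \<gamma> \<in> Orb g" using f(1) Orb_right assms(2) by simp
  ultimately show ?thesis unfolding closure_sequential by (intro exI[of _ "\<lambda>n. f n \<odot> \<gamma>"]) simp
qed

lemma mem_Orb: "g \<in> Orb g"
  using OrbI[OF M_ops(4) \<Gamma>_closed(3), of g] by simp

lemma boundary_right:
  assumes g: "g \<in> carrier (G \<sigma>)" and s: "s \<in> closure (Orb g) - Orb g" and \<gamma>: "\<gamma> \<in> \<Gamma> \<sigma>"
  shows "s \<odot> \<gamma> \<in> closure (Orb g) - Orb g"
proof -
  have "s \<in> Orb g" if "s \<odot> \<gamma> \<in> Orb g"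
    using Orb_right[OF that \<Gamma>_closed(2)[OF \<gamma>]] padj_mult(2)[OF \<Gamma>_carrier[OF \<gamma>]] by (simp add: pmult_assoc)
  then show ?thesis using s closure_Orb_right[OF _ \<gamma>] by blast
qed

lemma coset_orbit_Orb: "coset_orbit \<sigma> (torus_exp ` M) (\<pi> \<sigma> g) = \<pi> \<sigma> ` Orb g" if g: "g \<in> carrier (G \<sigma>)"
proof
  show "coset_orbit \<sigma> (torus_exp ` M) (\<pi> \<sigma> g) \<subseteq> \<pi> \<sigma> ` Orb g"
    unfolding coset_orbit_eq using OrbI[OF _ \<Gamma>_closed(3), of _ g] by auto
  show "\<pi> \<sigma> ` Orb g \<subseteq> coset_orbit \<sigma> (torus_exp ` M) (\<pi> \<sigma> g)"
  proof (rule image_subsetI)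
    fix s assume "s \<in> Orb g"
    then obtain z \<gamma> where z: "z \<in> M" "\<gamma> \<in> \<Gamma> \<sigma>" "s = torus_exp z \<odot> g \<odot> \<gamma>" by (rule OrbE)
    have "\<pi> \<sigma> s = \<pi> \<sigma> (torus_exp z \<odot> g)"
      using z g by (subst \<pi>_eq_iff) (auto simp: eeM_carrier \<Gamma>_carrier)
    then show "\<pi> \<sigma> s \<in> coset_orbit \<sigma> (torus_exp ` M) (\<pi> \<sigma> g)"
      unfolding coset_orbit_eq using z(1) by (intro image_eqI[of _ _ "torus_exp z"]) auto
  qed
qed

lemma orbit_closure_Orb:
  assumes g: "g \<in> carrier (G \<sigma>)"
  shows "orbit_closure \<sigma> (torus_exp ` M) (\<pi> \<sigma> g) = \<pi> \<sigma> ` closure (Orb g)"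
proof
  have "\<pi> \<sigma> ` Orb g \<subseteq> \<pi> \<sigma> ` closure (Orb g)" by (intro image_mono closure_subset)
  moreover have "closedin (quot_top \<sigma>) (\<pi> \<sigma> ` closure (Orb g))"
    by (rule closedin_\<pi>_image[OF closure_Orb_carrier[OF g] _ closed_closure]) (simp add: closure_Orb_right)
  ultimately show "orbit_closure \<sigma> (torus_exp ` M) (\<pi> \<sigma> g) \<subseteq> \<pi> \<sigma> ` closure (Orb g)"
    unfolding orbit_closure_def coset_orbit_Orb[OF g] by (rule closure_of_minimal)
  have "top_G \<sigma> closure_of Orb g = closure (Orb g)"
    using closure_Orb_carrier[OF g] Orb_carrier[OF g]
    by (simp add: closure_of_subtopology Int_absorb1 Int_absorb2)
  moreover have "\<pi> \<sigma> ` (top_G \<sigma> closure_of Orb g) \<subseteq> quot_top \<sigma> closure_of (\<pi> \<sigma> ` Orb g)"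
    by (rule continuous_map_image_closure_subset[OF quotient_imp_continuous_map[OF quotient_map_\<pi>]])
  ultimately show "\<pi> \<sigma> ` closure (Orb g) \<subseteq> orbit_closure \<sigma> (torus_exp ` M) (\<pi> \<sigma> g)"
    unfolding orbit_closure_def coset_orbit_Orb[OF g] by simp
qed

text \<open>A compact part of the torus and the discrete group \<open>\<Gamma> \<sigma>\<close> have a closed product.\<close>

lemma bounded_orbit_limit:
  assumes g: "g \<in> carrier (G \<sigma>)"
    and z: "\<And>k::nat. z k \<in> M" "\<And>k. norm (torus_exp (z k)) \<le> R" and \<gamma>: "\<And>k. \<gamma> k \<in> \<Gamma> \<sigma>"
    and lim: "(\<lambda>k. torus_exp (z k) \<odot> g \<odot> \<gamma> k) \<longlonglongrightarrow> y"
  shows "y \<in> Orb g"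
proof -
  have "compact (cball 0 R \<inter> torus_exp ` M)" by (intro compact_Int_closed closed_T compact_cball)
  moreover have "\<forall>k. torus_exp (z k) \<in> cball 0 R \<inter> torus_exp ` M" using z by simp
  ultimately obtain t r where tr: "t \<in> cball 0 R \<inter> torus_exp ` M" "strict_mono (r :: nat \<Rightarrow> nat)" "((\<lambda>k. torus_exp (z k)) \<circ> r) \<longlonglongrightarrow> t"
    unfolding compact_def by meson
  have t: "(\<lambda>k. torus_exp (z (r k))) \<longlonglongrightarrow> t" using tr(3) by (simp add: o_def)
  have y: "(\<lambda>k. torus_exp (z (r k)) \<odot> g \<odot> \<gamma> (r k)) \<longlonglongrightarrow> y"
    using LIMSEQ_subseq_LIMSEQ[OF lim tr(2)] by (simp add: o_def)
  have \<gamma>eq: "\<gamma> (r k) = padj g \<odot> (padj (torus_exp (z (r k))) \<odot> (torus_exp (z (r k)) \<odot> g \<odot> \<gamma> (r k)))" for k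
    by (simp add: pmult_assoc padj_mult_assoc(1)[OF eeM_carrier[OF z(1)]] padj_mult_assoc(1)[OF g])
  obtain w where w: "w \<in> M" "t = torus_exp w" using tr(1) by blast
  have "(\<lambda>k. padj g \<odot> (padj (torus_exp (z (r k))) \<odot> (torus_exp (z (r k)) \<odot> g \<odot> \<gamma> (r k)))) \<longlonglongrightarrow> padj g \<odot> (padj t \<odot> y)"
    by (intro tendsto_pmult tendsto_padj tendsto_const t y)
  then have "(\<lambda>k. \<gamma> (r k)) \<longlonglongrightarrow> padj g \<odot> (padj t \<odot> y)" by (simp only: \<gamma>eq[symmetric])
  then have "padj g \<odot> (padj t \<odot> y) \<in> \<Gamma> \<sigma>" by (rule closed_sequentially[OF closed_\<Gamma> \<gamma>])
  from OrbI[OF w(1) this, of g] show ?thesis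
    by (simp add: w(2) pmult_assoc padj_mult_assoc(2)[OF eeM_carrier[OF w(1)]] padj_mult_assoc(2)[OF g])
qed

text \<open>A boundary point near the orbit point \<open>l\<close> is, by \<open>bounded_orbit_limit\<close>, a limit of orbit points with large torus component.  A
  diagonal choice of such points converges to \<open>l\<close>, and moving \<open>l\<close> back to \<open>g\<close> shows that \<open>g\<close> is recurrent.\<close>

lemma closed_boundary:
  assumes g: "g \<in> carrier (G \<sigma>)" and nrec: "\<not> recurrent g"
  shows "closed (closure (Orb g) - Orb g)"
  unfolding closed_sequential_limits
proof (intro allI impI)
  fix y l assume yl: "(\<forall>n. y n \<in> closure (Orb g) - Orb g) \<and> y \<longlonglongrightarrow> l"
  have lcl: "l \<in> closure (Orb g)"
    by (rule closed_sequentially[OF closed_closure, of y]) (use yl in auto)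
  have "l \<notin> Orb g"
  proof
    assume "l \<in> Orb g"
    then obtain z0 \<gamma>0 where l: "z0 \<in> M" "\<gamma>0 \<in> \<Gamma> \<sigma>" "l = torus_exp z0 \<odot> g \<odot> \<gamma>0" by (rule OrbE)
    define Q where "Q n p \<longleftrightarrow> fst p \<in> M \<and> snd p \<in> \<Gamma> \<sigma> \<and> norm (torus_exp (fst p)) \<ge> real n \<and>
        dist (torus_exp (fst p) \<odot> g \<odot> snd p) (y n) < inverse (real (Suc n))" for n p
    have "\<exists>p. Q n p" for n
    proof (rule ccontr)
      assume no: "\<not> ?thesis"
      have small: "norm (torus_exp z) \<le> real n"
        if "z \<in> M" "\<gamma> \<in> \<Gamma> \<sigma>" "dist (torus_exp z \<odot> g \<odot> \<gamma>) (y n) < inverse (real (Suc n))" for z \<gamma>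
      proof (rule ccontr)
        assume "\<not> norm (torus_exp z) \<le> real n"
        then have "Q n (z, \<gamma>)" using that by (simp add: Q_def)
        then show False using no by blast
      qed
      have "y n \<in> closure (Orb g)" using yl by simp
      then obtain s where s: "\<forall>k. s k \<in> Orb g" "s \<longlonglongrightarrow> y n" unfolding closure_sequential by (elim exE conjE) (rule that)
      have "\<forall>\<^sub>F k in sequentially. dist (s k) (y n) < inverse (real (Suc n))"
        by (rule tendstoD[OF s(2)]) simp
      then obtain K where K: "\<And>k. k \<ge> K \<Longrightarrow> dist (s k) (y n) < inverse (real (Suc n))"
        unfolding eventually_sequentially by blast
      have "\<exists>z \<gamma>. z \<in> M \<and> \<gamma> \<in> \<Gamma> \<sigma> \<and> s k = torus_exp z \<odot> g \<odot> \<gamma>" for k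
      proof -
        have "s k \<in> Orb g" using s(1) by simp
        then obtain z \<gamma> where "z \<in> M" "\<gamma> \<in> \<Gamma> \<sigma>" "s k = torus_exp z \<odot> g \<odot> \<gamma>" by (rule OrbE)
        then show ?thesis by (intro exI conjI)
      qed
      then obtain z \<gamma> where zg: "\<And>k. z k \<in> M" "\<And>k. \<gamma> k \<in> \<Gamma> \<sigma>" "\<And>k. s k = torus_exp (z k) \<odot> g \<odot> \<gamma> k" by metis
      have b: "norm (torus_exp (z (k + K))) \<le> real n" for k
        using small[OF zg(1,2), of "k + K" "k + K"] K[of "k + K"] zg(3)[of "k + K"] by simp
      have "(\<lambda>k. s (k + K)) \<longlonglongrightarrow> y n" using s(2) by (rule LIMSEQ_ignore_initial_segment)
      then have "(\<lambda>k. torus_exp (z (k + K)) \<odot> g \<odot> \<gamma> (k + K)) \<longlonglongrightarrow> y n" by (simp only: zg(3))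
      then have "y n \<in> Orb g" by (rule bounded_orbit_limit[OF g zg(1) b zg(2)])
      then show False using yl by simp
    qed
    then obtain p where Qp: "\<And>n. Q n (p n)" by metis
    then have p: "fst (p n) \<in> M \<and> snd (p n) \<in> \<Gamma> \<sigma> \<and> norm (torus_exp (fst (p n))) \<ge> real n \<and>
        dist (torus_exp (fst (p n)) \<odot> g \<odot> snd (p n)) (y n) < inverse (real (Suc n))" for n
      by (simp add: Q_def)
    define z where "z n = fst (p n) - z0" for n
    define \<gamma> where "\<gamma> n = snd (p n) \<odot> padj \<gamma>0" for n
    define t where "t n = torus_exp (fst (p n)) \<odot> g \<odot> snd (p n)" for n
    have tl: "t \<longlonglongrightarrow> l"
    proof -
      have "(\<lambda>n. dist (t n) (y n)) \<longlonglongrightarrow> 0"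
        by (rule tendsto_sandwich[OF _ _ tendsto_const LIMSEQ_inverse_real_of_nat])
          (use p less_imp_le in \<open>auto simp: t_def intro!: always_eventually\<close>)
      moreover have "(\<lambda>n. dist (y n) l) \<longlonglongrightarrow> 0" using yl tendsto_dist_iff by blast
      ultimately have "(\<lambda>n. dist (t n) (y n) + dist (y n) l) \<longlonglongrightarrow> 0 + 0" by (rule tendsto_add)
      then have sum0: "(\<lambda>n. dist (t n) (y n) + dist (y n) l) \<longlonglongrightarrow> 0" by simp
      have "(\<lambda>n. dist (t n) l) \<longlonglongrightarrow> 0"
        by (rule tendsto_sandwich[OF _ _ tendsto_const sum0]) (auto intro!: always_eventually dist_triangle)
      then show ?thesis using tendsto_dist_iff by blast
    qed
    have "(\<lambda>n. torus_exp (- z0) \<odot> t n \<odot> padj \<gamma>0) \<longlonglongrightarrow> torus_exp (- z0) \<odot> l \<odot> padj \<gamma>0"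
      by (intro tendsto_pmult tendsto_const tl)
    also have "torus_exp (- z0) \<odot> l \<odot> padj \<gamma>0 = g"
      unfolding l(3) padj_torus_exp[symmetric] using padj_mult(2)[OF \<Gamma>_carrier[OF l(2)]]
      by (simp add: pmult_assoc padj_mult_assoc(1)[OF eeM_carrier[OF l(1)]])
    also have "(\<lambda>n. torus_exp (- z0) \<odot> t n \<odot> padj \<gamma>0) = (\<lambda>n. torus_exp (z n) \<odot> g \<odot> \<gamma> n)"
    proof
      fix n
      have "torus_exp (z n) = torus_exp (- z0) \<odot> torus_exp (fst (p n))" by (simp add: z_def flip: torus_exp_add)
      then show "torus_exp (- z0) \<odot> t n \<odot> padj \<gamma>0 = torus_exp (z n) \<odot> g \<odot> \<gamma> n"
        by (simp add: t_def \<gamma>_def pmult_assoc)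
    qed
    finally have lim: "(\<lambda>n. torus_exp (z n) \<odot> g \<odot> \<gamma> n) \<longlonglongrightarrow> g" .
    define C where "C = real CARD('r) * (4 * (2 * (norm (torus_exp z0) + 1)))"
    have C: "C > 0" by (simp add: C_def add_nonneg_pos)
    have big: "real n \<le> C * norm (torus_exp (z n))" for n
    proof -
      have "torus_exp (fst (p n)) = torus_exp z0 \<odot> torus_exp (z n)" by (simp add: z_def flip: torus_exp_add)
      then have "real n \<le> norm (torus_exp z0 \<odot> torus_exp (z n))" using p[of n] by simp
      also have "\<dots> \<le> CARD('r) * (4 * (2 * (norm (torus_exp z0) * norm (torus_exp (z n)))))" by (rule norm_pmult_le)
      also have "\<dots> \<le> CARD('r) * (4 * (2 * ((norm (torus_exp z0) + 1) * norm (torus_exp (z n)))))"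
        by (intro mult_left_mono mult_right_mono) auto
      finally show ?thesis by (simp add: C_def mult_ac)
    qed
    have "filterlim (\<lambda>n. norm (torus_exp (z n))) at_top sequentially"
      unfolding filterlim_at_top
    proof
      fix Z :: real
      have "\<forall>\<^sub>F n in sequentially. C * Z \<le> real n"
        using filterlim_real_sequentially unfolding filterlim_at_top by blast
      then show "\<forall>\<^sub>F n in sequentially. Z \<le> norm (torus_exp (z n))"
      proof eventually_elim
        case (elim n)
        then have "C * Z \<le> C * norm (torus_exp (z n))" using big[of n] by linarith
        then show ?case using C by simp
      qed
    qed
    moreover have "z n \<in> M \<and> \<gamma> n \<in> \<Gamma> \<sigma>" for n
      unfolding z_def \<gamma>_def using p[of n] l(1,2) by (intro conjI M_ops(3) \<Gamma>_closed(1) \<Gamma>_closed(2)) auto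
    ultimately have "recurrent g" unfolding recurrent_def using lim by (intro exI[of _ z] exI[of _ \<gamma>]) simp
    then show False using nrec by simp
  qed
  then show "l \<in> closure (Orb g) - Orb g" using lcl by simp
qed

text \<open>On a subsequence each active component of the torus element is bounded or stretches one of the two rows without bound.  Not both are
  bounded, and if just one is, the vector that it contracts contradicts the product inequality.\<close>

lemma recurrent_imp_rational:
  assumes g: "g \<in> carrier (G \<sigma>)" and rec: "recurrent g" and I: "I = {i, i'}" "i \<noteq> i'"
    and rat: "\<forall>j\<in>I. \<forall>a. \<exists>x y. algebraic_int x \<and> algebraic_int y \<and> (x \<noteq> 0 \<or> y \<noteq> 0) \<and> row_form g j a x y = 0"
  shows "\<exists>q\<in>SL2 UNIV. \<forall>j\<in>I. monomial2 ((g \<odot> emb q) $ j)"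
proof -
  obtain z0 \<gamma>0 where zg: "\<forall>k::nat. z0 k \<in> M \<and> \<gamma>0 k \<in> \<Gamma> \<sigma>"
    "filterlim (\<lambda>k. norm (torus_exp (z0 k))) at_top sequentially" "(\<lambda>k. torus_exp (z0 k) \<odot> g \<odot> \<gamma>0 k) \<longlonglongrightarrow> g"
    using rec unfolding recurrent_def by (elim exE conjE) (rule that)
  have "\<exists>B. B \<in> SLO \<and> \<gamma>0 k = emb B" for k using zg(1) unfolding \<Gamma>_eq by blast
  then obtain B0 where B0: "\<And>k. B0 k \<in> SLO" "\<And>k. \<gamma>0 k = emb (B0 k)" by metis
  define grows where "grows j r \<longleftrightarrow> (\<exists>a. filterlim (\<lambda>k. cmod (row_scale a (z0 (r k) $ j))) at_top sequentially) \<or>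
      (\<exists>C. \<forall>k a. cmod (row_scale a (z0 (r k) $ j)) \<le> C)" for j and r :: "nat \<Rightarrow> nat"
  have sub: "\<exists>s. strict_mono (s :: nat \<Rightarrow> nat) \<and> grows j (\<lambda>k. r (s k))" for j r
  proof (cases rule: row_scale_growth[of "\<lambda>k. z0 (r k) $ j"])
    case (1 s a)
    then show ?thesis unfolding grows_def by (intro exI[of _ s] conjI disjI1 exI[of _ a])
  next
    case (2 s C)
    then show ?thesis unfolding grows_def by (intro exI[of _ s] conjI disjI2 exI[of _ C] allI)
  qed
  obtain r1 where r1: "strict_mono (r1 :: nat \<Rightarrow> nat)" "grows i r1" using sub[of i "\<lambda>k. k"] by auto
  obtain r2 where r2: "strict_mono (r2 :: nat \<Rightarrow> nat)" "grows i' (\<lambda>k. r1 (r2 k))" using sub[of i' r1] by auto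
  define r where "r k = r1 (r2 k)" for k
  have r: "strict_mono r" unfolding r_def using r1(1) r2(1) by (simp add: strict_mono_def)
  have gi': "grows i' r" using r2(2) by (simp add: r_def[abs_def])
  have gi: "grows i r"
    using r1(2) unfolding grows_def r_def
  proof (elim disjE exE)
    fix a assume "filterlim (\<lambda>k. cmod (row_scale a (z0 (r1 k) $ i))) at_top sequentially"
    from filterlim_subseq[OF r2(1) this]
    show "(\<exists>a. filterlim (\<lambda>k. cmod (row_scale a (z0 (r1 (r2 k)) $ i))) at_top sequentially) \<or>
      (\<exists>C. \<forall>k a. cmod (row_scale a (z0 (r1 (r2 k)) $ i)) \<le> C)" by (intro disjI1 exI)
  next
    fix C assume "\<forall>k a. cmod (row_scale a (z0 (r1 k) $ i)) \<le> C"
    then show "(\<exists>a. filterlim (\<lambda>k. cmod (row_scale a (z0 (r1 (r2 k)) $ i))) at_top sequentially) \<or>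
      (\<exists>C. \<forall>k a. cmod (row_scale a (z0 (r1 (r2 k)) $ i)) \<le> C)" by (intro disjI2 exI[of _ C]) simp
  qed
  define z where "z k = z0 (r k)" for k
  define B where "B k = B0 (r k)" for k
  have zM: "z k \<in> M" for k using zg(1) by (simp add: z_def)
  have supp: "\<forall>k j. j \<noteq> i \<longrightarrow> j \<noteq> i' \<longrightarrow> z k $ j = 0" using M_supp[OF zM] I(1) by simp
  have supp': "\<forall>k j. j \<noteq> i' \<longrightarrow> j \<noteq> i \<longrightarrow> z k $ j = 0" using supp by blast
  interpret R: recurrent_sequence \<sigma> g z B
  proof
    show "(\<lambda>k. torus_exp (z k) \<odot> g \<odot> emb (B k)) \<longlonglongrightarrow> g"
      using filterlim_subseq[OF r zg(3)] by (simp add: z_def B_def B0(2))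
  qed (use g zM eeM_carrier B0(1) in \<open>auto simp: B_def\<close>)
  have E: "R.E a k j = row_scale a (z0 (r k) $ j)" for a k j by (simp add: R.E_def z_def)
  have top: "filterlim (\<lambda>k. norm (torus_exp (z k))) at_top sequentially"
    unfolding z_def by (rule filterlim_subseq[OF r zg(2)])
  have Wbound: "\<forall>\<^sub>F k in sequentially. R.W x y k j \<le> C * cmod (row_form g j 1 x y) + C * cmod (row_form g j 2 x y)"
    if "\<forall>k a. cmod (row_scale a (z0 (r k) $ j)) \<le> C" for x y j C
    using that by (intro always_eventually allI) (auto simp: R.W_def E intro!: add_mono mult_right_mono)
  obtain v where v: "\<And>j a. j \<in> I \<Longrightarrow> algebraic_int (fst (v j a)) \<and> algebraic_int (snd (v j a)) \<and>
      (fst (v j a) \<noteq> 0 \<or> snd (v j a) \<noteq> 0) \<and> row_form g j a (fst (v j a)) (snd (v j a)) = 0"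
  proof -
    have "\<forall>j a. \<exists>p. j \<in> I \<longrightarrow> algebraic_int (fst p) \<and> algebraic_int (snd p) \<and>
      (fst p \<noteq> 0 \<or> snd p \<noteq> 0) \<and> row_form g j a (fst p) (snd p) = 0"
    proof (intro allI)
      fix j a
      show "\<exists>p. j \<in> I \<longrightarrow> algebraic_int (fst p) \<and> algebraic_int (snd p) \<and>
        (fst p \<noteq> 0 \<or> snd p \<noteq> 0) \<and> row_form g j a (fst p) (snd p) = 0"
      proof (cases "j \<in> I")
        case True
        obtain x y where "algebraic_int x \<and> algebraic_int y \<and> (x \<noteq> 0 \<or> y \<noteq> 0) \<and> row_form g j a x y = 0"
          using bspec[OF rat True, THEN spec[of _ a]] by (elim exE) (rule that)
        then show ?thesis by (intro exI[of _ "(x, y)"]) simp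
      qed simp
    qed
    then show ?thesis using that by metis
  qed
  have iI: "i \<in> I" "i' \<in> I" using I(1) by auto
  from gi gi' show ?thesis
    unfolding grows_def
  proof (elim disjE exE)
    fix a a'
    assume a: "filterlim (\<lambda>k. cmod (row_scale a (z0 (r k) $ i))) at_top sequentially"
      and a': "filterlim (\<lambda>k. cmod (row_scale a' (z0 (r k) $ i'))) at_top sequentially"
    have "\<exists>q\<in>SL2 UNIV. monomial2 ((g \<odot> emb q) $ i) \<and> monomial2 ((g \<odot> emb q) $ i')"
      by (rule R.expanding_both_imp_monomial[OF I(2) supp, of a a' "fst (v i a)" "snd (v i a)" "fst (v i' a')" "snd (v i' a')"])
        (use a a' v[OF iI(1), of a] v[OF iI(2), of a'] in \<open>simp_all add: E\<close>)
    then show ?thesis unfolding I(1) by simp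
  next
    fix a C
    assume a: "filterlim (\<lambda>k. cmod (row_scale a (z0 (r k) $ i))) at_top sequentially"
      and C: "\<forall>k a. cmod (row_scale a (z0 (r k) $ i')) \<le> C"
    have False
      by (rule R.contracted_vector_contradiction[OF I(2) supp _ _ _ _ _ Wbound[OF C], of "fst (v i a)" "snd (v i a)" a])
        (use a v[OF iI(1), of a] in \<open>simp_all add: E\<close>)
    then show ?thesis ..
  next
    fix C a
    assume a: "filterlim (\<lambda>k. cmod (row_scale a (z0 (r k) $ i'))) at_top sequentially"
      and C: "\<forall>k a. cmod (row_scale a (z0 (r k) $ i)) \<le> C"
    have False
      by (rule R.contracted_vector_contradiction[OF I(2)[symmetric] supp' _ _ _ _ _ Wbound[OF C], of "fst (v i' a)" "snd (v i' a)" a])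
        (use a v[OF iI(2), of a] in \<open>simp_all add: E\<close>)
    then show ?thesis ..
  next
    fix C C'
    assume C: "\<forall>k a. cmod (row_scale a (z0 (r k) $ i)) \<le> C" and C': "\<forall>k a. cmod (row_scale a (z0 (r k) $ i')) \<le> C'"
    define m where "m = max 1 (max C C')"
    have "cmod (torus_exp (z k) $ j $ a $ b) \<le> m" for k j a b
    proof -
      have "torus_exp (z k) $ j $ a $ b = row_scale a (z k $ j) * mat 1 $ a $ b"
        using diag_exp_mult_entry[of "z k $ j" "mat 1" a b] by simp
      moreover have "cmod (mat 1 $ a $ b :: complex) \<le> 1" by (simp add: mat_def)
      moreover have "cmod (row_scale a (z k $ j)) \<le> m"
      proof (cases "j = i \<or> j = i'")
        case True
        then show ?thesis using C C' unfolding m_def z_def by (auto simp: le_max_iff_disj)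
      next
        case False
        then have "z k $ j = 0" using supp by simp
        then show ?thesis by (simp add: row_scale_def m_def)
      qed
      ultimately show ?thesis
        using mult_mono[of "cmod (row_scale a (z k $ j))" m "cmod (mat 1 $ a $ b)" 1]
        by (simp add: norm_mult m_def)
    qed
    then have bound: "norm (torus_exp (z k)) \<le> CARD('r) * (4 * m)" for k by (rule norm_le_entries)
    have "\<forall>\<^sub>F k in sequentially. CARD('r) * (4 * m) + 1 \<le> norm (torus_exp (z k))"
      using top unfolding filterlim_at_top by blast
    then obtain k where "CARD('r) * (4 * m) + 1 \<le> norm (torus_exp (z k))"
      unfolding eventually_sequentially by blast
    then have False using bound[of k] by linarith
    then show ?thesis ..
  qed
qed

text \<open>Write \<open>g = k p\<close> with \<open>p\<close> rational and \<open>k\<close> monomial at the active places.  Then \<open>k\<close> normalises the torus, and the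
  closure is \<open>k\<close> times the closure of the orbit through \<open>p\<close>.\<close>

lemma rational_imp_torus_orbit:
  assumes g: "g \<in> carrier (G \<sigma>)" and q: "q \<in> SL2 UNIV" and mono: "\<And>j. j \<in> I \<Longrightarrow> monomial2 ((g \<odot> emb q) $ j)"
  shows "torus_orbit \<sigma> (orbit_closure \<sigma> (torus_exp ` M) (\<pi> \<sigma> g))"
proof -
  define k where "k = g \<odot> emb q"
  have qc: "emb q \<in> carrier (G \<sigma>)" by (rule emb_carrier[OF q])
  have k: "k \<in> carrier (G \<sigma>)" using g qc by (simp add: k_def)
  define P where "P = adj2 q"
  have P: "P \<in> SL2 UNIV" using q by (simp add: P_def SL2_iff mult.commute)
  have gk: "g = k \<odot> emb P"
    unfolding k_def P_def emb_adj2 using padj_mult(2)[OF qc] by (simp add: pmult_assoc)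
  define fl where "fl z = (\<chi> j. if (k $ j $ 1 $ 2 = 0 \<and> k $ j $ 2 $ 1 = 0) = False then - z $ j else z $ j)" for z :: "complex^'r"
  have flM: "fl z \<in> M" if "z \<in> M" for z unfolding fl_def by (rule M_flip[OF that])
  have comm: "torus_exp z \<odot> k = k \<odot> torus_exp (fl z)" if z: "z \<in> M" for z
  proof -
    have "diag_exp (z $ j) ** k $ j = k $ j ** diag_exp (fl z $ j)" for j
    proof (cases "j \<in> I")
      case True
      then show ?thesis using mono[OF True] unfolding k_def[symmetric] monomial2_def fl_def
        by (intro matrix_2_eqI) (auto simp: entry_mult_2 mult.commute)
    next
      case False
      then have "z $ j = 0" by (rule M_supp[OF z])
      then show ?thesis by (simp add: fl_def)
    qed
    then show ?thesis by (simp add: vec_eq_iff[of "torus_exp z \<odot> k"])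
  qed
  have flfl: "fl (fl z) = z" for z by (simp add: fl_def vec_eq_iff)
  obtain V where V: "subspace V" "V \<subseteq> Lie" "closed (torus_exp ` V)"
    "closure (Orb (emb P)) = (\<lambda>(v, \<gamma>). torus_exp v \<odot> emb P \<odot> \<gamma>) ` (V \<times> \<Gamma> \<sigma>)"
    using rational_torus_orbit_closure[OF P] by (elim exE conjE) (rule that)
  have kinv: "padj k \<odot> (k \<odot> h) = h" "k \<odot> (padj k \<odot> h) = h" for h by (rule padj_mult_assoc[OF k])+
  have Orbg: "Orb g = (\<lambda>h. k \<odot> h) ` Orb (emb P)"
  proof
    show "Orb g \<subseteq> (\<lambda>h. k \<odot> h) ` Orb (emb P)"
    proof
      fix s assume "s \<in> Orb g"
      then obtain z \<gamma> where z: "z \<in> M" "\<gamma> \<in> \<Gamma> \<sigma>" "s = torus_exp z \<odot> g \<odot> \<gamma>" by (rule OrbE)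
      have "s = k \<odot> (torus_exp (fl z) \<odot> emb P \<odot> \<gamma>)"
        unfolding z(3) gk using comm[OF z(1)] by (metis pmult_assoc)
      then show "s \<in> (\<lambda>h. k \<odot> h) ` Orb (emb P)" using OrbI[OF flM[OF z(1)] z(2), of "emb P"] by blast
    qed
    show "(\<lambda>h. k \<odot> h) ` Orb (emb P) \<subseteq> Orb g"
    proof (rule image_subsetI)
      fix s assume "s \<in> Orb (emb P)"
      then obtain z \<gamma> where z: "z \<in> M" "\<gamma> \<in> \<Gamma> \<sigma>" "s = torus_exp z \<odot> emb P \<odot> \<gamma>" by (rule OrbE)
      have "k \<odot> s = torus_exp (fl z) \<odot> g \<odot> \<gamma>"
        unfolding z(3) gk using comm[OF flM[OF z(1)]] flfl[of z] by (metis pmult_assoc)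
      then show "k \<odot> s \<in> Orb g" using OrbI[OF flM[OF z(1)] z(2), of g] by simp
    qed
  qed
  have clos: "closure (Orb g) = (\<lambda>h. k \<odot> h) ` closure (Orb (emb P))"
  proof
    have cont: "continuous_on A (\<lambda>h. c \<odot> h)" for A and c :: "complex^2^2^'r"
      by (intro continuous_on_pmult continuous_on_const continuous_on_id)
    have "(\<lambda>h. k \<odot> h) ` closure (Orb (emb P)) = (\<lambda>h. padj k \<odot> h) -` closure (Orb (emb P))"
    proof
      show "(\<lambda>h. k \<odot> h) ` closure (Orb (emb P)) \<subseteq> (\<lambda>h. padj k \<odot> h) -` closure (Orb (emb P))"
        using kinv(1) by auto
      show "(\<lambda>h. padj k \<odot> h) -` closure (Orb (emb P)) \<subseteq> (\<lambda>h. k \<odot> h) ` closure (Orb (emb P))"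
      proof
        fix h assume "h \<in> (\<lambda>h. padj k \<odot> h) -` closure (Orb (emb P))"
        then have "k \<odot> (padj k \<odot> h) \<in> (\<lambda>h. k \<odot> h) ` closure (Orb (emb P))" by (intro imageI) simp
        then show "h \<in> (\<lambda>h. k \<odot> h) ` closure (Orb (emb P))" unfolding kinv(2) .
      qed
    qed
    moreover have "closed ((\<lambda>h. padj k \<odot> h) -` closure (Orb (emb P)))"
      using cont[of UNIV "padj k"] by (intro continuous_closed_vimage closed_closure) (simp add: continuous_on_eq_continuous_at)
    ultimately have "closed ((\<lambda>h. k \<odot> h) ` closure (Orb (emb P)))" by simp
    then show "closure (Orb g) \<subseteq> (\<lambda>h. k \<odot> h) ` closure (Orb (emb P))"
      unfolding Orbg by (intro closure_minimal image_mono closure_subset)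
    show "(\<lambda>h. k \<odot> h) ` closure (Orb (emb P)) \<subseteq> closure (Orb g)"
      unfolding Orbg by (rule image_closure_subset[OF cont closed_closure closure_subset])
  qed
  have "\<pi> \<sigma> ` closure (Orb g) = (\<lambda>v. \<pi> \<sigma> (k \<odot> torus_exp v \<odot> padj k \<odot> g)) ` V"
  proof -
    have mem: "\<pi> \<sigma> (k \<odot> (torus_exp v \<odot> emb P \<odot> \<gamma>)) = \<pi> \<sigma> (k \<odot> torus_exp v \<odot> padj k \<odot> g)" if v: "v \<in> V" and \<gamma>: "\<gamma> \<in> \<Gamma> \<sigma>" for v \<gamma>
    proof -
      have e: "k \<odot> (torus_exp v \<odot> emb P \<odot> \<gamma>) = (k \<odot> torus_exp v \<odot> padj k \<odot> g) \<odot> \<gamma>"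
        by (simp add: gk pmult_assoc kinv)
      have vc: "torus_exp v \<in> carrier (G \<sigma>)" using v V(2) torus_exp_carrier by blast
      show ?thesis
        unfolding e by (subst \<pi>_eq_iff) (use \<gamma> k g vc \<Gamma>_carrier[OF \<gamma>] in \<open>auto intro!: bexI[of _ \<gamma>]\<close>)
    qed
    have "\<pi> \<sigma> ` closure (Orb g) = (\<lambda>(v, \<gamma>). \<pi> \<sigma> (k \<odot> (torus_exp v \<odot> emb P \<odot> \<gamma>))) ` (V \<times> \<Gamma> \<sigma>)"
      unfolding clos V(4) by (simp add: image_image split_def)
    also have "\<dots> = (\<lambda>(v, \<gamma>). \<pi> \<sigma> (k \<odot> torus_exp v \<odot> padj k \<odot> g)) ` (V \<times> \<Gamma> \<sigma>)"
      by (intro image_cong refl) (auto simp: mem)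
    also have "\<dots> = (\<lambda>v. \<pi> \<sigma> (k \<odot> torus_exp v \<odot> padj k \<odot> g)) ` (fst ` (V \<times> \<Gamma> \<sigma>))"
      by (simp only: image_image split_def)
    also have "fst ` (V \<times> \<Gamma> \<sigma>) = V" using \<Gamma>_closed(3) by (metis empty_iff fst_image_times)
    finally show ?thesis .
  qed
  then show ?thesis
    unfolding orbit_closure_Orb[OF g] by (rule torus_orbitI[OF V(1-3) k g])
qed

lemma closed_orbit_imp_torus_orbit:
  assumes g: "g \<in> carrier (G \<sigma>)" and eq: "orbit_closure \<sigma> (torus_exp ` M) (\<pi> \<sigma> g) = coset_orbit \<sigma> (torus_exp ` M) (\<pi> \<sigma> g)"
  shows "torus_orbit \<sigma> (orbit_closure \<sigma> (torus_exp ` M) (\<pi> \<sigma> g))"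
proof (rule torus_orbitI[OF subspace_M M_Lie closed_T pone_carrier g])
  have "padj pone = (pone :: complex^2^2^'r)" using padj_mult(2)[OF pone_carrier] by simp
  then show "orbit_closure \<sigma> (torus_exp ` M) (\<pi> \<sigma> g) = (\<lambda>v. \<pi> \<sigma> (pone \<odot> torus_exp v \<odot> padj pone \<odot> g)) ` M"
    unfolding eq coset_orbit_eq by (simp add: image_image)
qed

text \<open>If the closure is the orbit of \<open>F\<close>, an element \<open>f\<close> of \<open>F\<close> near the identity moves \<open>g\<close> to a point of the orbit, so \<open>f\<close> is
  \<open>t g \<gamma> g\<inverse>\<close> with \<open>t\<close> in the torus; as \<open>g\<close> is not recurrent, \<open>t\<close> is bounded, \<open>\<gamma>\<close> takes finitely many values, and
  \<open>f\<close> lies in the torus.  So the torus is open in \<open>F\<close>, and being connected it is normal in \<open>F\<close>.  For a point \<open>f g\<close> of the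
  closure, the open orbit through it meets the dense orbit through \<open>g\<close>, and the two coincide: the orbit is closed.\<close>

lemma open_orbit_not_homogeneous:
  assumes g: "g \<in> carrier (G \<sigma>)" and bd: "closed (closure (Orb g) - Orb g)" and nrec: "\<not> recurrent g"
    and proper: "coset_orbit \<sigma> (torus_exp ` M) (\<pi> \<sigma> g) \<noteq> orbit_closure \<sigma> (torus_exp ` M) (\<pi> \<sigma> g)"
  shows "\<not> homogeneous_closure \<sigma> (torus_exp ` M) (\<pi> \<sigma> g)"
proof
  assume "homogeneous_closure \<sigma> (torus_exp ` M) (\<pi> \<sigma> g)"
  then obtain F where F: "subgroup F (G \<sigma>)" "torus_exp ` M \<subseteq> F" "orbit_closure \<sigma> (torus_exp ` M) (\<pi> \<sigma> g) = coset_orbit \<sigma> F (\<pi> \<sigma> g)"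
    unfolding homogeneous_closure_def by (elim exE conjE) (rule that)
  have Fc: "f \<in> carrier (G \<sigma>)" if "f \<in> F" for f using F(1) that unfolding subgroup_G_iff by blast
  have Fmult: "f \<odot> f' \<in> F" if "f \<in> F" "f' \<in> F" for f f' using F(1) that unfolding subgroup_G_iff by simp
  have Finv: "padj f \<in> F" if "f \<in> F" for f using F(1) that unfolding subgroup_G_iff by simp
  have TF: "torus_exp z \<in> F" if "z \<in> M" for z using F(2) that by blast
  let ?Z = "Orb g" and ?C = "closure (Orb g)"
  have Ceq: "\<pi> \<sigma> ` ?C = (\<lambda>f. \<pi> \<sigma> (f \<odot> g)) ` F"
    using F(3) unfolding orbit_closure_Orb[OF g] coset_orbit_eq .
  have fgC: "f \<odot> g \<in> ?C" if f: "f \<in> F" for f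
  proof (rule right_invariant_mem[OF closure_Orb_carrier[OF g]])
    show "\<forall>s\<in>?C. \<forall>\<gamma>\<in>\<Gamma> \<sigma>. s \<odot> \<gamma> \<in> ?C" by (simp add: closure_Orb_right)
    show "f \<odot> g \<in> carrier (G \<sigma>)" using Fc[OF f] g by simp
    show "\<pi> \<sigma> (f \<odot> g) \<in> \<pi> \<sigma> ` ?C" unfolding Ceq using f by (rule imageI)
  qed
  have CE: "\<exists>f\<in>F. \<exists>\<gamma>\<in>\<Gamma> \<sigma>. y = f \<odot> g \<odot> \<gamma>" if y: "y \<in> ?C" for y
  proof -
    have yc: "y \<in> carrier (G \<sigma>)" using y closure_Orb_carrier[OF g] by blast
    have "\<pi> \<sigma> y \<in> (\<lambda>f. \<pi> \<sigma> (f \<odot> g)) ` F" unfolding Ceq[symmetric] using y by (rule imageI)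
    then obtain f where f: "f \<in> F" "\<pi> \<sigma> y = \<pi> \<sigma> (f \<odot> g)" by (elim imageE) (rule that)
    have "f \<odot> g \<in> carrier (G \<sigma>)" using Fc[OF f(1)] g by simp
    then show ?thesis using f \<pi>_eq_iff[OF yc] by auto
  qed
  have escape: "\<exists>n. s n \<in> ?Z" if s: "\<And>n::nat. s n \<in> ?C" "s \<longlonglongrightarrow> l" "l \<in> ?Z" for s l
  proof (rule ccontr)
    assume "\<not> (\<exists>n. s n \<in> ?Z)"
    then have "\<And>n. s n \<in> ?C - ?Z" using s(1) by blast
    from closed_sequentially[OF bd this s(2)] s(3) show False by simp
  qed
  have near: "\<exists>e>0. \<forall>f\<in>F. dist f pone < e \<longrightarrow> f \<in> torus_exp ` M"
  proof (rule ccontr)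
    assume neg: "\<not> (\<exists>e>0. \<forall>f\<in>F. dist f pone < e \<longrightarrow> f \<in> torus_exp ` M)"
    have "\<exists>f. f \<in> F \<and> f \<notin> torus_exp ` M \<and> dist f pone < inverse (real (Suc n))" for n
    proof (rule ccontr)
      assume "\<not> ?thesis"
      then have all: "\<forall>f\<in>F. dist f pone < inverse (real (Suc n)) \<longrightarrow> f \<in> torus_exp ` M" by blast
      have "inverse (real (Suc n)) > 0" by simp
      with all have "\<exists>e>0. \<forall>f\<in>F. dist f pone < e \<longrightarrow> f \<in> torus_exp ` M" by (intro exI[of _ "inverse (real (Suc n))"] conjI)
      with neg show False by (rule notE)
    qed
    then obtain f where f: "\<And>n. f n \<in> F" "\<And>n. f n \<notin> torus_exp ` M" "\<And>n. dist (f n) pone < inverse (real (Suc n))" by metis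
    have "(\<lambda>n. dist (f n) pone) \<longlonglongrightarrow> 0"
      by (rule tendsto_sandwich[OF _ _ tendsto_const LIMSEQ_inverse_real_of_nat])
        (use f(3) less_imp_le in \<open>auto intro!: always_eventually\<close>)
    then have f1: "f \<longlonglongrightarrow> pone" using tendsto_dist_iff by blast
    have fgto: "(\<lambda>n. f n \<odot> g) \<longlonglongrightarrow> g" using tendsto_pmult[OF f1 tendsto_const[of g]] by simp
    have "\<forall>\<^sub>F n in sequentially. f n \<odot> g \<in> ?Z"
    proof -
      have op: "open (- (?C - ?Z))" by (rule open_Compl[OF bd])
      have "g \<in> - (?C - ?Z)" using mem_Orb by simp
      from topological_tendstoD[OF fgto op this] show ?thesis
        by eventually_elim (use fgC[OF f(1)] in blast)
    qed
    then obtain K where K: "\<And>n. n \<ge> K \<Longrightarrow> f n \<odot> g \<in> ?Z" unfolding eventually_sequentially by blast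
    have "\<exists>p. fst p \<in> M \<and> snd p \<in> \<Gamma> \<sigma> \<and> f (n + K) \<odot> g = torus_exp (fst p) \<odot> g \<odot> snd p" for n
    proof -
      have "f (n + K) \<odot> g \<in> ?Z" by (rule K) simp
      then obtain z \<gamma> where "z \<in> M" "\<gamma> \<in> \<Gamma> \<sigma>" "f (n + K) \<odot> g = torus_exp z \<odot> g \<odot> \<gamma>" by (rule OrbE)
      then show ?thesis by (intro exI[of _ "(z, \<gamma>)"]) simp
    qed
    then obtain p where p: "\<And>n. fst (p n) \<in> M \<and> snd (p n) \<in> \<Gamma> \<sigma> \<and> f (n + K) \<odot> g = torus_exp (fst (p n)) \<odot> g \<odot> snd (p n)" by metis
    have lim: "(\<lambda>n. torus_exp (fst (p n)) \<odot> g \<odot> snd (p n)) \<longlonglongrightarrow> g"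
      using LIMSEQ_ignore_initial_segment[OF fgto, of K] p by simp
    obtain r C where r: "strict_mono (r :: nat \<Rightarrow> nat)" "\<And>n. norm (torus_exp (fst (p (r n)))) \<le> C"
    proof (cases rule: real_sequence_subsequence_cases[of "\<lambda>n. norm (torus_exp (fst (p n)))"])
      case (1 r)
      have "recurrent g"
        unfolding recurrent_def using p 1 filterlim_subseq[OF 1(1) lim]
        by (intro exI[of _ "\<lambda>n. fst (p (r n))"] exI[of _ "\<lambda>n. snd (p (r n))"]) (auto simp: o_def)
      then show ?thesis using nrec by simp
    next
      case (2 r)
      then have "\<forall>\<^sub>F n in sequentially. norm (torus_exp (fst (p (r n)))) \<le> -1"
        unfolding filterlim_at_bot o_def by blast
      then obtain n where "norm (torus_exp (fst (p (r n)))) \<le> -1" unfolding eventually_sequentially by blast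
      then show ?thesis using norm_ge_zero[of "torus_exp (fst (p (r n)))"] by linarith
    next
      case (3 r C)
      then show ?thesis using that[of r C] by simp
    qed
    have pM: "fst (p n) \<in> M" "snd (p n) \<in> \<Gamma> \<sigma>" for n using p[of n] by auto
    have s\<gamma>: "snd (p n) = padj g \<odot> (torus_exp (- fst (p n)) \<odot> (f (n + K) \<odot> g))" for n
    proof -
      have "f (n + K) \<odot> g = torus_exp (fst (p n)) \<odot> (g \<odot> snd (p n))" using p[of n] by (simp add: pmult_assoc)
      then show ?thesis
        by (simp add: padj_mult_assoc(1)[OF g] padj_mult_assoc(1)[OF eeM_carrier[OF pM(1)]] flip: padj_torus_exp)
    qed
    have "compact (cball 0 C \<inter> torus_exp ` M)" by (intro compact_Int_closed closed_T compact_cball)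
    moreover have "\<forall>n. torus_exp (fst (p (r n))) \<in> cball 0 C \<inter> torus_exp ` M" using r(2) pM(1) by simp
    ultimately obtain t u where tu: "t \<in> cball 0 C \<inter> torus_exp ` M" "strict_mono (u :: nat \<Rightarrow> nat)" "((\<lambda>n. torus_exp (fst (p (r n)))) \<circ> u) \<longlonglongrightarrow> t"
      unfolding compact_def by meson
    define m where "m n = r (u n)" for n
    have m: "strict_mono m" unfolding m_def using r(1) tu(2) by (simp add: strict_mono_def)
    have tt: "(\<lambda>n. torus_exp (fst (p (m n)))) \<longlonglongrightarrow> t" using tu(3) by (simp add: o_def m_def)
    have fm: "(\<lambda>n. f (m n + K) \<odot> g) \<longlonglongrightarrow> g"
      using filterlim_subseq[OF m LIMSEQ_ignore_initial_segment[OF fgto, of K]] .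
    have "(\<lambda>n. snd (p (m n))) \<longlonglongrightarrow> padj g \<odot> (padj t \<odot> g)"
      unfolding s\<gamma> padj_torus_exp[symmetric] by (intro tendsto_pmult tendsto_padj tendsto_const tt fm)
    moreover have "eventually (\<lambda>n. snd (p (m n)) = \<delta>) sequentially" if "(\<lambda>n. snd (p (m n))) \<longlonglongrightarrow> \<delta>" for \<delta>
    proof -
      have "Bseq (\<lambda>n. snd (p (m n)))" using that convergent_imp_Bseq convergentI by blast
      then obtain R where R: "\<And>n. norm (snd (p (m n))) \<le> R" by (rule BseqE) blast
      let ?S = "{\<gamma> \<in> \<Gamma> \<sigma>. norm \<gamma> \<le> R} - {\<delta>}"
      have op: "open (- ?S)" using finite_bounded_\<Gamma>[of R] by (intro open_Compl finite_imp_closed) simp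
      have "\<delta> \<in> - ?S" by simp
      from topological_tendstoD[OF that op this] show ?thesis
        by eventually_elim (use pM(2) R in auto)
    qed
    ultimately obtain \<delta> where "eventually (\<lambda>n. snd (p (m n)) = \<delta>) sequentially" by blast
    then obtain L where L: "\<And>n. n \<ge> L \<Longrightarrow> snd (p (m n)) = \<delta>" unfolding eventually_sequentially by blast
    have \<delta>: "\<delta> \<in> \<Gamma> \<sigma>" using L[of L] pM(2)[of "m L"] by simp
    define d where "d = g \<odot> \<delta> \<odot> padj g"
    have dc: "d \<in> carrier (G \<sigma>)" using g \<Gamma>_carrier[OF \<delta>] by (simp add: d_def)
    have fd: "f (m (n + L) + K) = torus_exp (fst (p (m (n + L)))) \<odot> d" for n
    proof -
      have "f (m (n + L) + K) \<odot> g = torus_exp (fst (p (m (n + L)))) \<odot> g \<odot> \<delta>" using p[of "m (n + L)"] L[of "n + L"] by simp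
      then have "f (m (n + L) + K) \<odot> g \<odot> padj g = torus_exp (fst (p (m (n + L)))) \<odot> g \<odot> \<delta> \<odot> padj g" by simp
      then show ?thesis using padj_mult(2)[OF g] by (simp add: pmult_assoc d_def)
    qed
    have lim_d: "(\<lambda>n. f (m (n + L) + K) \<odot> padj d) \<longlonglongrightarrow> pone \<odot> padj d"
    proof (intro tendsto_pmult tendsto_const)
      have "(\<lambda>n. f (m n + K)) \<longlonglongrightarrow> pone" by (rule filterlim_subseq[OF m LIMSEQ_ignore_initial_segment[OF f1]])
      then show "(\<lambda>n. f (m (n + L) + K)) \<longlonglongrightarrow> pone" by (rule LIMSEQ_ignore_initial_segment)
    qed
    have mem_T: "f (m (n + L) + K) \<odot> padj d \<in> torus_exp ` M" for n
      unfolding fd using padj_mult(2)[OF dc] pM(1) by (simp add: pmult_assoc)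
    have "pone \<odot> padj d \<in> torus_exp ` M" by (rule closed_sequentially[OF closed_T mem_T lim_d])
    then obtain w where w: "w \<in> M" "padj d = torus_exp w" by auto
    have "f (m (0 + L) + K) = f (m (0 + L) + K) \<odot> padj d \<odot> torus_exp (- w)"
      unfolding w(2) by (simp add: pmult_assoc flip: torus_exp_add)
    also have "f (m (0 + L) + K) \<odot> padj d = torus_exp (fst (p (m (0 + L))))"
      unfolding fd using padj_mult(2)[OF dc] by (simp only: pmult_assoc pmult_pone)
    also have "torus_exp (fst (p (m (0 + L)))) \<odot> torus_exp (- w) = torus_exp (fst (p (m (0 + L))) + - w)"
      by (rule torus_exp_add[symmetric])
    also have "\<dots> \<in> torus_exp ` M" by (intro imageI M_ops(1) M_ops(2) w(1) pM(1))
    finally show False using f(2) by blast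
  qed
  then obtain e where e: "e > 0" "\<forall>f\<in>F. dist f pone < e \<longrightarrow> f \<in> torus_exp ` M" by (elim exE conjE) (rule that)
  have conj: "f \<odot> torus_exp z \<odot> padj f \<in> torus_exp ` M" if f: "f \<in> F" and z: "z \<in> M" for f z
  proof -
    \<comment> \<open>The conjugate torus is a connected subset of \<open>F\<close> that meets the open and closed subgroup \<open>torus_exp ` M\<close>.\<close>
    define A where "A = (\<lambda>z. f \<odot> torus_exp z \<odot> padj f) ` M"
    have AF: "A \<subseteq> F" unfolding A_def using Fmult Finv TF f by blast
    have "connected A"
      unfolding A_def by (intro connected_continuous_image convex_connected subspace_imp_convex subspace_M
          continuous_on_pmult continuous_on_const continuous_on_torus_exp continuous_on_id)
    moreover have "closedin (top_of_set A) (A \<inter> torus_exp ` M)" by (intro closedin_closed_Int closed_T)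
    moreover have "openin (top_of_set A) (A \<inter> torus_exp ` M)"
    proof -
      define U where "U = (\<Union>z\<in>M. (\<lambda>x. torus_exp (- z) \<odot> x) -` ball pone e)"
      have "open ((\<lambda>x. c \<odot> x) -` ball pone e)" for c :: "complex^2^2^'r"
        using continuous_on_pmult[OF continuous_on_const[of UNIV c] continuous_on_id]
        by (intro continuous_open_vimage) (simp_all add: continuous_on_eq_continuous_at)
      then have "open U" unfolding U_def by blast
      moreover have "A \<inter> torus_exp ` M = A \<inter> U"
      proof
        show "A \<inter> torus_exp ` M \<subseteq> A \<inter> U"
        proof
          fix x assume x: "x \<in> A \<inter> torus_exp ` M"
          then obtain w where w: "w \<in> M" "x = torus_exp w" by blast
          have "torus_exp (- w) \<odot> x = pone" unfolding w(2) by (simp flip: torus_exp_add)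
          then have "x \<in> U" unfolding U_def using w(1) e(1) by (intro UN_I[of w]) auto
          then show "x \<in> A \<inter> U" using x by blast
        qed
        show "A \<inter> U \<subseteq> A \<inter> torus_exp ` M"
        proof
          fix x assume x: "x \<in> A \<inter> U"
          then obtain w where w: "w \<in> M" "dist pone (torus_exp (- w) \<odot> x) < e" unfolding U_def by auto
          have "torus_exp (- w) \<odot> x \<in> F" using x AF by (intro Fmult TF M_ops(2) w(1)) blast
          then obtain v where v: "v \<in> M" "torus_exp (- w) \<odot> x = torus_exp v" using e(2) w(2) by (auto simp: dist_commute)
          have "x = torus_exp w \<odot> (torus_exp (- w) \<odot> x)" by (simp add: pmult_assoc[symmetric] flip: torus_exp_add)
          also have "\<dots> = torus_exp (w + v)" unfolding v(2) torus_exp_add ..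
          finally show "x \<in> A \<inter> torus_exp ` M" using x M_ops(1)[OF w(1) v(1)] by blast
        qed
      qed
      ultimately show ?thesis by (simp add: openin_open_Int)
    qed
    ultimately have "A \<inter> torus_exp ` M = {} \<or> A \<inter> torus_exp ` M = A" unfolding connected_clopen by blast
    moreover have "pone \<in> A \<inter> torus_exp ` M"
    proof
      show "pone \<in> A" unfolding A_def using M_ops(4) padj_mult(2)[OF Fc[OF f]] by (intro image_eqI[of _ _ 0]) auto
      show "pone \<in> torus_exp ` M" using M_ops(4) by (metis torus_exp_0 imageI)
    qed
    ultimately have "A \<subseteq> torus_exp ` M" by blast
    then show ?thesis unfolding A_def using z by blast
  qed
  have "?C \<subseteq> ?Z"
  proof
    fix y assume y: "y \<in> ?C"
    obtain f \<gamma> where f: "f \<in> F" "\<gamma> \<in> \<Gamma> \<sigma>" "y = f \<odot> g \<odot> \<gamma>" using CE[OF y] by (elim bexE) (rule that)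
    have fc: "f \<in> carrier (G \<sigma>)" by (rule Fc[OF f(1)])
    obtain s where s: "\<forall>n. s n \<in> ?Z" "s \<longlonglongrightarrow> f \<odot> g"
      using fgC[OF f(1)] unfolding closure_sequential by (elim exE conjE) (rule that)
    have "(\<lambda>n. padj f \<odot> s n) \<longlonglongrightarrow> padj f \<odot> (f \<odot> g)" by (intro tendsto_pmult tendsto_const s)
    then have lim: "(\<lambda>n. padj f \<odot> s n) \<longlonglongrightarrow> g" unfolding padj_mult_assoc(1)[OF fc] .
    have "padj f \<odot> s n \<in> ?C" for n
    proof -
      have "s n \<in> ?Z" using s(1) by simp
      then obtain z \<gamma>' where z: "z \<in> M" "\<gamma>' \<in> \<Gamma> \<sigma>" "s n = torus_exp z \<odot> g \<odot> \<gamma>'" by (rule OrbE)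
      have "padj f \<odot> s n = (padj f \<odot> torus_exp z) \<odot> g \<odot> \<gamma>'" unfolding z(3) by (simp add: pmult_assoc)
      then show ?thesis using closure_Orb_right[OF fgC[OF Fmult[OF Finv[OF f(1)] TF[OF z(1)]]] z(2)] by simp
    qed
    from escape[OF this lim mem_Orb] obtain n where n: "padj f \<odot> s n \<in> ?Z" by blast
    obtain w \<beta> where w: "w \<in> M" "\<beta> \<in> \<Gamma> \<sigma>" "padj f \<odot> s n = torus_exp w \<odot> g \<odot> \<beta>" using n by (rule OrbE)
    have "s n \<in> ?Z" using s(1) by simp
    then obtain z \<gamma>' where z: "z \<in> M" "\<gamma>' \<in> \<Gamma> \<sigma>" "s n = torus_exp z \<odot> g \<odot> \<gamma>'" by (rule OrbE)
    obtain c where c: "c \<in> M" "f \<odot> torus_exp (- w) \<odot> padj f = torus_exp c" using conj[OF f(1) M_ops(2)[OF w(1)]] by auto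
    have "f \<odot> (torus_exp w \<odot> g \<odot> \<beta>) = s n" unfolding w(3)[symmetric] by (rule padj_mult_assoc(2)[OF fc])
    then have 1: "f \<odot> torus_exp w \<odot> g = s n \<odot> padj \<beta>"
      using padj_mult(2)[OF \<Gamma>_carrier[OF w(2)]] by (metis pmult_assoc pmult_pone(2))
    have "f \<odot> g = f \<odot> torus_exp (- w) \<odot> (padj f \<odot> f) \<odot> torus_exp w \<odot> g"
      unfolding padj_mult(1)[OF fc] by (simp add: pmult_assoc) (simp add: pmult_assoc[symmetric] flip: torus_exp_add)
    also have "\<dots> = torus_exp c \<odot> (f \<odot> torus_exp w \<odot> g)" unfolding c(2)[symmetric] by (simp add: pmult_assoc)
    also have "\<dots> = torus_exp c \<odot> (s n \<odot> padj \<beta>)" unfolding 1 ..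
    also have "\<dots> \<in> ?Z" using s(1) by (intro Orb_left Orb_right c(1) \<Gamma>_closed(2) w(2)) simp
    finally show "y \<in> ?Z" unfolding f(3) by (rule Orb_right[OF _ f(2)])
  qed
  then have "?C = ?Z" using closure_subset by blast
  then show False using proper unfolding orbit_closure_Orb[OF g] coset_orbit_Orb[OF g] by simp
qed

lemma orbit_open_in_closure:
  assumes g: "g \<in> carrier (G \<sigma>)" and bd: "closed (closure (Orb g) - Orb g)"
  shows "openin (subtopology (quot_top \<sigma>) (orbit_closure \<sigma> (torus_exp ` M) (\<pi> \<sigma> g))) (coset_orbit \<sigma> (torus_exp ` M) (\<pi> \<sigma> g))"
proof -
  let ?B = "closure (Orb g) - Orb g"
  have Bc: "?B \<subseteq> carrier (G \<sigma>)" using closure_Orb_carrier[OF g] by blast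
  have Br: "\<forall>s\<in>?B. \<forall>\<gamma>\<in>\<Gamma> \<sigma>. s \<odot> \<gamma> \<in> ?B"
    by (intro ballI boundary_right[OF g])
  have cl: "closedin (quot_top \<sigma>) (\<pi> \<sigma> ` ?B)"
    by (rule closedin_\<pi>_image[OF Bc Br bd])
  define U where "U = topspace (quot_top \<sigma>) - \<pi> \<sigma> ` ?B"
  have "openin (quot_top \<sigma>) U" unfolding U_def using cl by (rule openin_diff[OF openin_topspace])
  moreover have "\<pi> \<sigma> ` Orb g = U \<inter> \<pi> \<sigma> ` closure (Orb g)"
  proof
    show "\<pi> \<sigma> ` Orb g \<subseteq> U \<inter> \<pi> \<sigma> ` closure (Orb g)"
    proof (rule image_subsetI)
      fix s assume s: "s \<in> Orb g"
      then have sc: "s \<in> carrier (G \<sigma>)" using Orb_carrier[OF g] by blast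
      have "\<pi> \<sigma> s \<notin> \<pi> \<sigma> ` ?B"
      proof
        assume "\<pi> \<sigma> s \<in> \<pi> \<sigma> ` ?B"
        from right_invariant_mem[OF Bc Br sc this] show False using s by simp
      qed
      then show "\<pi> \<sigma> s \<in> U \<inter> \<pi> \<sigma> ` closure (Orb g)"
        using sc s closure_subset[of "Orb g"] by (auto simp: U_def topspace_quot_top)
    qed
    show "U \<inter> \<pi> \<sigma> ` closure (Orb g) \<subseteq> \<pi> \<sigma> ` Orb g" unfolding U_def by blast
  qed
  ultimately show ?thesis
    unfolding orbit_closure_Orb[OF g] coset_orbit_Orb[OF g] openin_subtopology by blast
qed

lemma locally_divergent_orbit_closure:
  assumes g: "g \<in> carrier (G \<sigma>)" and I: "I = {i, i'}" "i \<noteq> i'"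
    and ld: "locally_divergent \<sigma> I (\<pi> \<sigma> g)"
    and nt: "\<not> torus_orbit \<sigma> (orbit_closure \<sigma> (torus_exp ` M) (\<pi> \<sigma> g))"
  shows "openin (subtopology (quot_top \<sigma>) (orbit_closure \<sigma> (torus_exp ` M) (\<pi> \<sigma> g))) (coset_orbit \<sigma> (torus_exp ` M) (\<pi> \<sigma> g))
       \<and> coset_orbit \<sigma> (torus_exp ` M) (\<pi> \<sigma> g) \<subset> orbit_closure \<sigma> (torus_exp ` M) (\<pi> \<sigma> g)
       \<and> \<not> homogeneous_closure \<sigma> (torus_exp ` M) (\<pi> \<sigma> g)"
proof -
  have rat: "\<forall>j\<in>I. \<forall>a. \<exists>x y. algebraic_int x \<and> algebraic_int y \<and> (x \<noteq> 0 \<or> y \<noteq> 0) \<and> row_form g j a x y = 0"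
  proof (intro ballI allI)
    fix j a assume "j \<in> I"
    then have "divergent \<sigma> (D \<sigma> {j}) (\<pi> \<sigma> g)" using ld unfolding locally_divergent_def by (rule bspec[rotated])
    then show "\<exists>x y. algebraic_int x \<and> algebraic_int y \<and> (x \<noteq> 0 \<or> y \<noteq> 0) \<and> row_form g j a x y = 0"
      by (rule divergent_imp_rational_zero[OF g])
  qed
  have nrec: "\<not> recurrent g"
  proof
    assume "recurrent g"
    from recurrent_imp_rational[OF g this I rat] obtain q where q: "q \<in> SL2 UNIV" "\<forall>j\<in>I. monomial2 ((g \<odot> emb q) $ j)"
      by (elim bexE) (rule that)
    then have "torus_orbit \<sigma> (orbit_closure \<sigma> (torus_exp ` M) (\<pi> \<sigma> g))"
      by (intro rational_imp_torus_orbit[OF g]) auto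
    then show False using nt by simp
  qed
  have bd: "closed (closure (Orb g) - Orb g)" by (rule closed_boundary[OF g nrec])
  have ne: "coset_orbit \<sigma> (torus_exp ` M) (\<pi> \<sigma> g) \<noteq> orbit_closure \<sigma> (torus_exp ` M) (\<pi> \<sigma> g)"
    using closed_orbit_imp_torus_orbit[OF g] nt by metis
  have "coset_orbit \<sigma> (torus_exp ` M) (\<pi> \<sigma> g) \<subseteq> orbit_closure \<sigma> (torus_exp ` M) (\<pi> \<sigma> g)"
    unfolding orbit_closure_Orb[OF g] coset_orbit_Orb[OF g] by (intro image_mono closure_subset)
  then show ?thesis
    using orbit_open_in_closure[OF g bd] open_orbit_not_homogeneous[OF g bd nrec ne] ne by blast
qed

end

context arch_number_field
begin

lemma torus_action_D: "torus_action \<sigma> {z \<in> Lie. \<forall>j. j \<notin> I \<longrightarrow> z $ j = 0} I"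
proof
  show "subspace {z \<in> Lie. \<forall>j. j \<notin> I \<longrightarrow> z $ j = 0}"
    using subspace_Lie unfolding subspace_def by auto
  show "closed (torus_exp ` {z \<in> Lie. \<forall>j. j \<notin> I \<longrightarrow> z $ j = 0})"
    unfolding D_eq[symmetric] by (rule closed_D)
  show "(\<chi> j. if s j then - z $ j else z $ j) \<in> {z \<in> Lie. \<forall>j. j \<notin> I \<longrightarrow> z $ j = 0}"
    if "z \<in> {z \<in> Lie. \<forall>j. j \<notin> I \<longrightarrow> z $ j = 0}" for s z
    using that by (auto simp: Lie_def completion_closed(3))
qed auto

text \<open>The sign changes preserve both Lie algebras because each is cut out place by place.\<close>

lemma torus_action_DR: "torus_action \<sigma> {z. \<forall>j. z $ j \<in> (if j \<in> I then \<real> else {0})} I"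
proof
  show "subspace {z::complex^'r. \<forall>j. z $ j \<in> (if j \<in> I then \<real> else {0})}"
    unfolding subspace_def by (auto simp: complex_is_Real_iff)
  show "{z::complex^'r. \<forall>j. z $ j \<in> (if j \<in> I then \<real> else {0})} \<subseteq> Lie"
  proof
    fix z :: "complex^'r" assume z: "z \<in> {z. \<forall>j. z $ j \<in> (if j \<in> I then \<real> else {0})}"
    have "z $ j \<in> arch_completion (\<sigma> j)" for j
    proof -
      have "z $ j \<in> \<real>" using z by (cases "j \<in> I") (auto dest: spec[of _ j])
      then show ?thesis using completion_closed(5) by (auto elim!: Reals_cases)
    qed
    then show "z \<in> Lie" by (simp add: Lie_def)
  qed
  show "z $ j = 0" if "z \<in> {z. \<forall>j. z $ j \<in> (if j \<in> I then \<real> else {0})}" "j \<notin> I" for z :: "complex^'r" and j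
    using that by (auto dest: spec[of _ j])
  show "closed (torus_exp ` {z::complex^'r. \<forall>j. z $ j \<in> (if j \<in> I then \<real> else {0})})"
    unfolding DR_eq[symmetric] by (rule closed_DR)
  show "(\<chi> j. if s j then - z $ j else z $ j) \<in> {z. \<forall>j. z $ j \<in> (if j \<in> I then \<real> else {0})}"
    if z: "z \<in> {z. \<forall>j. z $ j \<in> (if j \<in> I then \<real> else {0})}" for s and z :: "complex^'r"
  proof (intro CollectI allI)
    fix j
    have "z $ j \<in> (if j \<in> I then \<real> else {0})" using z by blast
    then show "(\<chi> j. if s j then - z $ j else z $ j) $ j \<in> (if j \<in> I then \<real> else {0})"
      by (cases "j \<in> I") auto
  qed
qed

end

theorem corollary1p2:
  fixes \<sigma> :: "'r::finite \<Rightarrow> 'k::field_char_0 \<Rightarrow> complex"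
    and I :: "'r set"
    and T :: "(complex^2^2^'r) set"
    and g :: "complex^2^2^'r"
  assumes "number_field TYPE('k)"
    and "archimedean_places \<sigma>"
    and "CARD('r) \<ge> 2"
    and "card I = 2"
    and "T = D \<sigma> I \<or> T = DR \<sigma> I"
    and "g \<in> carrier (G \<sigma>)"
    and "locally_divergent \<sigma> I (\<pi> \<sigma> g)"
    and "\<not> torus_orbit \<sigma> (orbit_closure \<sigma> T (\<pi> \<sigma> g))"
  shows "openin (subtopology (quot_top \<sigma>) (orbit_closure \<sigma> T (\<pi> \<sigma> g))) (coset_orbit \<sigma> T (\<pi> \<sigma> g))
       \<and> coset_orbit \<sigma> T (\<pi> \<sigma> g) \<subset> orbit_closure \<sigma> T (\<pi> \<sigma> g)
       \<and> \<not> homogeneous_closure \<sigma> T (\<pi> \<sigma> g)"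
proof -
  interpret arch_number_field \<sigma>
    by unfold_locales (fact assms(1), fact assms(2))
  obtain i i' where I: "I = {i, i'}" "i \<noteq> i'"
    using assms(4) by (auto simp: card_2_iff)
  obtain M where M: "torus_action \<sigma> M I" "T = torus_exp ` M"
    using assms(5)
  proof
    assume "T = D \<sigma> I"
    then show thesis using that[OF torus_action_D[of I]] by (simp add: D_eq)
  next
    assume "T = DR \<sigma> I"
    then show thesis using that[OF torus_action_DR[of I]] by (simp add: DR_eq)
  qed
  interpret torus_action \<sigma> M I by (rule M(1))
  show ?thesis
    using locally_divergent_orbit_closure[OF assms(6) I assms(7)] assms(8) unfolding M(2) by blast
qed

end
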